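(* Let $p$ be an odd prime and let $k$ be a field of characteristic not $p$ containing a primitive $p^2$-th root of unity $\zeta_{p^2}$; put $\zeta=\zeta_{p^2}^p$. For each of the following groups $G$ of order $p^6$, $G$ is realizable as a Galois group over $k$ if and only if there exist $a_1,a_2\in k^\times$, independent modulo $k^{\times p}$, such that the listed element is trivial in $\mathrm{Br}(k)$. 1. $\Phi_{14}(42)=\langle\alpha_1,\alpha_2,\beta:[\alpha_1,\alpha_2]=\beta,\ \alpha_1^{p^2}=\beta,\ \alpha_2^{p^2}=\beta^{p^2}=1\rangle$: $(a_1,\zeta_{p^2}a_2;\zeta_{p^2})$. 2. $\Phi_{14}(321)=\langle\alpha_1,\alpha_2,\beta:[\alpha_1,\alpha_2]=\beta,\ \alpha_1^{p^2}=\beta^p,\ \alpha_2^{p^2}=\beta^{p^2}=1\rangle$: $(a_1,\zeta a_2;\zeta_{p^2})$. 3. $\Phi_{14}(222)=\langle\alpha_1,\alpha_2,\beta:[\alpha_1,\alpha_2]=\beta,\ \alpha_1^{p^2}=\alpha_2^{p^2}=\beta^{p^2}=1\rangle$: $(a_1,a_2;\zeta_{p^2})$. In all three presentations $\beta$ commutes with $\alpha_1$ and $\alpha_2$.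
   Context: $[x,y]=x^{-1}y^{-1}xy$. A finite group $G$ is realizable as a Galois group over $k$ if there is a Galois field extension $M/k$ with $\mathrm{Gal}(M/k)\cong G$. Elements of $k^\times$ are independent modulo $k^{\times p}$ if their classes are linearly independent in the $\mathbb F_p$-vector space $k^\times/k^{\times p}$. For $a,b\in k^\times$, $(a,b;\zeta_{p^2})\in\mathrm{Br}(k)$ is the class of the cyclic $k$-algebra generated by $i_1,i_2$ with $i_1^{p^2}=b$, $i_2^{p^2}=a$, $i_1i_2=\zeta_{p^2}i_2i_1$. *)

theory Defs
  imports
    "HOL-Algebra.Algebraic_Closure_Type"
    "HOL-Algebra.Bij"
    "HOL-Algebra.Module"
    "HOL-Algebra.QuotRing"
    "HOL-Library.Poly_Mapping"
begin

section \<open>Groups given by generators and relations\<close>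

text \<open>
  A group word over \<open>'g\<close> is a list of signed letters: \<open>(g, False)\<close> stands for the generator
  \<open>g\<close> and \<open>(g, True)\<close> for its inverse. A relation is a pair \<open>(l, r)\<close> of words, read as \<open>l = r\<close>.
\<close>

type_synonym 'g gword = "('g \<times> bool) list"

definition gen :: "'g \<Rightarrow> 'g gword"
  where "gen g = [(g, False)]"

definition winv :: "'g gword \<Rightarrow> 'g gword"
  where "winv w = rev (map (\<lambda>(g, s). (g, \<not> s)) w)"

definition wpow :: "'g gword \<Rightarrow> nat \<Rightarrow> 'g gword"
  where "wpow w n = concat (replicate n w)"

definition wcomm :: "'g gword \<Rightarrow> 'g gword \<Rightarrow> 'g gword"
  where "wcomm x y = winv x @ winv y @ x @ y"

inductive word_eq :: "('g gword \<times> 'g gword) set \<Rightarrow> 'g gword \<Rightarrow> 'g gword \<Rightarrow> bool"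
  for R where
  refl: "word_eq R w w"
| sym: "word_eq R v w \<Longrightarrow> word_eq R w v"
| trans: "word_eq R u v \<Longrightarrow> word_eq R v w \<Longrightarrow> word_eq R u w"
| cancel: "word_eq R (u @ [(g, s), (g, \<not> s)] @ v) (u @ v)"
| relation: "(l, r) \<in> R \<Longrightarrow> word_eq R (u @ l @ v) (u @ r @ v)"

definition word_rel :: "('g gword \<times> 'g gword) set \<Rightarrow> ('g gword \<times> 'g gword) set"
  where "word_rel R = {(v, w). word_eq R v w}"

text \<open>The group \<open>\<langle>'g : R\<rangle>\<close>: every element of the type \<open>'g\<close> is a generator.\<close>

definition presented_group :: "('g gword \<times> 'g gword) set \<Rightarrow> 'g gword set monoid"
  where "presented_group R =
    \<lparr>carrier = UNIV // word_rel R,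
     monoid.mult = (\<lambda>U V. \<Union>x\<in>U. \<Union>y\<in>V. word_rel R `` {x @ y}),
     one = word_rel R `` {[]}\<rparr>"

lemma equiv_word_rel: "equiv UNIV (word_rel R)"
  by (rule equivI)
    (auto simp: word_rel_def refl_on_def sym_def trans_def
      intro: word_eq.refl word_eq.sym word_eq.trans)

lemma word_eq_context: "word_eq R v w \<Longrightarrow> word_eq R (x @ v @ y) (x @ w @ y)"
proof (induction rule: word_eq.induct)
  case (cancel u g s v)
  show ?case using word_eq.cancel[of R "x @ u" g s "v @ y"] by simp
next
  case (relation l r u v)
  then show ?case using word_eq.relation[of l r R "x @ u" "v @ y"] by simp
qed (auto intro: word_eq.refl word_eq.sym word_eq.trans)

lemma word_eq_append:
  assumes "word_eq R v v'" "word_eq R w w'"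
  shows "word_eq R (v @ w) (v' @ w')"
  using word_eq_context[OF assms(1), of "[]" w] word_eq_context[OF assms(2), of v' "[]"]
  by (auto intro: word_eq.trans)

lemma word_eq_winv_left: "word_eq R (winv w @ w) []"
proof (induction w)
  case (Cons a w)
  obtain g s where a: "a = (g, s)" by force
  have "word_eq R (winv w @ [(g, \<not> s), (g, \<not> \<not> s)] @ w) (winv w @ w)"
    by (rule word_eq.cancel)
  then show ?case using Cons by (auto simp: a winv_def intro: word_eq.trans)
qed (simp add: winv_def word_eq.refl)

lemma presented_group_mult:
  "monoid.mult (presented_group R) (word_rel R `` {v}) (word_rel R `` {w}) = word_rel R `` {v @ w}"
proof -
  have "congruent2 (word_rel R) (word_rel R) (\<lambda>x y. word_rel R `` {x @ y})"
    by (intro congruent2I' equiv_class_eq[OF equiv_word_rel])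
      (auto simp: word_rel_def intro: word_eq_append)
  from UN_equiv_class2[OF equiv_word_rel equiv_word_rel this]
  show ?thesis by (simp add: presented_group_def)
qed

lemma group_presented_group: "group (presented_group R)"
proof (rule groupI)
  fix U V assume "U \<in> carrier (presented_group R)" "V \<in> carrier (presented_group R)"
  then obtain x y where "U = word_rel R `` {x}" "V = word_rel R `` {y}"
    by (auto simp: presented_group_def elim!: quotientE)
  then show "U \<otimes>\<^bsub>presented_group R\<^esub> V \<in> carrier (presented_group R)"
    by (simp only: presented_group_mult) (simp add: presented_group_def quotientI)
next
  show "\<one>\<^bsub>presented_group R\<^esub> \<in> carrier (presented_group R)"
    by (simp add: presented_group_def quotientI)
next
  fix U V W assume "U \<in> carrier (presented_group R)" "V \<in> carrier (presented_group R)"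
    "W \<in> carrier (presented_group R)"
  then obtain x y z where
    "U = word_rel R `` {x}" "V = word_rel R `` {y}" "W = word_rel R `` {z}"
    by (auto simp: presented_group_def elim!: quotientE)
  then show "U \<otimes>\<^bsub>presented_group R\<^esub> V \<otimes>\<^bsub>presented_group R\<^esub> W
      = U \<otimes>\<^bsub>presented_group R\<^esub> (V \<otimes>\<^bsub>presented_group R\<^esub> W)"
    by (simp add: presented_group_mult)
next
  fix U assume "U \<in> carrier (presented_group R)"
  then obtain x where U: "U = word_rel R `` {x}"
    by (auto simp: presented_group_def elim!: quotientE)
  have one: "\<one>\<^bsub>presented_group R\<^esub> = word_rel R `` {[]}"
    by (simp add: presented_group_def)
  show "\<one>\<^bsub>presented_group R\<^esub> \<otimes>\<^bsub>presented_group R\<^esub> U = U"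
    by (simp add: U one presented_group_mult)
  have "word_rel R `` {winv x @ x} = word_rel R `` {[]}"
    by (rule equiv_class_eq[OF equiv_word_rel]) (simp add: word_rel_def word_eq_winv_left)
  moreover have "word_rel R `` {winv x} \<in> carrier (presented_group R)"
    by (simp add: presented_group_def quotientI)
  ultimately show "\<exists>V\<in>carrier (presented_group R).
      V \<otimes>\<^bsub>presented_group R\<^esub> U = \<one>\<^bsub>presented_group R\<^esub>"
    by (metis U one presented_group_mult)
qed

lemma presented_group_relation:
  "(l, r) \<in> R \<Longrightarrow> word_rel R `` {l} = word_rel R `` {r}"
  using word_eq.relation[of l r R "[]" "[]"]
  by (intro equiv_class_eq[OF equiv_word_rel]) (simp add: word_rel_def)


section \<open>The groups \<open>\<Phi>\<^sub>1\<^sub>4(42)\<close>, \<open>\<Phi>\<^sub>1\<^sub>4(321)\<close> and \<open>\<Phi>\<^sub>1\<^sub>4(222)\<close>\<close>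

datatype phi14_gen = Alpha1 | Alpha2 | Beta

definition phi14_relations ::
    "nat \<Rightarrow> phi14_gen gword \<Rightarrow> (phi14_gen gword \<times> phi14_gen gword) set"
  where "phi14_relations p w =
    {(wcomm (gen Alpha1) (gen Alpha2), gen Beta),
     (wpow (gen Alpha1) (p ^ 2), w),
     (wpow (gen Alpha2) (p ^ 2), []),
     (wpow (gen Beta) (p ^ 2), []),
     (wcomm (gen Alpha1) (gen Beta), []),
     (wcomm (gen Alpha2) (gen Beta), [])}"

definition phi14_42 :: "nat \<Rightarrow> phi14_gen gword set monoid"
  where "phi14_42 p = presented_group (phi14_relations p (gen Beta))"

definition phi14_321 :: "nat \<Rightarrow> phi14_gen gword set monoid"
  where "phi14_321 p = presented_group (phi14_relations p (wpow (gen Beta) p))"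

definition phi14_222 :: "nat \<Rightarrow> phi14_gen gword set monoid"
  where "phi14_222 p = presented_group (phi14_relations p [])"


section \<open>Galois groups\<close>

text \<open>
  The base field is the type \<open>'a\<close>, embedded by \<^const>\<open>to_ac\<close> in its algebraic closure. Every
  algebraic extension of \<open>'a\<close> is isomorphic, over \<open>'a\<close>, to an intermediate field \<open>M\<close> of
  \<open>'a alg_closure\<close>, so quantifying over such \<open>M\<close> covers all Galois extensions.
\<close>

definition intermediate_field :: "'a::field alg_closure set \<Rightarrow> bool"
  where "intermediate_field M \<longleftrightarrow>
    subfield M (ring_of_type_algebra :: 'a alg_closure ring) \<and> range to_ac \<subseteq> M"

definition Gal :: "'a::field alg_closure set \<Rightarrow> ('a alg_closure \<Rightarrow> 'a alg_closure) monoid"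
  where "Gal M = BijGroup M \<lparr>carrier := {\<sigma> \<in> Bij M.
      (\<forall>x\<in>M. \<forall>y\<in>M. \<sigma> (x + y) = \<sigma> x + \<sigma> y \<and> \<sigma> (x * y) = \<sigma> x * \<sigma> y) \<and>
      (\<forall>c. \<sigma> (to_ac c) = to_ac c)}\<rparr>"

text \<open>
  An extension is Galois if it is algebraic (automatic here) and the fixed field of its
  automorphism group is the base field.
\<close>

definition galois_extension :: "'a::field alg_closure set \<Rightarrow> bool"
  where "galois_extension M \<longleftrightarrow>
    intermediate_field M \<and> {x \<in> M. \<forall>\<sigma>\<in>carrier (Gal M). \<sigma> x = x} = range to_ac"

definition realizable :: "'a::field itself \<Rightarrow> ('g, 'm) monoid_scheme \<Rightarrow> bool"
  where "realizable k G \<longleftrightarrow>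
    (\<exists>M :: 'a alg_closure set. galois_extension M \<and> Gal M \<cong> G)"


section \<open>Roots of unity and independence modulo \<open>p\<close>-th powers\<close>

definition primitive_root_of_unity :: "nat \<Rightarrow> 'a::field \<Rightarrow> bool"
  where "primitive_root_of_unity n z \<longleftrightarrow>
    n > 0 \<and> z ^ n = 1 \<and> (\<forall>m. 0 < m \<and> m < n \<longrightarrow> z ^ m \<noteq> 1)"

text \<open>
  Linear independence of the classes of \<open>a\<close> and \<open>b\<close> in the vector space of \<open>p\<close>-th power
  classes over the field with \<open>p\<close> elements, with scalars lifted to integers and addition written multiplicatively.
\<close>

definition independent_mod_powers :: "nat \<Rightarrow> 'a::field \<Rightarrow> 'a \<Rightarrow> bool"
  where "independent_mod_powers p a b \<longleftrightarrow> a \<noteq> 0 \<and> b \<noteq> 0 \<and>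
    (\<forall>m n :: int. (\<exists>c. c \<noteq> 0 \<and> a powi m * b powi n = c ^ p) \<longrightarrow> int p dvd m \<and> int p dvd n)"


section \<open>Algebras over a field and Brauer equivalence\<close>

text \<open>
  An algebra over the field \<open>'a\<close> is a (not necessarily commutative) ring with a scalar
  multiplication, stored in a record of type \<open>('a, 'b) module\<close>.
\<close>

definition algebra_iso ::
    "('a::field, 'b, 'm) module_scheme \<Rightarrow> ('a, 'c, 'n) module_scheme \<Rightarrow> bool"
  where "algebra_iso A B \<longleftrightarrow>
    (\<exists>h \<in> ring_iso A B. \<forall>c. \<forall>x\<in>carrier A. h (c \<odot>\<^bsub>A\<^esub> x) = c \<odot>\<^bsub>B\<^esub> h x)"

definition matrix_algebra ::
    "nat \<Rightarrow> ('a::field, 'b, 'm) module_scheme \<Rightarrow> ('a, nat \<times> nat \<Rightarrow> 'b) module"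
  where "matrix_algebra n A =
    \<lparr>carrier = {..<n} \<times> {..<n} \<rightarrow>\<^sub>E carrier A,
     monoid.mult = (\<lambda>U V. \<lambda>(i, j)\<in>{..<n} \<times> {..<n}. \<Oplus>\<^bsub>A\<^esub>l\<in>{..<n}. U (i, l) \<otimes>\<^bsub>A\<^esub> V (l, j)),
     one = (\<lambda>(i, j)\<in>{..<n} \<times> {..<n}. if i = j then \<one>\<^bsub>A\<^esub> else \<zero>\<^bsub>A\<^esub>),
     ring.zero = (\<lambda>_\<in>{..<n} \<times> {..<n}. \<zero>\<^bsub>A\<^esub>),
     add = (\<lambda>U V. \<lambda>ij\<in>{..<n} \<times> {..<n}. U ij \<oplus>\<^bsub>A\<^esub> V ij),
     module.smult = (\<lambda>c U. \<lambda>ij\<in>{..<n} \<times> {..<n}. c \<odot>\<^bsub>A\<^esub> U ij)\<rparr>"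

definition base_algebra :: "('a::field, 'a) module"
  where "base_algebra =
    \<lparr>carrier = UNIV, monoid.mult = (*), one = 1, ring.zero = 0, add = (+),
     module.smult = (*)\<rparr>"

definition brauer_equivalent ::
    "('a::field, 'b, 'm) module_scheme \<Rightarrow> ('a, 'c, 'n) module_scheme \<Rightarrow> bool"
  where "brauer_equivalent A B \<longleftrightarrow>
    (\<exists>m n. m > 0 \<and> n > 0 \<and> algebra_iso (matrix_algebra m A) (matrix_algebra n B))"

text \<open>
  The elements of \<open>Br(k)\<close> are the equivalence classes of central simple algebras, with the class
  of \<open>k\<close> as identity. The condition below does not have to require separately that \<open>A\<close> be
  central simple, since any algebra with a matrix algebra isomorphic to some \<open>M\<^sub>n(k)\<close> is.
\<close>

definition trivial_in_Br :: "('a::field, 'b, 'm) module_scheme \<Rightarrow> bool"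
  where "trivial_in_Br A \<longleftrightarrow> brauer_equivalent A (base_algebra :: ('a, 'a) module)"


section \<open>Cyclic algebras given by generators and relations\<close>

text \<open>
  The free algebra is the monoid algebra (finitely supported functions with convolution) of the
  free monoid, which is written additively to match the library's \<^type>\<open>poly_mapping\<close>.
\<close>

datatype 'g free_monoid = Word "'g list"

instantiation free_monoid :: (type) monoid_add
begin

definition zero_free_monoid :: "'g free_monoid"
  where "zero_free_monoid = Word []"

fun plus_free_monoid :: "'g free_monoid \<Rightarrow> 'g free_monoid \<Rightarrow> 'g free_monoid"
  where "plus_free_monoid (Word v) (Word w) = Word (v @ w)"

instance
proof
  fix a b c :: "'g free_monoid"
  show "a + b + c = a + (b + c)" by (cases a; cases b; cases c) simp
  show "0 + a = a" by (cases a) (simp add: zero_free_monoid_def)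
  show "a + 0 = a" by (cases a) (simp add: zero_free_monoid_def)
qed

end

type_synonym ('g, 'a) free_algebra = "'g free_monoid \<Rightarrow>\<^sub>0 'a"

definition fa_gen :: "'g \<Rightarrow> ('g, 'a::field) free_algebra"
  where "fa_gen g = Poly_Mapping.single (Word [g]) 1"

definition fa_const :: "'a::field \<Rightarrow> ('g, 'a) free_algebra"
  where "fa_const c = Poly_Mapping.single 0 c"

lemma ring_free_algebra:
  "ring (ring_of_type_algebra :: ('g, 'a::field) free_algebra ring)"
proof -
  have "\<exists>y. x + y = 0" "\<exists>y. y + x = 0" for x :: "('g, 'a) free_algebra"
    by (rule exI[of _ "-x"], simp)+
  then show ?thesis
    unfolding ring_of_type_algebra_def
    by unfold_locales (auto simp: algebra_simps Units_def)
qed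

text \<open>The quotient of the free algebra by the two-sided ideal generated by \<open>R\<close>.\<close>

definition presented_algebra ::
    "('g, 'a::field) free_algebra set \<Rightarrow> ('a, ('g, 'a) free_algebra set) module"
  where "presented_algebra R =
    (let F = ring_of_type_algebra; I = Idl\<^bsub>F\<^esub> R; Q = F Quot I in
      \<lparr>carrier = carrier Q, monoid.mult = monoid.mult Q, one = one Q,
       ring.zero = ring.zero Q, add = add Q,
       module.smult = (\<lambda>c U. (I +>\<^bsub>F\<^esub> fa_const c) \<otimes>\<^bsub>Q\<^esub> U)\<rparr>)"

datatype cyclic_gen = I1 | I2

text \<open>
  The algebra \<open>(a, b; z)\<close> of degree \<open>n\<close>: \<open>i\<^sub>1\<^sup>n = b\<close>, \<open>i\<^sub>2\<^sup>n = a\<close> and \<open>i\<^sub>1 i\<^sub>2 = z i\<^sub>2 i\<^sub>1\<close>.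
\<close>

definition cyclic_algebra ::
    "nat \<Rightarrow> 'a::field \<Rightarrow> 'a \<Rightarrow> 'a \<Rightarrow> ('a, (cyclic_gen, 'a) free_algebra set) module"
  where "cyclic_algebra n a b z = presented_algebra
    {fa_gen I1 ^ n - fa_const b,
     fa_gen I2 ^ n - fa_const a,
     fa_gen I1 * fa_gen I2 - fa_const z * fa_gen I2 * fa_gen I1}"

end

theory Submission
  imports Defs
begin

text \<open>
  Put \<open>n = p\<^sup>2\<close>. The three groups differ only in the relation \<open>\<alpha>\<^sub>1\<^sup>n = \<beta>\<^sup>s\<close> with \<open>s = 1, p, 0\<close>. For fixed
  \<open>s\<close>, both sides of the equivalence say that for some independent \<open>a\<^sub>1, a\<^sub>2\<close> the element \<open>z\<^sup>s a\<^sub>2\<close> is the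
  norm of some \<open>y\<close> from \<open>K = k(\<theta>\<^sub>1)\<close>, where \<open>\<theta>\<^sub>1\<^sup>n = a\<^sub>1\<close> and \<open>\<sigma>\<close> generates \<open>Gal(K/k)\<close>.

  Brauer side: given \<open>y\<close>, the cyclic algebra acts faithfully on the \<open>n\<close>-dimensional space \<open>K\<close> by
  \<open>i\<^sub>2 \<mapsto> \<theta>\<^sub>1\<close> and \<open>i\<^sub>1 \<mapsto> y\<sigma>\<close>, so it is a full matrix algebra. Conversely, if \<open>M\<^sub>m(A)\<close> is a matrix
  algebra over \<open>k\<close>, an idempotent matrix unit cuts out a nonzero \<open>A\<close>-module of dimension at most \<open>n\<close>; it is
  generated over \<open>k[i\<^sub>2] = K\<close> by one vector \<open>\<xi>\<close>, and \<open>i\<^sub>1\<xi> = y\<xi>\<close> yields \<open>N(y)\<xi> = i\<^sub>1\<^sup>n\<xi>\<close>.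

  Galois side: given \<open>y\<close> and \<open>\<theta>\<^sub>2\<^sup>n = a\<^sub>2\<close>, Hilbert's theorem 90 provides \<open>\<omega> \<in> K\<close> with
  \<open>\<sigma>\<omega> = (y/\<theta>\<^sub>2)\<^sup>n\<omega>\<close>; on \<open>M = k(\<theta>\<^sub>1, \<theta>\<^sub>2, \<eta>)\<close> with \<open>\<eta>\<^sup>n = \<omega>\<close> the group acts by
  \<open>\<alpha>\<^sub>1\<eta> = (y/\<theta>\<^sub>2)\<eta>\<close>, \<open>\<alpha>\<^sub>2\<eta> = \<eta>\<close>, \<open>\<beta>\<eta> = z\<eta>\<close>. Conversely, independence of automorphisms gives
  eigenvectors \<open>\<theta>\<^sub>1, \<theta>\<^sub>2, \<eta>\<close>, and \<open>y = \<theta>\<^sub>2 \<alpha>\<^sub>1(\<eta>)/\<eta>\<close> has the required norm.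
\<close>

section \<open>Kummer extensions of subfields\<close>

text \<open>Independence is given only modulo p-th powers, whereas every step of the tower has
  degree n = p^2. This suffices because n is a power of p: over a field containing the n-th roots of
  unity, T^n - c is irreducible as soon as c is not a p-th power. At the top step the criterion has
  to be checked for \<omega>, where it follows from \<alpha>2 dividing y/\<theta>2 by z: a p-th root
  of \<omega> in k(\<theta>1, \<theta>2) would force z^p = 1.

  The exponent s enters through \<alpha>1^n, which multiplies \<eta> by the product of the n
  conjugates of y/\<theta>2 under \<sigma>, that is by N(y)/a2 = z^s. The n-th power of this product
  is 1, which is what Hilbert's theorem 90 asks for.

  Relations between automorphisms alone do not identify a group with the presented one. Normal forms
  show that the presented group has at most n^3 elements, and a quotient of the integral Heisenberg
  group shows that they are distinct.

  The bridge between the two sides is \<open>norm_condition\<close>, a divisibility of polynomials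
  over k that mentions neither an extension field nor a choice of root.\<close>

definition subfield_set :: "'c::field set \<Rightarrow> bool" where
  "subfield_set F \<longleftrightarrow> 0 \<in> F \<and> 1 \<in> F \<and> (\<forall>x\<in>F. \<forall>y\<in>F. x + y \<in> F \<and> x * y \<in> F)
    \<and> (\<forall>x\<in>F. - x \<in> F \<and> inverse x \<in> F)"

lemma subfield_set_simps:
  assumes "subfield_set F"
  shows "0 \<in> F" "1 \<in> F" "x \<in> F \<Longrightarrow> y \<in> F \<Longrightarrow> x + y \<in> F" "x \<in> F \<Longrightarrow> y \<in> F \<Longrightarrow> x * y \<in> F"
    "x \<in> F \<Longrightarrow> - x \<in> F" "x \<in> F \<Longrightarrow> inverse x \<in> F"
    "x \<in> F \<Longrightarrow> y \<in> F \<Longrightarrow> x - y \<in> F" "x \<in> F \<Longrightarrow> y \<in> F \<Longrightarrow> x / y \<in> F"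
    "x \<in> F \<Longrightarrow> x ^ i \<in> F"
proof -
  show add: "x \<in> F \<Longrightarrow> y \<in> F \<Longrightarrow> x + y \<in> F" and mult: "x \<in> F \<Longrightarrow> y \<in> F \<Longrightarrow> x * y \<in> F"
    and neg: "x \<in> F \<Longrightarrow> - x \<in> F" and inv: "x \<in> F \<Longrightarrow> inverse x \<in> F"
    and "0 \<in> F" and one: "1 \<in> F" for x y
    using assms by (auto simp: subfield_set_def)
  show "x \<in> F \<Longrightarrow> y \<in> F \<Longrightarrow> x - y \<in> F" using add[OF _ neg, of x y] by simp
  show "x \<in> F \<Longrightarrow> y \<in> F \<Longrightarrow> x / y \<in> F" using mult[OF _ inv, of x y] by (simp add: divide_inverse)
  show "x \<in> F \<Longrightarrow> x ^ i \<in> F" by (induction i) (auto intro: mult one)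
qed

lemma subfield_set_sum:
  assumes "subfield_set F" "\<And>i. i \<in> S \<Longrightarrow> f i \<in> F" shows "sum f S \<in> F"
  using assms(2) by (induction S rule: infinite_finite_induct) (auto intro: subfield_set_simps[OF assms(1)])

lemma subfield_set_prod:
  assumes "subfield_set F" "\<And>i. i \<in> S \<Longrightarrow> f i \<in> F" shows "prod f S \<in> F"
  using assms(2) by (induction S rule: infinite_finite_induct) (auto intro: subfield_set_simps[OF assms(1)])

lemma subfield_set_of_nat: "subfield_set F \<Longrightarrow> of_nat m \<in> F"
  by (induction m) (auto intro: subfield_set_simps)

lemma subfield_set_cancel:
  assumes "subfield_set F" "x \<in> F" "x \<noteq> 0" "x * y \<in> F" shows "y \<in> F"
  using subfield_set_simps(8)[OF assms(1) assms(4) assms(2)] assms(3) by simp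

section \<open>Polynomials with coefficients in a subfield\<close>

definition polys_over :: "'c::field set \<Rightarrow> 'c poly set" where
  "polys_over F = {f. \<forall>i. coeff f i \<in> F}"

lemma polys_over_simps:
  assumes F: "subfield_set F"
  shows "0 \<in> polys_over F" "1 \<in> polys_over F"
    "f \<in> polys_over F \<Longrightarrow> g \<in> polys_over F \<Longrightarrow> f + g \<in> polys_over F"
    "f \<in> polys_over F \<Longrightarrow> g \<in> polys_over F \<Longrightarrow> f - g \<in> polys_over F"
    "f \<in> polys_over F \<Longrightarrow> - f \<in> polys_over F"
    "f \<in> polys_over F \<Longrightarrow> g \<in> polys_over F \<Longrightarrow> f * g \<in> polys_over F"
    "c \<in> F \<Longrightarrow> monom c i \<in> polys_over F" "c \<in> F \<Longrightarrow> [:c:] \<in> polys_over F"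
    "c \<in> F \<Longrightarrow> f \<in> polys_over F \<Longrightarrow> f \<circ>\<^sub>p [:0, c:] \<in> polys_over F"
  unfolding polys_over_def
  by (auto simp: coeff_mult coeff_pcompose_linear coeff_1 coeff_pCons subfield_set_simps[OF F] split: nat.splits
      intro!: subfield_set_sum[OF F])

lemma polys_over_sum:
  assumes "subfield_set F" "\<And>i. i \<in> S \<Longrightarrow> f i \<in> polys_over F" shows "sum f S \<in> polys_over F"
  using assms(2) by (induction S rule: infinite_finite_induct) (auto intro: polys_over_simps[OF assms(1)])

lemma polys_over_prod:
  assumes "subfield_set F" "\<And>i. i \<in> S \<Longrightarrow> f i \<in> polys_over F" shows "prod f S \<in> polys_over F"
  using assms(2) by (induction S rule: infinite_finite_induct) (auto intro: polys_over_simps[OF assms(1)])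

lemma poly_in_subfield:
  assumes "subfield_set F" "f \<in> polys_over F" "x \<in> F" shows "poly f x \<in> F"
  using assms unfolding poly_altdef polys_over_def
  by (auto intro!: subfield_set_sum subfield_set_simps[OF assms(1)])

text \<open>Cancelling a leading term needs only the quotient of two leading coefficients, so
  quotient and remainder keep their coefficients in F.\<close>

lemma polys_over_division:
  assumes F: "subfield_set F" and g: "g \<in> polys_over F" "g \<noteq> 0"
  shows "f \<in> polys_over F \<Longrightarrow>
    \<exists>s\<in>polys_over F. \<exists>r\<in>polys_over F. f = g * s + r \<and> (r = 0 \<or> degree r < degree g)"
proof (induction "degree f" arbitrary: f rule: less_induct)
  case less
  note po = polys_over_simps[OF F]
  show ?case
  proof (cases "f = 0 \<or> degree f < degree g")
    case True
    then show ?thesis using less.prems po by (intro bexI[of _ 0] bexI[of _ f]) auto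
  next
    case False
    define h where "h = monom (lead_coeff f / lead_coeff g) (degree f - degree g)"
    have h: "h \<in> polys_over F"
      using less.prems g unfolding h_def polys_over_def
      by (auto intro!: subfield_set_simps[OF F])
    define f' where "f' = f - g * h"
    have f': "f' \<in> polys_over F" using less.prems g h po by (auto simp: f'_def)
    have "degree (g * h) \<le> degree f"
      using False degree_mult_le[of g h] degree_monom_le[of "lead_coeff f / lead_coeff g" "degree f - degree g"]
      unfolding h_def by linarith
    then have le: "degree f' \<le> degree f" unfolding f'_def by (intro degree_diff_le) auto
    have "coeff (g * h) (degree f) = lead_coeff f"
      using False g by (auto simp: h_def coeff_monom_mult mult.commute[of g])
    then have c0: "coeff f' (degree f) = 0" by (simp add: f'_def)
    show ?thesis
    proof (cases "f' = 0")
      case True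
      then show ?thesis using h po by (intro bexI[of _ h] bexI[of _ 0]) (auto simp: f'_def)
    next
      case nz: False
      then have "degree f' < degree f" using le c0 by (metis leading_coeff_neq_0 order_le_less)
      from less.hyps[OF this f'] obtain s r where "s \<in> polys_over F" "r \<in> polys_over F"
        "f' = g * s + r" "r = 0 \<or> degree r < degree g" by blast
      then show ?thesis using h po
        by (intro bexI[of _ "h + s"] bexI[of _ r]) (auto simp: f'_def algebra_simps)
    qed
  qed
qed

section \<open>Powers of a primitive n-th root of unity\<close>

locale prim_root =
  fixes n :: nat and Z :: "'c::field"
  assumes Z: "primitive_root_of_unity n Z"
begin

lemma n_pos: "n > 0" and Z_n: "Z ^ n = 1"
  using Z by (auto simp: primitive_root_of_unity_def)

lemma Z_nz: "Z \<noteq> 0"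
  using n_pos Z_n by (auto simp: zero_power)

lemma Z_pow_n: "(Z ^ i) ^ n = 1"
  by (metis Z_n mult.commute power_mult power_one)

lemma Z_mod: "Z ^ (i mod n) = Z ^ i"
proof -
  have "Z ^ i = Z ^ (n * (i div n) + i mod n)" by simp
  also have "\<dots> = Z ^ (i mod n)" by (simp only: power_add power_mult Z_n) simp
  finally show ?thesis by simp
qed

lemma Z_eq_1: "Z ^ i = 1 \<longleftrightarrow> n dvd i"
proof
  assume "Z ^ i = 1"
  then have "Z ^ (i mod n) = 1" by (simp add: Z_mod)
  moreover have "i mod n < n" using n_pos by simp
  ultimately have "i mod n = 0" using Z by (auto simp: primitive_root_of_unity_def)
  then show "n dvd i" by auto
next
  assume "n dvd i" then show "Z ^ i = 1" using Z_mod[of i] by auto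
qed

lemma Z_inj: assumes "Z ^ i = Z ^ j" "i < n" "j < n" shows "i = j"
proof -
  have *: "i = j" if "Z ^ i = Z ^ j" "i \<le> j" "j < n" for i j
  proof -
    have "Z ^ j = Z ^ i * Z ^ (j - i)" using that by (metis le_add_diff_inverse power_add)
    then have "Z ^ i * Z ^ (j - i) = Z ^ i * 1" using that by simp
    then have "Z ^ (j - i) = 1" using Z_nz by simp
    then have "n dvd j - i" by (simp add: Z_eq_1)
    then show ?thesis using that n_pos by (auto dest!: dvd_imp_le)
  qed
  show ?thesis using *[of i j] *[of j i] assms by (cases "i \<le> j") auto
qed

text \<open>The n powers of Z below n are already n distinct roots of T^n - 1, and a nonzero
  polynomial of degree at most n has no more.\<close>

lemma root_of_unity: assumes "x ^ n = 1" shows "\<exists>i<n. x = Z ^ i"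
proof -
  define q :: "'c poly" where "q = monom 1 n - 1"
  have pq: "poly q y = y ^ n - 1" for y by (simp add: q_def poly_monom)
  have dq: "degree q \<le> n" unfolding q_def by (intro degree_diff_le) (auto simp: degree_monom_le)
  have "coeff q n = 1" using n_pos by (simp add: q_def)
  then have q0: "q \<noteq> 0" by auto
  have fin: "finite {y. poly q y = 0}" by (rule poly_roots_finite[OF q0])
  have sub: "(\<lambda>i. Z ^ i) ` {..<n} \<subseteq> {y. poly q y = 0}"
    by (auto simp: pq Z_pow_n)
  have "card ((\<lambda>i. Z ^ i) ` {..<n}) = n"
    by (subst card_image) (auto simp: inj_on_def intro: Z_inj)
  moreover have "card {y. poly q y = 0} \<le> n"
    using card_poly_roots_bound[OF q0] dq by simp
  ultimately have "(\<lambda>i. Z ^ i) ` {..<n} = {y. poly q y = 0}"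
    using card_mono[OF fin sub] by (intro card_subset_eq[OF fin sub]) linarith
  moreover have "x \<in> {y. poly q y = 0}" using assms by (simp add: pq)
  ultimately show ?thesis by auto
qed

text \<open>Multiplying by 1 - Z^k telescopes the sum to 1 - Z^(kn) = 0. This discrete Fourier
  inversion serves in Hilbert's theorem 90, in the expansion of y over k, and in the faithfulness of
  the action of the cyclic algebra.\<close>

lemma orthogonality: "(\<Sum>i<n. (Z ^ k) ^ i) = (if n dvd k then of_nat n else 0)"
proof (cases "n dvd k")
  case True
  then have "Z ^ k = 1" by (simp add: Z_eq_1)
  then show ?thesis using True by simp
next
  case False
  then have "Z ^ k \<noteq> 1" by (simp add: Z_eq_1)
  moreover have "(1 - Z ^ k) * (\<Sum>i<n. (Z ^ k) ^ i) = 0"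
    using one_diff_power_eq[of "Z^k" n] by (simp add: Z_pow_n)
  ultimately show ?thesis using False by simp
qed

end

section \<open>Adjoining an n-th root, with n = p^2\<close>

locale kummer_field = prim_root n Z for n and Z :: "'c::alg_closed_field" +
  fixes p :: nat
  assumes p: "prime p" and n: "n = p ^ 2"

text \<open>The assumption \<open>no_pth_root\<close> stands in for irreducibility of T^n -
  \<theta>^n, which is derived from it in \<open>independent\<close>. It passes to the conjugates
  Z^i \<theta> and can be verified by eigenvector arguments at each step of a tower.\<close>

locale kummer = kummer_field n Z p for n and Z :: "'c::alg_closed_field" and p +
  fixes F :: "'c set" and \<theta> :: 'c
  assumes F: "subfield_set F" and Z_in: "Z \<in> F" and \<theta>_n: "\<theta> ^ n \<in> F"
    and no_pth_root: "\<And>c. c \<in> F \<Longrightarrow> c ^ p \<noteq> \<theta> ^ n"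
begin

lemmas sf = subfield_set_simps[OF F]
lemmas po = polys_over_simps[OF F]

lemma \<theta>_nz: "\<theta> \<noteq> 0"
proof
  assume "\<theta> = 0"
  then have "(0::'c) ^ p = \<theta> ^ n" using prime_gt_0_nat[OF p] n_pos by (simp add: zero_power)
  then show False using no_pth_root[of 0] sf by simp
qed

text \<open>By Bezout \<theta>^gcd(d, n) lies in F. If n does not divide d, this gcd is 1 or p, so
  \<theta>^p lies in F, and it is a p-th root of \<theta>^n.\<close>

lemma \<theta>_d: assumes "\<theta> ^ d \<in> F" shows "n dvd d"
proof (rule ccontr)
  assume nd: "\<not> n dvd d"
  have d0: "d \<noteq> 0" using nd by (intro notI) simp
  obtain x y where xy: "d * x = n * y + gcd d n" using bezout_nat[OF d0] by blast
  have "(\<theta> ^ n) ^ y * \<theta> ^ gcd d n = (\<theta> ^ d) ^ x"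
    using xy by (simp flip: power_mult power_add)
  then have "(\<theta> ^ n) ^ y * \<theta> ^ gcd d n \<in> F" using sf(9)[OF assms, of x] by (simp only:)
  then have g: "\<theta> ^ gcd d n \<in> F"
    using subfield_set_cancel[OF F sf(9)[OF \<theta>_n, of y]] \<theta>_nz by simp
  obtain k where k: "k \<le> 2" "gcd d n = p ^ k"
    using divides_primepow_nat[OF p, of "gcd d n" 2] n by auto
  have "k \<noteq> 2" using nd k n by (metis gcd_dvd1)
  then have "\<exists>e. p = gcd d n * e" using k by (intro exI[of _ "p ^ (1 - k)"]) (auto simp: le_Suc_eq numeral_2_eq_2)
  then obtain e where "p = gcd d n * e" ..
  then have "\<theta> ^ p = (\<theta> ^ gcd d n) ^ e" by (metis power_mult)
  then have "\<theta> ^ p \<in> F" using sf(9)[OF g] by simp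
  moreover have "(\<theta> ^ p) ^ p = \<theta> ^ n" by (simp add: n power2_eq_square power_mult)
  ultimately show False using no_pth_root by blast
qed

definition q where "q = monom 1 n - [:\<theta> ^ n:]"

lemma q_in: "q \<in> polys_over F" unfolding q_def by (intro po(4,7,8) sf(2) \<theta>_n)
lemma poly_q: "poly q x = x ^ n - \<theta> ^ n" by (simp add: q_def poly_monom)
lemma degree_q: "degree q = n" and lead_q: "lead_coeff q = 1" and q_nz: "q \<noteq> 0"
proof -
  have c: "coeff q n = 1" using n_pos by (simp add: q_def coeff_pCons split: nat.splits)
  have "degree q \<le> n" unfolding q_def by (intro degree_diff_le) (auto simp: degree_monom_le)
  moreover have "degree q \<ge> n" using c by (intro le_degree) simp
  ultimately show d: "degree q = n" by simp
  show "lead_coeff q = 1" "q \<noteq> 0" using c d by auto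
qed

lemma root_q: assumes "x ^ n = \<theta> ^ n" shows "\<exists>i<n. x = Z ^ i * \<theta>"
proof -
  have "(x / \<theta>) ^ n = 1" using assms \<theta>_nz by (simp add: power_divide)
  then obtain i where "i < n" "x / \<theta> = Z ^ i" using root_of_unity by blast
  then show ?thesis using \<theta>_nz by (auto simp: field_simps)
qed

text \<open>Irreducibility of q over F. A nonzero annihilator of \<theta> of least degree d divides
  q, so its roots have the form Z^i \<theta>. Its constant term is thus \<theta>^d times a nonzero
  element of F, which puts \<theta>^d into F and makes n divide d.\<close>

lemma independent:
  assumes "f \<in> polys_over F" "degree f < n" "poly f \<theta> = 0"
  shows "f = 0"
proof (rule ccontr)
  assume "f \<noteq> 0"
  define P where "P g \<longleftrightarrow> g \<in> polys_over F \<and> g \<noteq> 0 \<and> poly g \<theta> = 0" for g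
  define g where "g = arg_min degree P"
  have "P f" using assms \<open>f \<noteq> 0\<close> by (simp add: P_def)
  then have g: "P g" and gmin: "\<And>h. P h \<Longrightarrow> degree g \<le> degree h"
    unfolding g_def using arg_min_natI arg_min_nat_le by (metis, metis)
  have dg: "degree g < n" using gmin[OF \<open>P f\<close>] assms by simp
  obtain s r where sr: "r \<in> polys_over F" "q = g * s + r" "r = 0 \<or> degree r < degree g"
    using polys_over_division[OF F _ _ q_in, of g] g by (auto simp: P_def)
  have "poly r \<theta> = 0" using sr(2) g poly_q[of \<theta>] by (auto simp: P_def)
  then have "r = 0" using sr(1,3) gmin[of r] unfolding P_def by (metis not_less)
  then have qg: "q = g * s" using sr by simp
  obtain A where A: "size A = degree g" "g = smult (lead_coeff g) (\<Prod>x\<in>#A. [:- x, 1:])"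
    using alg_closed_imp_factorization[of g] g by (auto simp: P_def)
  have roots: "\<exists>c\<in>F. c \<noteq> 0 \<and> x = c * \<theta>" if "x \<in># A" for x
  proof -
    have "poly (\<Prod>x\<in>#A. [:- x, 1:]) x = 0"
      using that by (simp add: poly_prod_mset prod_mset_zero_iff)
    then have "poly g x = 0" by (subst A(2)) simp
    then have "poly q x = 0" by (simp add: qg)
    then obtain i where "x = Z ^ i * \<theta>" using root_q[of x] by (auto simp: poly_q)
    then show ?thesis using Z_in Z_nz sf by (intro bexI[of _ "Z ^ i"]) auto
  qed
  \<comment> \<open>Stated for every submultiset of the roots, so that the induction can add one
    root at a time.\<close>
  have "\<exists>e\<in>F. e \<noteq> 0 \<and> poly (\<Prod>x\<in>#B. [:- x, 1:]) 0 = e * \<theta> ^ size B" if "B \<subseteq># A" for B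
    using that
  proof (induction B)
    case empty
    then show ?case using sf by (intro bexI[of _ 1]) auto
  next
    case (add x B)
    then obtain e where e: "e \<in> F" "e \<noteq> 0" "poly (\<Prod>x\<in>#B. [:- x, 1:]) 0 = e * \<theta> ^ size B"
      using subset_mset.order_trans[of B "add_mset x B" A] by auto
    have "x \<in># A" using add.prems by (metis insert_subset_eq_iff)
    then obtain c where "c \<in> F" "c \<noteq> 0" "x = c * \<theta>" using roots by blast
    then show ?case using e sf by (intro bexI[of _ "- c * e"]) auto
  qed
  from this[of A] obtain e where e: "e \<in> F" "e \<noteq> 0"
    "poly (\<Prod>x\<in>#A. [:- x, 1:]) 0 = e * \<theta> ^ degree g" using A(1) by auto
  have "coeff g 0 = lead_coeff g * (e * \<theta> ^ degree g)"
    by (subst (1) poly_0_coeff_0[symmetric], subst A(2)) (simp add: e(3))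
  moreover have "coeff g 0 \<in> F" using g by (auto simp: P_def polys_over_def)
  ultimately have "(lead_coeff g * e) * \<theta> ^ degree g \<in> F" by (simp add: mult.assoc)
  then have "\<theta> ^ degree g \<in> F"
    using subfield_set_cancel[OF F sf(4)[of "lead_coeff g" e]] g e(1,2) by (auto simp: P_def polys_over_def)
  then have "n dvd degree g" by (rule \<theta>_d)
  then have "degree g = 0" using dg by (auto dest: dvd_imp_le)
  then obtain c where "g = [:c:]" by (rule degree_eq_zeroE)
  then show False using g by (auto simp: P_def)
qed

lemma conjugate: "i < n \<Longrightarrow> kummer n Z p F (Z ^ i * \<theta>)"
proof -
  have "(Z ^ i * \<theta>) ^ n = \<theta> ^ n" by (simp add: power_mult_distrib Z_pow_n)
  then show ?thesis using \<theta>_n no_pth_root Z_in F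
    by (intro kummer.intro kummer_axioms.intro kummer_field_axioms) (simp_all only: not_False_eq_True)
qed

text \<open>The ring F[\<theta>]; \<open>subfield_ext\<close> shows that it is the field
  F(\<theta>).\<close>

definition ext where "ext = (\<lambda>f. poly f \<theta>) ` polys_over F"

lemma ext_repr: assumes "x \<in> ext" shows "\<exists>f\<in>polys_over F. degree f < n \<and> poly f \<theta> = x"
proof -
  obtain f where f: "f \<in> polys_over F" "x = poly f \<theta>" using assms unfolding ext_def by blast
  obtain s r where r: "r \<in> polys_over F" "f = q * s + r" "r = 0 \<or> degree r < degree q"
    using polys_over_division[OF F q_in q_nz f(1)] by blast
  have "poly r \<theta> = x" by (simp add: f(2) r(2) poly_q)
  then show ?thesis using r(1,3) n_pos degree_q by (intro bexI[of _ r]) auto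
qed

lemma F_ext: "F \<subseteq> ext"
proof
  fix x assume "x \<in> F" then show "x \<in> ext" unfolding ext_def using po(8)[of x]
    by (intro image_eqI[of _ _ "[:x:]"]) auto
qed

lemma \<theta>_ext: "\<theta> \<in> ext"
  unfolding ext_def using po(7)[OF sf(2), of 1] by (intro image_eqI[of _ _ "monom 1 1"]) (auto simp: poly_monom)

text \<open>The product of \<open>f(Z\<^sup>jT)\<close> over all \<open>j\<close> is invariant under \<open>T \<mapsto> ZT\<close>, hence a polynomial in
  \<open>T\<^sup>n\<close>; this yields inverses in \<open>F(\<theta>)\<close>.\<close>

lemma norm_in: assumes "f \<in> polys_over F" shows "(\<Prod>j<n. poly f (Z ^ j * \<theta>)) \<in> F"
proof -
  define N where "N = (\<Prod>j<n. f \<circ>\<^sub>p [:0, Z ^ j:])"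
  have N: "N \<in> polys_over F" unfolding N_def using assms sf(9)[OF Z_in] by (intro polys_over_prod[OF F] po(9)) auto
  have pN: "poly N x = (\<Prod>j<n. poly f (Z ^ j * x))" for x
    by (simp add: N_def poly_prod poly_pcompose mult.commute)
  have "N \<circ>\<^sub>p [:0, Z:] = N"
  proof -
    have "f \<circ>\<^sub>p [:0, Z ^ j:] \<circ>\<^sub>p [:0, Z:] = f \<circ>\<^sub>p [:0, Z ^ Suc j:]" for j
      by (simp add: pcompose_pCons mult.commute flip: pcompose_assoc)
    then have "N \<circ>\<^sub>p [:0, Z:] = (\<Prod>j<n. f \<circ>\<^sub>p [:0, Z ^ Suc j:])" by (simp add: N_def pcompose_prod)
    also have "\<dots> = (\<Prod>j\<in>Suc ` {..<n}. f \<circ>\<^sub>p [:0, Z ^ j:])" by (simp add: prod.reindex)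
    also have "Suc ` {..<n} = insert n ({..<n} - {0})"
      using n_pos by (auto simp: image_Suc_lessThan)
    also have "(\<Prod>j\<in>insert n ({..<n} - {0}). f \<circ>\<^sub>p [:0, Z ^ j:]) = N"
      using n_pos unfolding N_def by (subst (2) prod.remove[of _ 0]) (auto simp: Z_n)
    finally show ?thesis .
  qed
  then have "Z ^ i * coeff N i = coeff N i" for i by (metis coeff_pcompose_linear)
  then have c: "coeff N i = 0" if "\<not> n dvd i" for i using that Z_eq_1[of i] by (metis mult_cancel_right1)
  have "coeff N i * \<theta> ^ i \<in> F" for i
  proof (cases "n dvd i")
    case True then show ?thesis using N \<theta>_n sf by (auto simp: polys_over_def power_mult)
  qed (simp add: c sf)
  then have "poly N \<theta> \<in> F" unfolding poly_altdef by (intro subfield_set_sum[OF F])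
  then show ?thesis by (simp add: pN)
qed

text \<open>\<theta> and Z^j \<theta> have the same minimal polynomial q over F, so f vanishes at
  both or at neither.\<close>

lemma norm_nz:
  assumes "f \<in> polys_over F" "poly f \<theta> \<noteq> 0" "j < n" shows "poly f (Z ^ j * \<theta>) \<noteq> 0"
proof
  assume 0: "poly f (Z ^ j * \<theta>) = 0"
  interpret c: kummer n Z p F "Z ^ j * \<theta>" by (rule conjugate[OF assms(3)])
  obtain s r where r: "r \<in> polys_over F" "f = q * s + r" "r = 0 \<or> degree r < degree q"
    using polys_over_division[OF F q_in q_nz assms(1)] by auto
  have "poly q (Z ^ j * \<theta>) = 0"
    by (simp add: poly_q power_mult_distrib Z_pow_n)
  then have "poly r (Z ^ j * \<theta>) = 0" using 0 r(2) by simp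
  then have "r = 0" using c.independent[OF r(1)] r(3) n_pos degree_q by auto
  then show False using assms(2) by (simp add: r(2) poly_q)
qed

lemma subfield_ext: "subfield_set ext"
proof -
  have inv: "inverse x \<in> ext" if "x \<in> ext" for x
  proof (cases "x = 0")
    case True then show ?thesis using F_ext sf by auto
  next
    case False
    obtain f where f: "f \<in> polys_over F" "x = poly f \<theta>" using \<open>x \<in> ext\<close> by (auto simp: ext_def)
    \<comment> \<open>The product of the conjugates other than x itself: x times g(\<theta>) is the
      norm N in F, so g(\<theta>)/N inverts x.\<close>
    define g where "g = (\<Prod>j\<in>{..<n} - {0}. f \<circ>\<^sub>p [:0, Z ^ j:])"
    define N where "N = (\<Prod>j<n. poly f (Z ^ j * \<theta>))"
    have g: "g \<in> polys_over F" unfolding g_def using f sf(9)[OF Z_in] by (intro polys_over_prod[OF F] po(9)) auto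
    have N: "N \<in> F" unfolding N_def by (rule norm_in[OF f(1)])
    have N0: "N \<noteq> 0" using norm_nz[OF f(1)] False f by (auto simp: N_def)
    have "N = x * poly g \<theta>" unfolding N_def
      using n_pos by (subst prod.remove[of _ 0]) (auto simp: g_def f poly_prod poly_pcompose mult.commute)
    then have "poly g \<theta> = inverse x * N" using False by simp
    then have "inverse x = poly (g * [:inverse N:]) \<theta>" using N0 by simp
    moreover have "g * [:inverse N:] \<in> polys_over F" by (rule po(6)[OF g po(8)[OF sf(6)[OF N]]])
    ultimately show ?thesis unfolding ext_def by (rule image_eqI)
  qed
  have "x + y \<in> ext" "x * y \<in> ext" "- x \<in> ext" if xy: "x \<in> ext" "y \<in> ext" for x y
  proof -
    from xy obtain f g where fg: "f \<in> polys_over F" "x = poly f \<theta>" "g \<in> polys_over F" "y = poly g \<theta>"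
      unfolding ext_def by blast
    show "x + y \<in> ext" unfolding ext_def using po(3)[OF fg(1,3)] fg by (intro image_eqI[of _ _ "f + g"]) auto
    show "x * y \<in> ext" unfolding ext_def using po(6)[OF fg(1,3)] fg by (intro image_eqI[of _ _ "f * g"]) auto
    show "- x \<in> ext" unfolding ext_def using po(5)[OF fg(1)] fg by (intro image_eqI[of _ _ "- f"]) auto
  qed
  moreover have "0 \<in> ext" "1 \<in> ext" using F_ext sf(1,2) by auto
  ultimately show ?thesis using inv unfolding subfield_set_def by (intro conjI ballI) simp_all
qed

end

section \<open>Homomorphisms on subfields\<close>

text \<open>Only the values on F matter, so one total function can be restricted along a tower. The
  clause \<phi> 1 = 1 excludes the zero map and makes \<phi> injective on the field F.\<close>

definition hom_on :: "'c::field set \<Rightarrow> ('c \<Rightarrow> 'c) \<Rightarrow> bool" where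
  "hom_on F \<phi> \<longleftrightarrow> \<phi> 1 = 1 \<and> (\<forall>x\<in>F. \<forall>y\<in>F. \<phi> (x + y) = \<phi> x + \<phi> y \<and> \<phi> (x * y) = \<phi> x * \<phi> y)"

locale subfield_hom =
  fixes F :: "'c::field set" and \<phi> :: "'c \<Rightarrow> 'c"
  assumes F: "subfield_set F" and hom: "hom_on F \<phi>"
begin

lemma one: "\<phi> 1 = 1" and add: "x \<in> F \<Longrightarrow> y \<in> F \<Longrightarrow> \<phi> (x + y) = \<phi> x + \<phi> y"
  and mult: "x \<in> F \<Longrightarrow> y \<in> F \<Longrightarrow> \<phi> (x * y) = \<phi> x * \<phi> y"
  using hom by (auto simp: hom_on_def)

lemma zero: "\<phi> 0 = 0"
  using add[of 0 0] subfield_set_simps(1)[OF F] by (metis add_0_right add_left_cancel)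

lemma minus: assumes "x \<in> F" shows "\<phi> (- x) = - \<phi> x"
  using add[OF assms subfield_set_simps(5)[OF F assms]] zero by (simp add: eq_neg_iff_add_eq_0 add.commute)

lemma nonzero: assumes "x \<in> F" "x \<noteq> 0" shows "\<phi> x \<noteq> 0"
  using mult[OF assms(1) subfield_set_simps(6)[OF F assms(1)]] assms(2) one by auto

lemma inverse: assumes "x \<in> F" shows "\<phi> (inverse x) = inverse (\<phi> x)"
proof (cases "x = 0")
  case False
  then have "\<phi> x * \<phi> (inverse x) = 1"
    using mult[OF assms subfield_set_simps(6)[OF F assms]] one by simp
  then show ?thesis by (metis inverse_unique)
qed (simp add: zero)

lemma diff: assumes "x \<in> F" "y \<in> F" shows "\<phi> (x - y) = \<phi> x - \<phi> y"
  using add[OF assms(1) subfield_set_simps(5)[OF F assms(2)]] minus[OF assms(2)] by simp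

lemma divide: assumes "x \<in> F" "y \<in> F" shows "\<phi> (x / y) = \<phi> x / \<phi> y"
  using mult[OF assms(1) subfield_set_simps(6)[OF F assms(2)]] inverse[OF assms(2)] by (simp add: divide_inverse)

lemma power: "x \<in> F \<Longrightarrow> \<phi> (x ^ i) = \<phi> x ^ i"
  by (induction i) (auto simp: one mult subfield_set_simps(9)[OF F])

lemma sum: "(\<And>i. i \<in> S \<Longrightarrow> f i \<in> F) \<Longrightarrow> \<phi> (sum f S) = (\<Sum>i\<in>S. \<phi> (f i))"
  by (induction S rule: infinite_finite_induct) (auto simp: zero add subfield_set_sum[OF F])

lemma prod: "(\<And>i. i \<in> S \<Longrightarrow> f i \<in> F) \<Longrightarrow> \<phi> (prod f S) = (\<Prod>i\<in>S. \<phi> (f i))"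
  by (induction S rule: infinite_finite_induct) (auto simp: one mult subfield_set_prod[OF F])

lemma inj: assumes "x \<in> F" "y \<in> F" "\<phi> x = \<phi> y" shows "x = y"
  using nonzero[OF subfield_set_simps(7)[OF F assms(1,2)]] diff[OF assms(1,2)] assms(3) by auto

lemma poly:
  assumes "f \<in> polys_over F" "x \<in> F"
  shows "\<phi> (poly f x) = poly (map_poly \<phi> f) (\<phi> x)"
proof -
  have c: "coeff f i \<in> F" for i using assms(1) by (simp add: polys_over_def)
  have d: "degree (map_poly \<phi> f) = degree f"
  proof (cases "f = 0")
    case False
    then have "coeff (map_poly \<phi> f) (degree f) \<noteq> 0"
      using nonzero[OF c] zero by (simp add: coeff_map_poly)
    then show ?thesis by (intro antisym map_poly_degree_leq le_degree) auto
  qed simp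
  show ?thesis
    using c assms(2) subfield_set_simps(4,9)[OF F]
    by (simp add: poly_altdef sum mult power d coeff_map_poly zero)
qed

lemma map_poly_add:
  "f \<in> polys_over F \<Longrightarrow> g \<in> polys_over F \<Longrightarrow> map_poly \<phi> (f + g) = map_poly \<phi> f + map_poly \<phi> g"
  by (intro poly_eqI) (simp add: coeff_map_poly zero add polys_over_def)

lemma map_poly_mult:
  "f \<in> polys_over F \<Longrightarrow> g \<in> polys_over F \<Longrightarrow> map_poly \<phi> (f * g) = map_poly \<phi> f * map_poly \<phi> g"
  by (intro poly_eqI) (simp add: coeff_map_poly zero mult sum coeff_mult polys_over_def subfield_set_simps(4)[OF F])

end

lemma polys_over_mono: "F \<subseteq> E \<Longrightarrow> polys_over F \<subseteq> polys_over E"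
  by (auto simp: polys_over_def)

lemma hom_on_subset: "hom_on E \<phi> \<Longrightarrow> F \<subseteq> E \<Longrightarrow> hom_on F \<phi>"
  by (auto simp: hom_on_def)

lemma map_poly_id_on:
  assumes "subfield_set F" "\<And>x. x \<in> F \<Longrightarrow> \<phi> x = x" "f \<in> polys_over F" shows "map_poly \<phi> f = f"
  using assms subfield_set_simps(1)[OF assms(1)] by (intro poly_eqI) (simp add: coeff_map_poly polys_over_def)

lemma map_poly_cong_on:
  assumes "subfield_set F" "\<And>x. x \<in> F \<Longrightarrow> \<phi> x = \<psi> x" "\<phi> 0 = 0" "f \<in> polys_over F" 
  shows "map_poly \<phi> f = map_poly \<psi> f"
  using assms subfield_set_simps(1)[OF assms(1)]
  by (intro poly_eqI) (metis (mono_tags, lifting) coeff_map_poly mem_Collect_eq polys_over_def)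

section \<open>Extending homomorphisms from F to F(\<theta>)\<close>

context kummer
begin

text \<open>The polynomials over F vanishing at \<theta> are the multiples of q, and \<phi> turns q
  into T^n - \<phi>(\<theta>^n), which vanishes at \<theta>'. Hence the image of f(\<theta>) does
  not depend on the choice of f.\<close>

lemma hom_extension:
  assumes \<phi>: "hom_on F \<phi>" and \<theta>': "\<theta>' ^ n = \<phi> (\<theta> ^ n)"
  obtains \<psi> where "hom_on ext \<psi>" "\<And>x. x \<in> F \<Longrightarrow> \<psi> x = \<phi> x" "\<psi> \<theta> = \<theta>'"
proof -
  interpret h: subfield_hom F \<phi> using F \<phi> by unfold_locales
  define r where "r x = (SOME f. f \<in> polys_over F \<and> poly f \<theta> = x)" for x
  have r: "r x \<in> polys_over F" "poly (r x) \<theta> = x" if "x \<in> ext" for x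
  proof -
    have "\<exists>f. f \<in> polys_over F \<and> poly f \<theta> = x" using that by (auto simp: ext_def)
    then show "r x \<in> polys_over F" "poly (r x) \<theta> = x" unfolding r_def by (metis (mono_tags, lifting) someI_ex)+
  qed
  have kernel: "poly (map_poly \<phi> f) \<theta>' = 0" if f: "f \<in> polys_over F" "poly f \<theta> = 0" for f
  proof -
    obtain s t where st: "s \<in> polys_over F" "t \<in> polys_over F" "f = q * s + t" "t = 0 \<or> degree t < degree q"
      using polys_over_division[OF F q_in q_nz f(1)] by blast
    have "poly t \<theta> = 0" using f(2) by (simp add: st(3) poly_q)
    then have "t = 0" using independent[OF st(2)] st(4) degree_q n_pos by auto
    then have f': "f = q * s" using st(3) by simp
    have "map_poly \<phi> q = monom 1 n - [:\<phi> (\<theta> ^ n):]"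
      unfolding q_def using sf(1,2,7) \<theta>_n
      by (intro poly_eqI) (auto simp: coeff_map_poly h.zero h.diff h.one h.minus coeff_pCons split: nat.splits)
    then have "poly (map_poly \<phi> q) \<theta>' = 0" using \<theta>' by (simp add: poly_monom)
    then show ?thesis by (simp add: f' h.map_poly_mult[OF q_in st(1)])
  qed
  define \<psi> where "\<psi> x = poly (map_poly \<phi> (r x)) \<theta>'" for x
  have \<psi>: "\<psi> (poly f \<theta>) = poly (map_poly \<phi> f) \<theta>'" if f: "f \<in> polys_over F" for f
  proof -
    define g where "g = r (poly f \<theta>)"
    have "poly f \<theta> \<in> ext" using f by (simp add: ext_def)
    note g = r[OF this, folded g_def]
    have "poly (map_poly \<phi> (f - g)) \<theta>' = 0"
      by (rule kernel) (use f g po(4) in auto)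
    moreover have "map_poly \<phi> f = map_poly \<phi> (f - g) + map_poly \<phi> g"
      using h.map_poly_add[OF po(4)[OF f g(1)] g(1)] by simp
    ultimately show ?thesis by (simp add: \<psi>_def g_def)
  qed
  have base: "\<psi> x = \<phi> x" if "x \<in> F" for x
    using \<psi>[OF po(8)[OF that]] by (simp add: map_poly_pCons h.zero)
  have "hom_on ext \<psi>" unfolding hom_on_def
  proof (intro conjI ballI)
    show "\<psi> 1 = 1" using base[OF sf(2)] h.one by simp
    fix x y assume "x \<in> ext" "y \<in> ext"
    then obtain f g where fg: "f \<in> polys_over F" "x = poly f \<theta>" "g \<in> polys_over F" "y = poly g \<theta>"
      unfolding ext_def by blast
    show "\<psi> (x + y) = \<psi> x + \<psi> y"
      using \<psi>[OF po(3)[OF fg(1,3)]] by (simp add: fg(2,4) \<psi>[OF fg(1)] \<psi>[OF fg(3)] h.map_poly_add[OF fg(1,3)])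
    show "\<psi> (x * y) = \<psi> x * \<psi> y"
      using \<psi>[OF po(6)[OF fg(1,3)]] by (simp add: fg(2,4) \<psi>[OF fg(1)] \<psi>[OF fg(3)] h.map_poly_mult[OF fg(1,3)])
  qed
  moreover have "\<psi> \<theta> = \<theta>'"
    using \<psi>[OF po(7)[OF sf(2), of 1]] by (simp add: poly_monom map_poly_monom h.zero h.one)
  ultimately show thesis using base that by blast
qed

lemma hom_ext_poly:
  assumes "hom_on ext \<psi>" "f \<in> polys_over F"
  shows "\<psi> (poly f \<theta>) = poly (map_poly \<psi> f) (\<psi> \<theta>)"
proof -
  interpret e: subfield_hom ext \<psi> using subfield_ext assms by unfold_locales
  show ?thesis using polys_over_mono[OF F_ext] assms(2) \<theta>_ext by (intro e.poly) auto
qed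

lemma hom_ext_eqI:
  assumes "hom_on ext \<psi>" "hom_on ext \<chi>" "\<And>x. x \<in> F \<Longrightarrow> \<psi> x = \<chi> x" "\<psi> \<theta> = \<chi> \<theta>" "x \<in> ext"
  shows "\<psi> x = \<chi> x"
proof -
  obtain f where f: "f \<in> polys_over F" "x = poly f \<theta>" using assms(5) unfolding ext_def by blast
  interpret e: subfield_hom ext \<psi> using subfield_ext assms by unfold_locales
  have "map_poly \<psi> f = map_poly \<chi> f" using assms(3) f(1) e.zero by (intro map_poly_cong_on[OF F])
  then show ?thesis using hom_ext_poly[OF assms(1) f(1)] hom_ext_poly[OF assms(2) f(1)] assms(4) f(2) by simp
qed

lemma hom_ext_maps:
  assumes \<psi>: "hom_on ext \<psi>" and E: "subfield_set E" "\<And>x. x \<in> F \<Longrightarrow> \<psi> x \<in> E" "\<psi> \<theta> \<in> E" "x \<in> ext"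
  shows "\<psi> x \<in> E"
proof -
  interpret e: subfield_hom ext \<psi> using subfield_ext assms by unfold_locales
  obtain f where f: "f \<in> polys_over F" "x = poly f \<theta>" using assms(5) unfolding ext_def by blast
  have "map_poly \<psi> f \<in> polys_over E" using f(1) E(2) by (auto simp: polys_over_def coeff_map_poly e.zero)
  then show ?thesis using hom_ext_poly[OF \<psi> f(1)] f(2) poly_in_subfield[OF E(1) _ E(3)] by simp
qed

text \<open>Writing x = f(\<theta>) with deg f < n, invariance gives f(ZT) = f(T) by uniqueness of
  f. A coefficient of T^i survives only if n divides i, so f is constant.\<close>

lemma fixed_by_generator:
  assumes \<psi>: "hom_on ext \<psi>" "\<And>x. x \<in> F \<Longrightarrow> \<psi> x = x" "\<psi> \<theta> = Z * \<theta>" and x: "x \<in> ext" "\<psi> x = x"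
  shows "x \<in> F"
proof -
  obtain f where f: "f \<in> polys_over F" "degree f < n" "poly f \<theta> = x" using ext_repr[OF x(1)] by blast
  have "poly f (Z * \<theta>) = x"
    using hom_ext_poly[OF \<psi>(1) f(1)] map_poly_id_on[OF F \<psi>(2) f(1)] \<psi>(3) x(2) f(3) by simp
  then have "poly (f \<circ>\<^sub>p [:0, Z:] - f) \<theta> = 0" by (simp add: poly_pcompose f(3) mult.commute)
  moreover have "f \<circ>\<^sub>p [:0, Z:] - f \<in> polys_over F" by (intro po(4,9) f Z_in)
  moreover have "degree (f \<circ>\<^sub>p [:0, Z:] - f) < n" 
    using f(2) degree_pcompose_le[of f "[:0, Z:]"] by (intro degree_diff_less) (auto intro: le_less_trans split: if_splits)
  ultimately have "f \<circ>\<^sub>p [:0, Z:] - f = 0" by (intro independent)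
  then have "Z ^ i * coeff f i = coeff f i" for i by (metis coeff_pcompose_linear eq_iff_diff_eq_0)
  then have "coeff f i = 0" if "\<not> n dvd i" for i using that Z_eq_1[of i] by (metis mult_cancel_right1)
  moreover have "\<not> n dvd i" if "i > 0" "i < n" for i using that by (auto dest: dvd_imp_le)
  ultimately have "coeff f i = 0" if "i > 0" for i 
    using that f(2) by (cases "i < n") (auto intro: coeff_eq_0)
  then have "f = [:coeff f 0:]" by (intro poly_eqI) (auto simp: coeff_pCons split: nat.splits)
  then have "x = coeff f 0" using f(3) by (metis poly_const_conv)
  then show ?thesis using f(1) by (simp add: polys_over_def)
qed

end

section \<open>A Galois extension from a norm\<close>

text \<open>Endomorphisms of M over k. For the generators of the Galois group, bijectivity is
  deduced from their relations in \<open>realizable_if_norm_condition\<close>.\<close>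

definition relative_endo :: "'c::field set \<Rightarrow> 'c set \<Rightarrow> ('c \<Rightarrow> 'c) \<Rightarrow> bool" where
  "relative_endo k M f \<longleftrightarrow> (\<forall>x\<in>M. f x \<in> M) \<and> (\<forall>x\<in>k. f x = x) \<and>
    (\<forall>x\<in>M. \<forall>y\<in>M. f (x + y) = f x + f y \<and> f (x * y) = f x * f y)"

lemma relative_endo_hom_on:
  "subfield_set k \<Longrightarrow> relative_endo k M f \<Longrightarrow> hom_on M f"
  by (auto simp: relative_endo_def hom_on_def subfield_set_simps)

lemma relative_endo_closed: "relative_endo k M f \<Longrightarrow> x \<in> M \<Longrightarrow> f x \<in> M"
  by (auto simp: relative_endo_def)

lemma relative_endo_comp:
  "relative_endo k M f \<Longrightarrow> relative_endo k M g \<Longrightarrow> relative_endo k M (\<lambda>x. f (g x))"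
  by (auto simp: relative_endo_def)

lemma relative_endo_funpow: "relative_endo k M f \<Longrightarrow> relative_endo k M (f ^^ i)"
  by (induction i) (auto simp: relative_endo_def)

text \<open>With \<open>n = p\<^sup>2\<close>, the values \<open>s = 1, p, 0\<close> give \<open>\<Phi>\<^sub>1\<^sub>4(42)\<close>, \<open>\<Phi>\<^sub>1\<^sub>4(321)\<close> and \<open>\<Phi>\<^sub>1\<^sub>4(222)\<close>.\<close>

definition heisenberg_relations ::
    "nat \<Rightarrow> nat \<Rightarrow> 'c set \<Rightarrow> ('c \<Rightarrow> 'c) \<Rightarrow> ('c \<Rightarrow> 'c) \<Rightarrow> ('c \<Rightarrow> 'c) \<Rightarrow> bool" where
  "heisenberg_relations n s M A1 A2 B \<longleftrightarrow> (\<forall>x\<in>M. A1 (A2 x) = A2 (A1 (B x)) \<and>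
    A1 (B x) = B (A1 x) \<and> A2 (B x) = B (A2 x) \<and>
    (A1 ^^ n) x = (B ^^ s) x \<and> (A2 ^^ n) x = x \<and> (B ^^ n) x = x)"

context kummer_field
begin

lemma p_pos: "p > 0" using prime_gt_0_nat[OF p] .

text \<open>The clause \<open>n dvd i * p\<close> records that Z^i is a p-th root of unity; it makes
  the exponent division in \<open>\<theta>2_no_pth_root\<close> exact.\<close>

lemma pth_root_unique:
  assumes "x ^ p = y ^ p" "y \<noteq> 0" shows "\<exists>i<n. n dvd i * p \<and> x = Z ^ i * y"
proof -
  have u: "(x / y) ^ p = 1" using assms by (simp add: power_divide)
  then have "(x / y) ^ n = 1" by (simp add: n power2_eq_square power_mult)
  then obtain i where i: "i < n" "x / y = Z ^ i" using root_of_unity by blast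
  then have "Z ^ (i * p) = 1" using u by (simp add: power_mult)
  then show ?thesis using i assms(2) Z_eq_1 by (auto simp: field_simps)
qed

end

section \<open>The tower k, K, L, M built from a solution of the norm equation\<close>

locale heisenberg_kummer = kummer_field n Z p for n and Z :: "'c::alg_closed_field" and p +
  fixes k :: "'c set" and \<theta>1 \<theta>2 :: 'c and f :: "'c poly" and s :: nat
  assumes k: "subfield_set k" and Z_k: "Z \<in> k" and \<theta>1_k: "\<theta>1 ^ n \<in> k" and \<theta>2_k: "\<theta>2 ^ n \<in> k"
    and f: "f \<in> polys_over k" and norm: "(\<Prod>j<n. poly f (Z ^ j * \<theta>1)) = Z ^ s * \<theta>2 ^ n"
    and indep1: "\<And>c. c \<in> k \<Longrightarrow> c ^ p \<noteq> \<theta>1 ^ n"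
    and indep2: "\<And>c t. c \<in> k \<Longrightarrow> c ^ p \<noteq> \<theta>2 ^ n * (\<theta>1 ^ n) ^ t"
    and n_nz: "of_nat n \<noteq> (0::'c)"
begin

lemma \<theta>2_nz: "\<theta>2 \<noteq> 0"
proof
  assume "\<theta>2 = 0"
  then have "(0::'c) ^ p = \<theta>2 ^ n * (\<theta>1 ^ n) ^ 0" using p_pos n_pos by (simp add: zero_power)
  then show False using indep2[of 0 0] subfield_set_simps(1)[OF k] by simp
qed

sublocale K: kummer n Z p k \<theta>1
  using k Z_k \<theta>1_k indep1 by (intro kummer.intro kummer_axioms.intro kummer_field_axioms)

lemma k_K: "x \<in> k \<Longrightarrow> x \<in> K.ext" using K.F_ext by blast

definition \<sigma>0 where "\<sigma>0 = (SOME \<psi>. hom_on K.ext \<psi> \<and> (\<forall>x\<in>k. \<psi> x = x) \<and> \<psi> \<theta>1 = Z * \<theta>1)"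

lemma \<sigma>0: "hom_on K.ext \<sigma>0" "x \<in> k \<Longrightarrow> \<sigma>0 x = x" "\<sigma>0 \<theta>1 = Z * \<theta>1"
proof -
  have "hom_on k (\<lambda>x. x)" by (simp add: hom_on_def)
  moreover have "(Z * \<theta>1) ^ n = \<theta>1 ^ n" by (simp add: power_mult_distrib Z_n)
  ultimately obtain \<psi> where "hom_on K.ext \<psi>" "\<And>x. x \<in> k \<Longrightarrow> \<psi> x = x" "\<psi> \<theta>1 = Z * \<theta>1"
    by (rule K.hom_extension) blast
  then have "\<exists>\<psi>. hom_on K.ext \<psi> \<and> (\<forall>x\<in>k. \<psi> x = x) \<and> \<psi> \<theta>1 = Z * \<theta>1" by blast
  from someI_ex[OF this] show "hom_on K.ext \<sigma>0" "x \<in> k \<Longrightarrow> \<sigma>0 x = x" "\<sigma>0 \<theta>1 = Z * \<theta>1"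
    unfolding \<sigma>0_def by blast+
qed

lemma \<sigma>0_K: "x \<in> K.ext \<Longrightarrow> \<sigma>0 x \<in> K.ext"
  using K.hom_ext_maps[OF \<sigma>0(1) K.subfield_ext] \<sigma>0(2,3) k_K Z_k
    subfield_set_simps(4)[OF K.subfield_ext] K.\<theta>_ext by auto

sublocale sK: subfield_hom K.ext \<sigma>0
  using \<sigma>0(1) K.subfield_ext by unfold_locales

text \<open>A p-th root c of \<theta>2^n in K satisfies \<sigma>0 c = Z^i c for some i. Multiplying
  c by a power of \<theta>1 that cancels Z^i gives an element of k whose p-th power is \<theta>2^n
  times a power of \<theta>1^n, against \<open>indep2\<close>.\<close>

lemma \<theta>2_no_pth_root: assumes c: "c \<in> K.ext" shows "c ^ p \<noteq> \<theta>2 ^ n"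
proof
  assume eq: "c ^ p = \<theta>2 ^ n"
  then have c0: "c \<noteq> 0" using \<theta>2_nz p_pos by (auto simp: zero_power)
  have "\<sigma>0 c ^ p = c ^ p"
    using sK.power[OF c, of p] \<sigma>0(2)[OF \<theta>2_k] by (simp add: eq)
  from pth_root_unique[OF this c0] obtain i where i: "i < n" "n dvd i * p" "\<sigma>0 c = Z ^ i * c" by blast
  \<comment> \<open>The exponent n - i stands for -i, since Z^n = 1.\<close>
  define c' where "c' = c * \<theta>1 ^ (n - i)"
  have "\<theta>1 ^ (n - i) \<in> K.ext" by (rule subfield_set_simps(9)[OF K.subfield_ext K.\<theta>_ext])
  then have c': "c' \<in> K.ext" "\<sigma>0 c' = \<sigma>0 c * (Z * \<theta>1) ^ (n - i)"
    using c sK.mult[of c] sK.power[OF K.\<theta>_ext] subfield_set_simps(4)[OF K.subfield_ext]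
    by (auto simp: c'_def \<sigma>0(3))
  have "Z ^ i * Z ^ (n - i) = 1" using i(1) Z_n by (simp flip: power_add)
  moreover have "\<sigma>0 c' = (Z ^ i * Z ^ (n - i)) * c'"
    by (subst c'(2), subst i(3)) (simp only: c'_def power_mult_distrib mult_ac)
  ultimately have "\<sigma>0 c' = c'" by simp
  from K.fixed_by_generator[OF \<sigma>0 c'(1) this] have "c' \<in> k" by simp
  moreover have "c' ^ p = \<theta>2 ^ n * (\<theta>1 ^ n) ^ (((n - i) * p) div n)"
  proof -
    have "n dvd (n - i) * p" using i(2) by (simp add: diff_mult_distrib)
    then have "(n - i) * p = n * (((n - i) * p) div n)" by simp
    then have "\<theta>1 ^ ((n - i) * p) = (\<theta>1 ^ n) ^ (((n - i) * p) div n)" by (metis power_mult)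
    then have "(\<theta>1 ^ (n - i)) ^ p = (\<theta>1 ^ n) ^ (((n - i) * p) div n)" by (simp only: power_mult)
    then show ?thesis by (simp only: c'_def power_mult_distrib eq)
  qed
  ultimately show False using indep2 by blast
qed

sublocale L: kummer n Z p K.ext \<theta>2
  using K.subfield_ext k_K[OF Z_k] k_K[OF \<theta>2_k] \<theta>2_no_pth_root
  by (intro kummer.intro kummer_axioms.intro kummer_field_axioms)

lemma K_L: "x \<in> K.ext \<Longrightarrow> x \<in> L.ext" using L.F_ext by blast
lemmas k_L = K_L[OF k_K]

definition \<sigma> where "\<sigma> = (SOME \<psi>. hom_on L.ext \<psi> \<and> (\<forall>x\<in>K.ext. \<psi> x = \<sigma>0 x) \<and> \<psi> \<theta>2 = \<theta>2)"
definition \<tau> where "\<tau> = (SOME \<psi>. hom_on L.ext \<psi> \<and> (\<forall>x\<in>K.ext. \<psi> x = x) \<and> \<psi> \<theta>2 = Z * \<theta>2)"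

lemma \<sigma>: "hom_on L.ext \<sigma>" "x \<in> K.ext \<Longrightarrow> \<sigma> x = \<sigma>0 x" "\<sigma> \<theta>2 = \<theta>2"
proof -
  obtain \<psi> where "hom_on L.ext \<psi>" "\<And>x. x \<in> K.ext \<Longrightarrow> \<psi> x = \<sigma>0 x" "\<psi> \<theta>2 = \<theta>2"
    using L.hom_extension[OF \<sigma>0(1), of \<theta>2] \<sigma>0(2)[OF \<theta>2_k] by metis
  then have "\<exists>\<psi>. hom_on L.ext \<psi> \<and> (\<forall>x\<in>K.ext. \<psi> x = \<sigma>0 x) \<and> \<psi> \<theta>2 = \<theta>2" by blast
  from someI_ex[OF this] show "hom_on L.ext \<sigma>" "x \<in> K.ext \<Longrightarrow> \<sigma> x = \<sigma>0 x" "\<sigma> \<theta>2 = \<theta>2"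
    unfolding \<sigma>_def by blast+
qed

lemma \<tau>: "hom_on L.ext \<tau>" "x \<in> K.ext \<Longrightarrow> \<tau> x = x" "\<tau> \<theta>2 = Z * \<theta>2"
proof -
  have "hom_on K.ext (\<lambda>x. x)" by (simp add: hom_on_def)
  moreover have "(Z * \<theta>2) ^ n = \<theta>2 ^ n" by (simp add: power_mult_distrib Z_n)
  ultimately obtain \<psi> where "hom_on L.ext \<psi>" "\<And>x. x \<in> K.ext \<Longrightarrow> \<psi> x = x" "\<psi> \<theta>2 = Z * \<theta>2"
    by (rule L.hom_extension) blast
  then have "\<exists>\<psi>. hom_on L.ext \<psi> \<and> (\<forall>x\<in>K.ext. \<psi> x = x) \<and> \<psi> \<theta>2 = Z * \<theta>2" by blast
  from someI_ex[OF this] show "hom_on L.ext \<tau>" "x \<in> K.ext \<Longrightarrow> \<tau> x = x" "\<tau> \<theta>2 = Z * \<theta>2"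
    unfolding \<tau>_def by blast+
qed

sublocale sL: subfield_hom L.ext \<sigma> using \<sigma>(1) L.subfield_ext by unfold_locales
sublocale tL: subfield_hom L.ext \<tau> using \<tau>(1) L.subfield_ext by unfold_locales

lemma \<sigma>_L: "x \<in> L.ext \<Longrightarrow> \<sigma> x \<in> L.ext"
  using L.hom_ext_maps[OF \<sigma>(1) L.subfield_ext] \<sigma>(2,3) K_L \<sigma>0_K L.\<theta>_ext by auto

lemma \<tau>_L: "x \<in> L.ext \<Longrightarrow> \<tau> x \<in> L.ext"
  using L.hom_ext_maps[OF \<tau>(1) L.subfield_ext] \<tau>(2,3) K_L k_L[OF Z_k]
    subfield_set_simps(4)[OF L.subfield_ext] L.\<theta>_ext by auto

lemma \<sigma>_k: "x \<in> k \<Longrightarrow> \<sigma> x = x" and \<tau>_k: "x \<in> k \<Longrightarrow> \<tau> x = x"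
  by (simp_all add: \<sigma>(2) \<tau>(2) \<sigma>0(2) k_K)

lemma \<sigma>\<tau>: assumes "x \<in> L.ext" shows "\<sigma> (\<tau> x) = \<tau> (\<sigma> x)"
proof (rule L.hom_ext_eqI[where \<psi> = "\<lambda>x. \<sigma> (\<tau> x)" and \<chi> = "\<lambda>x. \<tau> (\<sigma> x)"])
  show "hom_on L.ext (\<lambda>x. \<sigma> (\<tau> x))" "hom_on L.ext (\<lambda>x. \<tau> (\<sigma> x))"
    unfolding hom_on_def by (simp_all add: sL.one tL.one sL.add tL.add sL.mult tL.mult \<sigma>_L \<tau>_L)
  show "\<sigma> (\<tau> \<theta>2) = \<tau> (\<sigma> \<theta>2)"
    using sL.mult[OF k_L[OF Z_k] L.\<theta>_ext] \<sigma>_k[OF Z_k] by (simp add: \<sigma>(3) \<tau>(3))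
qed (simp_all add: \<sigma>(2) \<tau>(2) \<sigma>0_K assms)

text \<open>The conjugates \<sigma>^j(y) of y = Y 0, by \<open>\<sigma>0_Y\<close>.\<close>

definition Y where "Y j = poly f (Z ^ j * \<theta>1)"

lemma Y_K: "Y j \<in> K.ext"
  unfolding Y_def using polys_over_mono[OF K.F_ext] f subfield_set_simps(9)[OF k Z_k] k_K
  by (intro poly_in_subfield[OF K.subfield_ext] subfield_set_simps(4)[OF K.subfield_ext] K.\<theta>_ext) auto

lemma \<sigma>0_Y: "\<sigma>0 (Y j) = Y (Suc j)"
proof -
  have Zj: "Z ^ j \<in> k" by (rule subfield_set_simps(9)[OF k Z_k])
  have in_K: "Z ^ j * \<theta>1 \<in> K.ext" using k_K[OF Zj] K.\<theta>_ext subfield_set_simps(4)[OF K.subfield_ext] by blast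
  have fK: "f \<in> polys_over K.ext" using polys_over_mono[OF K.F_ext] f by blast
  show ?thesis unfolding Y_def
    using sK.poly[OF fK in_K] map_poly_id_on[OF k \<sigma>0(2) f] sK.mult[OF k_K[OF Zj] K.\<theta>_ext]
    by (simp add: \<sigma>0(2)[OF Zj] \<sigma>0(3) mult_ac)
qed

lemma Y_nz: "j < n \<Longrightarrow> Y j \<noteq> 0"
  using norm Z_nz \<theta>2_nz unfolding Y_def by (metis (no_types, lifting) finite_lessThan lessThan_iff mult_eq_0_iff power_not_zero prod_zero_iff)

lemma \<sigma>0_k: "x \<in> k \<Longrightarrow> \<sigma>0 x = x" using \<sigma>0(2) .

text \<open>Hilbert's theorem 90 for the cyclic extension \<open>K/k\<close>: the element \<open>Y\<^sub>0\<^sup>n / \<theta>\<^sub>2\<^sup>n\<close> has norm \<open>1\<close>.\<close>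

lemma hilbert90: "\<exists>\<omega>\<in>K.ext. \<omega> \<noteq> 0 \<and> \<sigma>0 \<omega> = (Y 0 / \<theta>2) ^ n * \<omega>"
proof -
  \<comment> \<open>These are the conjugates of (y/\<theta>2)^n, which lies in K because \<theta>2^n
    lies in k. V i is the product of the first i of them, and V n is the norm.\<close>
  define v where "v j = Y j ^ n / \<theta>2 ^ n" for j
  define V where "V i = (\<Prod>t<i. v t)" for i
  note sK' = subfield_set_simps[OF K.subfield_ext]
  have v_K: "v j \<in> K.ext" for j unfolding v_def by (intro sK'(8,9) Y_K k_K \<theta>2_k)
  have V_K: "V i \<in> K.ext" for i unfolding V_def by (intro subfield_set_prod[OF K.subfield_ext] v_K)
  have \<sigma>v: "\<sigma>0 (v j) = v (Suc j)" for j
    unfolding v_def using \<theta>2_k by (simp add: sK.divide sK.power Y_K sK'(9) k_K \<sigma>0_k \<sigma>0_Y)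
  have \<sigma>V: "v 0 * \<sigma>0 (V i) = V (Suc i)" for i
    unfolding V_def by (simp only: sK.prod[OF v_K] \<sigma>v prod.lessThan_Suc_shift)
  have "(\<Prod>t<n. v t) = (\<Prod>t<n. Y t) ^ n / (\<theta>2 ^ n) ^ n"
    by (simp add: v_def prod_dividef prod_power_distrib)
  also have "(\<Prod>t<n. Y t) = Z ^ s * \<theta>2 ^ n" using norm by (simp add: Y_def)
  finally have Vn: "V n = 1" using \<theta>2_nz by (simp add: V_def power_mult_distrib Z_pow_n)
  \<comment> \<open>W m times \<theta>1^m is Hilbert's sum of the V i \<sigma>^i(x) at the test
    element x = \<theta>1^m. Adding the W m over all m isolates the term i = 0 and gives n, so some
    W m is nonzero.\<close>
  define W where "W m = (\<Sum>i<n. V i * (Z ^ i) ^ m)" for m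
  have "(\<Sum>m<n. W m) = (\<Sum>i<n. V i * (\<Sum>m<n. (Z ^ i) ^ m))"
    unfolding W_def by (subst sum.swap) (simp add: sum_distrib_left)
  also have "\<dots> = (\<Sum>i<n. if i = 0 then V 0 * of_nat n else 0)"
    by (intro sum.cong) (auto simp: orthogonality dest: dvd_imp_le)
  also have "\<dots> = of_nat n" using n_pos by (simp add: V_def)
  finally have "\<exists>m<n. W m \<noteq> 0" using n_nz by (metis (no_types, lifting) lessThan_iff sum.neutral)
  then obtain m where m: "W m \<noteq> 0" by blast
  define w where "w = W m * \<theta>1 ^ m"
  have Zi: "(Z ^ i) ^ m \<in> k" for i by (intro subfield_set_simps(9)[OF k] Z_k)
  have W_K: "W m \<in> K.ext" unfolding W_def by (intro subfield_set_sum[OF K.subfield_ext] sK'(4) V_K k_K Zi)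
  have w_K: "w \<in> K.ext" unfolding w_def by (intro sK'(4,9) W_K K.\<theta>_ext)
  have "v 0 * \<sigma>0 (W m) * Z ^ m = (\<Sum>i<n. (v 0 * \<sigma>0 (V i)) * (Z ^ i) ^ m * Z ^ m)"
    unfolding W_def
    by (simp add: sK.sum sK.mult V_K k_K Zi sK'(4) \<sigma>0_k sum_distrib_left sum_distrib_right mult_ac)
  also have "\<dots> = (\<Sum>i<n. V (Suc i) * (Z ^ Suc i) ^ m)"
    by (intro sum.cong) (simp_all only: \<sigma>V power_Suc power_mult_distrib mult_ac)
  also have "\<dots> = (\<Sum>i<Suc n. V i * (Z ^ i) ^ m) - V 0"
    by (subst sum.lessThan_Suc_shift) simp
  also have "\<dots> = W m" by (simp add: W_def Vn Z_n) (simp add: V_def)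
  finally have "v 0 * \<sigma>0 w = w"
    using sK.mult[OF W_K sK'(9)[OF K.\<theta>_ext]] sK.power[OF K.\<theta>_ext]
    by (simp add: w_def \<sigma>0(3) power_mult_distrib mult_ac)
  moreover have w0: "w \<noteq> 0" using m K.\<theta>_nz by (simp add: w_def)
  moreover have "\<sigma>0 w \<noteq> 0" by (rule sK.nonzero[OF w_K w0])
  \<comment> \<open>The sum w satisfies the desired equation with v 0 inverted, hence the passage to
    its inverse.\<close>
  ultimately have "inverse (\<sigma>0 w) = v 0 * inverse w" by (simp add: field_simps)
  then have "\<sigma>0 (inverse w) = v 0 * inverse w" using sK.inverse[OF w_K] by simp
  then show ?thesis using w_K w0 sK'(6) by (intro bexI[of _ "inverse w"]) (auto simp: v_def power_divide)
qed

definition \<omega> where "\<omega> = (SOME \<omega>. \<omega> \<in> K.ext \<and> \<omega> \<noteq> 0 \<and> \<sigma>0 \<omega> = (Y 0 / \<theta>2) ^ n * \<omega>)"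
definition \<eta> where "\<eta> = (SOME \<eta>. \<eta> ^ n = \<omega>)"
definition u where "u = Y 0 / \<theta>2"

lemma \<omega>: "\<omega> \<in> K.ext" "\<omega> \<noteq> 0" "\<sigma>0 \<omega> = u ^ n * \<omega>"
proof -
  have "\<exists>\<omega>. \<omega> \<in> K.ext \<and> \<omega> \<noteq> 0 \<and> \<sigma>0 \<omega> = (Y 0 / \<theta>2) ^ n * \<omega>" using hilbert90 by blast
  from someI_ex[OF this] show "\<omega> \<in> K.ext" "\<omega> \<noteq> 0" "\<sigma>0 \<omega> = u ^ n * \<omega>" unfolding \<omega>_def u_def by blast+
qed

lemma \<eta>: "\<eta> ^ n = \<omega>"
proof -
  have "\<exists>\<eta>. \<eta> ^ n = \<omega>" using nth_root_exists[OF n_pos] by blast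
  from someI_ex[OF this] show ?thesis unfolding \<eta>_def .
qed

lemma u_L: "u \<in> L.ext" unfolding u_def by (intro subfield_set_simps(8)[OF L.subfield_ext] K_L Y_K L.\<theta>_ext)

lemma u_nz: "u \<noteq> 0" using Y_nz[OF n_pos] \<theta>2_nz by (simp add: u_def)

lemma \<tau>_u: "\<tau> u = u / Z"
  using \<theta>2_nz Z_nz by (simp add: u_def tL.divide K_L Y_K L.\<theta>_ext \<tau>(2,3) field_simps)

text \<open>If c in L had c^p = \<omega>, then \<tau> c = Z^j c and \<sigma> c = Z^i u^p c for some
  i, j. As \<tau> u = u/Z, comparing \<sigma>(\<tau> c) with \<tau>(\<sigma> c) gives Z^p = 1, which
  is false because Z has order p^2.\<close>

lemma \<omega>_no_pth_root: assumes c: "c \<in> L.ext" shows "c ^ p \<noteq> \<omega>"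
proof
  assume eq: "c ^ p = \<omega>"
  note sL' = subfield_set_simps[OF L.subfield_ext]
  have c0: "c \<noteq> 0" using \<omega>(2) p_pos by (auto simp: zero_power simp flip: eq)
  have Zk: "Z ^ i \<in> k" for i by (rule subfield_set_simps(9)[OF k Z_k])
  have "\<sigma> c ^ p = (u ^ p * c) ^ p"
    using sL.power[OF c, of p] \<omega>(3) \<sigma>(2)[OF \<omega>(1)]
    by (simp add: eq power_mult_distrib n power2_eq_square power_mult)
  then obtain i where i: "\<sigma> c = Z ^ i * (u ^ p * c)"
    using pth_root_unique[of "\<sigma> c" "u ^ p * c"] c0 u_nz by auto
  have "\<tau> c ^ p = c ^ p"
    using tL.power[OF c, of p] \<tau>(2)[OF \<omega>(1)] by (simp add: eq)
  then obtain j where j: "\<tau> c = Z ^ j * c" using pth_root_unique[of "\<tau> c" c] c0 by auto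
  have "\<sigma> (\<tau> c) = Z ^ j * (Z ^ i * (u ^ p * c))"
    using sL.mult[OF k_L[OF Zk[of j]] c] \<sigma>_k[OF Zk] by (simp add: i j)
  moreover have "\<tau> (\<sigma> c) = Z ^ i * ((u / Z) ^ p * (Z ^ j * c))"
    using tL.mult[OF k_L[OF Zk[of i]] sL'(4)[OF sL'(9)[OF u_L] c]] tL.mult[OF sL'(9)[OF u_L] c]
      tL.power[OF u_L] \<tau>_k[OF Zk] by (simp add: i j \<tau>_u)
  ultimately have "Z ^ j * Z ^ i * c * u ^ p * Z ^ p = Z ^ j * Z ^ i * c * u ^ p * 1"
    using \<sigma>\<tau>[OF c] Z_nz by (simp add: field_simps)
  then have "Z ^ p = 1" using Z_nz c0 u_nz by simp
  then have "p ^ 2 dvd p" by (simp add: Z_eq_1 n)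
  then show False using prime_gt_1_nat[OF p] p_pos by (auto dest!: dvd_imp_le simp: power2_eq_square)
qed

sublocale M: kummer n Z p L.ext \<eta>
proof -
  have "\<eta> ^ n \<in> L.ext" using K_L[OF \<omega>(1)] by (simp add: \<eta>)
  moreover have "c ^ p \<noteq> \<eta> ^ n" if "c \<in> L.ext" for c using \<omega>_no_pth_root[OF that] by (simp add: \<eta>)
  ultimately show "kummer n Z p L.ext \<eta>" using L.subfield_ext k_L[OF Z_k]
    by (intro kummer.intro kummer_axioms.intro kummer_field_axioms)
qed

lemma L_M: "x \<in> L.ext \<Longrightarrow> x \<in> M.ext" using M.F_ext by blast
lemmas K_M = L_M[OF K_L] and k_M = L_M[OF k_L]
lemmas sM = subfield_set_simps[OF M.subfield_ext]

lemma M_eqI: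
  assumes "hom_on M.ext g" "hom_on M.ext h" "\<And>x. x \<in> k \<Longrightarrow> g x = h x" "g \<theta>1 = h \<theta>1" "g \<theta>2 = h \<theta>2"
  shows "x \<in> L.ext \<Longrightarrow> g x = h x" and "g \<eta> = h \<eta> \<Longrightarrow> x \<in> M.ext \<Longrightarrow> g x = h x"
proof -
  have gK: "hom_on K.ext g" "hom_on K.ext h" "hom_on L.ext g" "hom_on L.ext h"
    using assms(1,2) K_M L_M hom_on_subset by (metis subsetI)+
  have K: "g x = h x" if "x \<in> K.ext" for x
    by (rule K.hom_ext_eqI[OF gK(1,2) assms(3,4) that])
  have L: "g x = h x" if "x \<in> L.ext" for x
    by (rule L.hom_ext_eqI[OF gK(3,4) K assms(5) that])
  show "x \<in> L.ext \<Longrightarrow> g x = h x" by (rule L)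
  show "g \<eta> = h \<eta> \<Longrightarrow> x \<in> M.ext \<Longrightarrow> g x = h x"
    by (rule M.hom_ext_eqI[OF assms(1,2) L])
qed

lemma generator_exists:
  assumes "hom_on L.ext \<phi>" "\<And>x. x \<in> L.ext \<Longrightarrow> \<phi> x \<in> L.ext" "\<And>x. x \<in> k \<Longrightarrow> \<phi> x = x"
    "\<eta>' ^ n = \<phi> \<omega>" "\<eta>' \<in> M.ext"
  shows "\<exists>\<psi>. relative_endo k M.ext \<psi> \<and> (\<forall>x\<in>L.ext. \<psi> x = \<phi> x) \<and> \<psi> \<eta> = \<eta>'"
proof -
  obtain \<psi> where \<psi>: "hom_on M.ext \<psi>" "\<And>x. x \<in> L.ext \<Longrightarrow> \<psi> x = \<phi> x" "\<psi> \<eta> = \<eta>'"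
    using M.hom_extension[OF assms(1), of \<eta>'] assms(4) by (metis \<eta>)
  have "\<psi> x \<in> M.ext" if "x \<in> M.ext" for x
    using M.hom_ext_maps[OF \<psi>(1) M.subfield_ext _ _ that] \<psi>(2,3) assms(2,5) L_M by simp
  then show ?thesis using \<psi> assms(3) k_L by (intro exI[of _ \<psi>]) (auto simp: relative_endo_def hom_on_def)
qed

lemma heisenberg_extension:
  obtains A1 A2 B where "relative_endo k M.ext A1" "relative_endo k M.ext A2" "relative_endo k M.ext B"
    "heisenberg_relations n s M.ext A1 A2 B"
    "\<And>x. x \<in> M.ext \<Longrightarrow> A1 x = x \<Longrightarrow> A2 x = x \<Longrightarrow> B x = x \<Longrightarrow> x \<in> k"
    "\<And>i j l. i < n \<Longrightarrow> j < n \<Longrightarrow> l < n \<Longrightarrow> \<forall>x\<in>M.ext. (A1 ^^ i) ((A2 ^^ j) ((B ^^ l) x)) = x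
      \<Longrightarrow> i = 0 \<and> j = 0 \<and> l = 0"
    "\<And>g. relative_endo k M.ext g \<Longrightarrow> \<exists>i j l. \<forall>x\<in>M.ext. g x = (A1 ^^ i) ((A2 ^^ j) ((B ^^ l) x))"
proof -
  note Z_M = k_M[OF Z_k]
  have Zk: "Z ^ i \<in> k" for i by (rule subfield_set_simps(9)[OF k Z_k])
  have u\<eta>: "u * \<eta> \<in> M.ext" by (intro sM(4) L_M u_L M.\<theta>_ext)
  have u\<eta>n: "(u * \<eta>) ^ n = \<sigma> \<omega>" by (simp add: power_mult_distrib \<eta> \<sigma>(2)[OF \<omega>(1)] \<omega>(3))
  from generator_exists[OF \<sigma>(1) \<sigma>_L \<sigma>_k u\<eta>n u\<eta>] obtain A1 where
    A1: "relative_endo k M.ext A1" "\<And>x. x \<in> L.ext \<Longrightarrow> A1 x = \<sigma> x" "A1 \<eta> = u * \<eta>" by blast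
  have "\<eta> ^ n = \<tau> \<omega>" by (simp add: \<eta> \<tau>(2)[OF \<omega>(1)])
  from generator_exists[OF \<tau>(1) \<tau>_L \<tau>_k this M.\<theta>_ext] obtain A2 where
    A2: "relative_endo k M.ext A2" "\<And>x. x \<in> L.ext \<Longrightarrow> A2 x = \<tau> x" "A2 \<eta> = \<eta>" by blast
  have id: "hom_on L.ext (\<lambda>x. x)" by (simp add: hom_on_def)
  have "(Z * \<eta>) ^ n = \<omega>" by (simp add: power_mult_distrib \<eta> Z_n)
  from generator_exists[OF id _ _ this sM(4)[OF Z_M M.\<theta>_ext]] obtain B where
    B: "relative_endo k M.ext B" "\<And>x. x \<in> L.ext \<Longrightarrow> B x = x" "B \<eta> = Z * \<eta>" by blast
  note re = A1(1) A2(1) B(1)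
  have hom: "hom_on M.ext g" if "relative_endo k M.ext g" for g
    using relative_endo_hom_on[OF k that] .
  have fixk: "g x = x" if "relative_endo k M.ext g" "x \<in> k" for g x
    using that by (simp add: relative_endo_def)
  have multk: "g (x * y) = x * g y" if "relative_endo k M.ext g" "x \<in> k" "y \<in> M.ext" for g x y
    using that k_M by (simp add: relative_endo_def)
  have mult: "g (x * y) = g x * g y" if "relative_endo k M.ext g" "x \<in> M.ext" "y \<in> M.ext" for g x y
    using that by (simp add: relative_endo_def)
  note in_M = M.\<theta>_ext L_M[OF L.\<theta>_ext] K_M[OF K.\<theta>_ext] L_M[OF u_L]
  have gen: "A1 \<theta>1 = Z * \<theta>1" "A1 \<theta>2 = \<theta>2" "A2 \<theta>1 = \<theta>1" "A2 \<theta>2 = Z * \<theta>2" "B \<theta>1 = \<theta>1" "B \<theta>2 = \<theta>2"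
    by (simp_all add: A1(2) A2(2) B(2) \<sigma>(2,3) \<tau>(2,3) \<sigma>0(3) L.\<theta>_ext K_L[OF K.\<theta>_ext] K.\<theta>_ext)
  have multZ: "g (Z * y) = Z * g y" if "relative_endo k M.ext g" "y \<in> M.ext" for g y
    using multk[OF that(1) Z_k that(2)] .
  have multZp: "g (Z ^ i * y) = Z ^ i * g y" if "relative_endo k M.ext g" "y \<in> M.ext" for g y i
    using multk[OF that(1) Zk that(2)] .
  have pow_gen: "(A1 ^^ i) \<theta>1 = Z ^ i * \<theta>1" "(A1 ^^ i) \<theta>2 = \<theta>2" "(A2 ^^ i) \<theta>1 = \<theta>1"
    "(A2 ^^ i) \<theta>2 = Z ^ i * \<theta>2" "(B ^^ i) \<theta>1 = \<theta>1" "(B ^^ i) \<theta>2 = \<theta>2"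
    "(A2 ^^ i) \<eta> = \<eta>" "(B ^^ i) \<eta> = Z ^ i * \<eta>" for i
    by (induction i) (simp_all add: gen A2(3) B(3) multZp re in_M mult.left_commute)
  have A1Y: "A1 (Y j) = Y (Suc j)" for j
    by (simp add: A1(2) K_L Y_K \<sigma>(2) \<sigma>0_Y)
  have A1\<theta>2i: "A1 (inverse \<theta>2) = inverse \<theta>2"
    by (simp add: A1(2) L.\<theta>_ext subfield_set_simps(6)[OF L.subfield_ext] sL.inverse \<sigma>(3))
  \<comment> \<open>A1 fixes \<theta>2, so its iterates multiply \<eta> by the partial norms of u =
    y/\<theta>2.\<close>
  have A1\<eta>: "(A1 ^^ i) \<eta> = (\<Prod>t<i. Y t * inverse \<theta>2) * \<eta>" for i
  proof (induction i)
    case (Suc i)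
    have Yt: "Y t * inverse \<theta>2 \<in> M.ext" for t by (intro sM(4,6) K_M Y_K in_M)
    interpret h: subfield_hom M.ext A1 using hom[OF re(1)] M.subfield_ext by unfold_locales
    have "(A1 ^^ Suc i) \<eta> = (\<Prod>t<i. A1 (Y t * inverse \<theta>2)) * (u * \<eta>)"
      using subfield_set_prod[OF M.subfield_ext, of "{..<i}" "\<lambda>t. Y t * inverse \<theta>2"] Yt
      by (simp add: Suc h.mult h.prod Yt in_M A1(3))
    also have "(\<Prod>t<i. A1 (Y t * inverse \<theta>2)) = (\<Prod>t<i. Y (Suc t) * inverse \<theta>2)"
      by (intro prod.cong) (simp_all add: mult re A1Y A1\<theta>2i K_M Y_K sM(6) in_M)
    finally show ?case by (simp only: prod.lessThan_Suc_shift) (simp add: u_def divide_inverse mult_ac)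
  qed simp
  \<comment> \<open>The full norm of u is N(y)/\<theta>2^n = Z^s; this is where the norm equation
    becomes the relation between A1^n and B^s.\<close>
  have A1n: "(A1 ^^ n) \<eta> = Z ^ s * \<eta>"
  proof -
    have "(\<Prod>t<n. Y t * inverse \<theta>2) = (\<Prod>t<n. Y t) * inverse \<theta>2 ^ n"
      by (simp add: prod.distrib)
    also have "\<dots> = Z ^ s" using norm \<theta>2_nz by (simp add: Y_def power_inverse)
    finally show ?thesis by (simp add: A1\<eta>)
  qed
  have eqI: "g x = h x" if "relative_endo k M.ext g" "relative_endo k M.ext h"
    "g \<theta>1 = h \<theta>1" "g \<theta>2 = h \<theta>2" "g \<eta> = h \<eta>" "x \<in> M.ext" for g h x
    using M_eqI(2)[OF hom[OF that(1)] hom[OF that(2)]] that fixk by metis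
  note cp = relative_endo_comp and fp = relative_endo_funpow
  have idM: "relative_endo k M.ext (\<lambda>x. x)" by (simp add: relative_endo_def)
  have rel: "heisenberg_relations n s M.ext A1 A2 B"
    unfolding heisenberg_relations_def
  proof (intro ballI conjI)
    fix x assume x: "x \<in> M.ext"
    \<comment> \<open>A1 and A2 fail to commute only at \<eta>, where A2 divides the multiplier u of
      A1 by Z; B compensates for this factor.\<close>
    have A2u: "A2 u = u / Z" by (simp add: A2(2) u_L \<tau>_u)
    show "A1 (A2 x) = A2 (A1 (B x))"
      by (rule eqI[OF cp[OF re(1,2)] cp[OF re(2) cp[OF re(1,3)]] _ _ _ x])
        (simp_all add: gen multZ re in_M u\<eta> A1(3) A2(3) B(3) mult A2u Z_nz)
    show "A1 (B x) = B (A1 x)"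
      by (rule eqI[OF cp[OF re(1,3)] cp[OF re(3,1)] _ _ _ x])
        (simp_all add: gen multZ re in_M A1(3) B(3) mult B(2) u_L)
    show "A2 (B x) = B (A2 x)"
      by (rule eqI[OF cp[OF re(2,3)] cp[OF re(3,2)] _ _ _ x])
        (simp_all add: gen multZ re in_M A2(3) B(3))
    show "(A1 ^^ n) x = (B ^^ s) x"
      by (rule eqI[OF fp[OF re(1)] fp[OF re(3)] _ _ _ x]) (simp_all add: pow_gen Z_n A1n)
    show "(A2 ^^ n) x = x"
      by (rule eqI[OF fp[OF re(2)] idM _ _ _ x]) (simp_all add: pow_gen Z_n)
    show "(B ^^ n) x = x"
      by (rule eqI[OF fp[OF re(3)] idM _ _ _ x]) (simp_all add: pow_gen Z_n)
  qed
  have fixed: "x \<in> k" if "x \<in> M.ext" "A1 x = x" "A2 x = x" "B x = x" for x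
  proof -
    have L: "x \<in> L.ext" by (rule M.fixed_by_generator[OF hom[OF re(3)] B(2,3) that(1,4)])
    have "\<tau> x = x" using that(3) A2(2)[OF L] by metis
    then have K: "x \<in> K.ext" by (intro L.fixed_by_generator[OF \<tau> L])
    have "\<sigma>0 x = x" using that(2) A1(2)[OF L] \<sigma>(2)[OF K] by metis
    then show ?thesis by (intro K.fixed_by_generator[OF \<sigma>0 K])
  qed
  have comp: "relative_endo k M.ext (\<lambda>x. (A1 ^^ i) ((A2 ^^ j) ((B ^^ l) x)))" for i j l
    by (rule cp[OF fp[OF re(1)] cp[OF fp[OF re(2)] fp[OF re(3)]]])
  have c\<theta>: "(A1 ^^ i) ((A2 ^^ j) ((B ^^ l) \<theta>1)) = Z ^ i * \<theta>1"
    "(A1 ^^ i) ((A2 ^^ j) ((B ^^ l) \<theta>2)) = Z ^ j * \<theta>2"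
    "(A1 ^^ i) ((A2 ^^ j) ((B ^^ l) \<eta>)) = Z ^ l * (A1 ^^ i) \<eta>" for i j l
    by (simp_all add: pow_gen multZp fp re in_M)
  have faithful: "i = 0 \<and> j = 0 \<and> l = 0" if "i < n" "j < n" "l < n"
    and that: "\<forall>x\<in>M.ext. (A1 ^^ i) ((A2 ^^ j) ((B ^^ l) x)) = x" for i j l
  proof -
    have "Z ^ i = 1" using that c\<theta>(1)[of i j l] in_M(3) K.\<theta>_nz by simp
    moreover have "Z ^ j = 1" using that c\<theta>(2)[of i j l] in_M(2) \<theta>2_nz by simp
    ultimately have ij: "n dvd i" "n dvd j" by (simp_all add: Z_eq_1)
    then have 0: "i = 0" "j = 0" using \<open>i < n\<close> \<open>j < n\<close> by (auto dest: dvd_imp_le)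
    then have "Z ^ l = 1" using that c\<theta>(3)[of i j l] in_M(1) M.\<theta>_nz by simp
    then show ?thesis using 0 \<open>l < n\<close> by (auto simp: Z_eq_1 dest: dvd_imp_le)
  qed
  \<comment> \<open>g agrees on L with a product h of powers of A1 and A2, so g \<eta> and h \<eta>
    have the same n-th power and differ by a power of Z, which a power of B supplies.\<close>
  have generate: "\<exists>i j l. \<forall>x\<in>M.ext. g x = (A1 ^^ i) ((A2 ^^ j) ((B ^^ l) x))" if g: "relative_endo k M.ext g" for g
  proof -
    interpret g: subfield_hom M.ext g using hom[OF g] M.subfield_ext by unfold_locales
    have "g \<theta>1 ^ n = \<theta>1 ^ n" using g.power[of \<theta>1 n] in_M fixk[OF g \<theta>1_k] by simp
    then obtain i where i: "g \<theta>1 = Z ^ i * \<theta>1" using K.root_q by blast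
    have "g \<theta>2 ^ n = \<theta>2 ^ n" using g.power[of \<theta>2 n] in_M fixk[OF g \<theta>2_k] by simp
    then obtain j where j: "g \<theta>2 = Z ^ j * \<theta>2" using L.root_q by blast
    define h where "h x = (A1 ^^ i) ((A2 ^^ j) x)" for x
    have h: "relative_endo k M.ext h" unfolding h_def by (rule cp[OF fp[OF re(1)] fp[OF re(2)]])
    have h\<theta>: "h \<theta>1 = Z ^ i * \<theta>1" "h \<theta>2 = Z ^ j * \<theta>2" "h \<eta> = (A1 ^^ i) \<eta>"
      by (simp_all add: h_def pow_gen multZp fp re in_M)
    interpret h: subfield_hom M.ext h using hom[OF h] M.subfield_ext by unfold_locales
    have "g \<omega> = h \<omega>"
      using M_eqI(1)[OF hom[OF g] hom[OF h] _ _ _ K_L[OF \<omega>(1)]] fixk[OF g] fixk[OF h] i j h\<theta> by simp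
    then have "g \<eta> ^ n = h \<eta> ^ n" using g.power[of \<eta> n] h.power[of \<eta> n] in_M by (simp add: \<eta>)
    moreover have "h \<eta> \<noteq> 0" by (rule h.nonzero[OF in_M(1) M.\<theta>_nz])
    ultimately have "(g \<eta> / h \<eta>) ^ n = 1" by (simp add: power_divide)
    then obtain l where "g \<eta> / h \<eta> = Z ^ l" using root_of_unity by blast
    then have "g \<eta> = Z ^ l * (A1 ^^ i) \<eta>" using \<open>h \<eta> \<noteq> 0\<close> h\<theta>(3) by (simp add: field_simps)
    then have "g \<eta> = (A1 ^^ i) ((A2 ^^ j) ((B ^^ l) \<eta>))" by (simp only: c\<theta>)
    moreover have "g \<theta>1 = (A1 ^^ i) ((A2 ^^ j) ((B ^^ l) \<theta>1))" "g \<theta>2 = (A1 ^^ i) ((A2 ^^ j) ((B ^^ l) \<theta>2))"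
      by (simp_all only: c\<theta> i j)
    ultimately have "\<forall>x\<in>M.ext. g x = (A1 ^^ i) ((A2 ^^ j) ((B ^^ l) x))"
      by (intro ballI) (rule eqI[OF g comp])
    then show ?thesis by blast
  qed
  from that[OF re rel fixed faithful generate] show thesis .
qed

end

section \<open>A norm from a Galois extension\<close>

text \<open>Dedekind's argument: pick y where \<chi> r and \<chi> t differ, evaluate the relation at
  x * y and subtract \<chi> t y times the relation at x. The term of t cancels, and induction
  applies to the shorter relation.\<close>

lemma dedekind_independence:
  fixes \<chi> :: "'i \<Rightarrow> 'c::field \<Rightarrow> 'c"
  assumes "finite S"
    and M: "\<And>x y. x \<in> M \<Longrightarrow> y \<in> M \<Longrightarrow> x * y \<in> M" "1 \<in> M"
    and mult: "\<And>s x y. s \<in> S \<Longrightarrow> x \<in> M \<Longrightarrow> y \<in> M \<Longrightarrow> \<chi> s (x * y) = \<chi> s x * \<chi> s y"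
    and one: "\<And>s. s \<in> S \<Longrightarrow> \<chi> s 1 = 1"
    and distinct: "\<And>s t. s \<in> S \<Longrightarrow> t \<in> S \<Longrightarrow> (\<forall>x\<in>M. \<chi> s x = \<chi> t x) \<Longrightarrow> s = t"
    and zero: "\<And>x. x \<in> M \<Longrightarrow> (\<Sum>s\<in>S. c s * \<chi> s x) = 0"
    and "s \<in> S"
  shows "c s = 0"
  using assms
proof (induction S arbitrary: c s rule: finite_induct)
  case (insert t S)
  have S: "c r = 0" if r: "r \<in> S" for r
  proof -
    obtain y where y: "y \<in> M" "\<chi> r y \<noteq> \<chi> t y" using insert.prems(5)[of r t] r insert.hyps by auto
    have "c r * (\<chi> r y - \<chi> t y) = 0"
    proof (rule insert.IH[of "\<lambda>s. c s * (\<chi> s y - \<chi> t y)" r])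
      fix x assume x: "x \<in> M"
      have "(\<Sum>s\<in>insert t S. c s * \<chi> s (x * y)) - \<chi> t y * (\<Sum>s\<in>insert t S. c s * \<chi> s x) = 0"
        using insert.prems(6)[OF x] insert.prems(6)[OF insert.prems(1)[OF x y(1)]] by simp
      also have "(\<Sum>s\<in>insert t S. c s * \<chi> s (x * y)) - \<chi> t y * (\<Sum>s\<in>insert t S. c s * \<chi> s x)
          = (\<Sum>s\<in>insert t S. c s * (\<chi> s x * \<chi> s y) - \<chi> t y * (c s * \<chi> s x))"
        using x y insert.prems(3) by (simp add: sum_distrib_left sum_subtractf)
      also have "\<dots> = (\<Sum>s\<in>S. c s * (\<chi> s x * \<chi> s y) - \<chi> t y * (c s * \<chi> s x))"
        using insert.hyps by (simp add: mult_ac)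
      also have "\<dots> = (\<Sum>s\<in>S. c s * (\<chi> s y - \<chi> t y) * \<chi> s x)"
        by (intro sum.cong) (simp_all add: algebra_simps)
      finally show "(\<Sum>s\<in>S. c s * (\<chi> s y - \<chi> t y) * \<chi> s x) = 0" .
    qed (use insert.prems r in auto)
    then show ?thesis using y(2) by simp
  qed
  have "c t = 0" using insert.prems(6)[OF insert.prems(2)] insert.hyps S insert.prems(4)[of t] by simp
  then show ?case using S insert.prems(7) by auto
qed simp

section \<open>Joint eigenvectors in a Galois extension\<close>

locale heisenberg_galois = kummer_field n Z p for n and Z :: "'c::alg_closed_field" and p +
  fixes k M :: "'c set" and A1 A2 B :: "'c \<Rightarrow> 'c" and s :: nat
  assumes k: "subfield_set k" and M: "subfield_set M" and k_M: "x \<in> k \<Longrightarrow> x \<in> M" and Z_k: "Z \<in> k"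
    and A1: "relative_endo k M A1" and A2: "relative_endo k M A2" and B: "relative_endo k M B"
    and rel: "heisenberg_relations n s M A1 A2 B"
    and fixed: "x \<in> M \<Longrightarrow> A1 x = x \<Longrightarrow> A2 x = x \<Longrightarrow> B x = x \<Longrightarrow> x \<in> k"
    and distinct: "i < n \<Longrightarrow> j < n \<Longrightarrow> l < n \<Longrightarrow> i' < n \<Longrightarrow> j' < n \<Longrightarrow> l' < n \<Longrightarrow>
      \<forall>x\<in>M. (A1 ^^ i) ((A2 ^^ j) ((B ^^ l) x)) = (A1 ^^ i') ((A2 ^^ j') ((B ^^ l') x)) \<Longrightarrow>
      i = i' \<and> j = j' \<and> l = l'"
    and n_nz: "of_nat n \<noteq> (0::'c)"
begin

lemmas sM = subfield_set_simps[OF M]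
lemmas sk = subfield_set_simps[OF k]

sublocale A1: subfield_hom M A1 using M relative_endo_hom_on[OF k A1] by unfold_locales
sublocale A2: subfield_hom M A2 using M relative_endo_hom_on[OF k A2] by unfold_locales
sublocale B: subfield_hom M B using M relative_endo_hom_on[OF k B] by unfold_locales

lemmas in_M = relative_endo_closed[OF A1] relative_endo_closed[OF A2] relative_endo_closed[OF B]
  relative_endo_closed[OF relative_endo_funpow[OF A1]] relative_endo_closed[OF relative_endo_funpow[OF A2]]
  relative_endo_closed[OF relative_endo_funpow[OF B]]

lemma rels:
  assumes "x \<in> M"
  shows "A1 (A2 x) = A2 (A1 (B x))" "A1 (B x) = B (A1 x)" "A2 (B x) = B (A2 x)"
    "(A1 ^^ n) x = (B ^^ s) x" "(A2 ^^ n) x = x" "(B ^^ n) x = x"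
  using rel assms by (auto simp: heisenberg_relations_def)

lemma relative_endo_scale: "relative_endo k M g \<Longrightarrow> c \<in> k \<Longrightarrow> x \<in> M \<Longrightarrow> g (c * x) = c * g x"
  using k_M by (simp add: relative_endo_def)

lemma relative_endo_sum:
  assumes g: "relative_endo k M g" and "\<And>i. i \<in> S \<Longrightarrow> c i \<in> k" "\<And>i. i \<in> S \<Longrightarrow> x i \<in> M"
  shows "g (\<Sum>i\<in>S. c i * x i) = (\<Sum>i\<in>S. c i * g (x i))"
proof -
  interpret g: subfield_hom M g using M relative_endo_hom_on[OF k g] by unfold_locales
  have "c i * x i \<in> M" if "i \<in> S" for i using assms(2,3) k_M sM(4) that by blast
  then show ?thesis using assms relative_endo_scale[OF g] by (simp add: g.sum)
qed

text \<open>A Lagrange resolvent. If c^n = 1 and g^n fixes x, it is n times the projection of x to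
  the eigenvalue 1/c; the eigenvector property is phrased as c * g t = t to avoid the
  inverse.\<close>

definition proj :: "('c \<Rightarrow> 'c) \<Rightarrow> 'c \<Rightarrow> 'c \<Rightarrow> 'c" where
  "proj g c x = (\<Sum>i<n. c ^ i * (g ^^ i) x)"

lemma proj_in: assumes "relative_endo k M g" "c \<in> k" "x \<in> M" shows "proj g c x \<in> M"
  unfolding proj_def using assms relative_endo_closed[OF relative_endo_funpow[OF assms(1)]] k_M sk(9)
  by (intro subfield_set_sum[OF M] sM(4)) auto

lemma proj_eigen:
  assumes g: "relative_endo k M g" and c: "c \<in> k" "c ^ n = 1" and x: "x \<in> M" "(g ^^ n) x = x"
  shows "c * g (proj g c x) = proj g c x"
proof -
  have "c * g (proj g c x) = (\<Sum>i<n. c ^ Suc i * (g ^^ Suc i) x)"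
    unfolding proj_def
    using relative_endo_sum[OF g, of "{..<n}" "\<lambda>i. c ^ i" "\<lambda>i. (g ^^ i) x"] sk(9)[OF c(1)]
      relative_endo_closed[OF relative_endo_funpow[OF g] x(1)]
    by (simp add: sum_distrib_left mult_ac)
  also have "\<dots> = (\<Sum>i<Suc n. c ^ i * (g ^^ i) x) - x"
    by (subst sum.lessThan_Suc_shift) simp
  also have "\<dots> = proj g c x" by (simp add: proj_def c x)
  finally show ?thesis .
qed

lemma proj_commute:
  assumes g: "relative_endo k M g" and h: "relative_endo k M h" and c: "c \<in> k" and e: "e \<in> k" and x: "x \<in> M"
    and hgx: "\<And>i. h ((g ^^ i) x) = e * (g ^^ i) x"
  shows "h (proj g c x) = e * proj g c x"
  unfolding proj_def
  using relative_endo_sum[OF h, of "{..<n}" "\<lambda>i. c ^ i" "\<lambda>i. (g ^^ i) x"] sk(9)[OF c(1)]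
      relative_endo_closed[OF relative_endo_funpow[OF g] x(1)]
  by (simp add: hgx sum_distrib_left mult_ac)

lemma proj_A2_B:
  assumes x: "x \<in> M" and c: "c2 \<in> k" "c2 ^ n = 1" "c3 \<in> k" "c3 ^ n = 1"
  defines "y \<equiv> proj A2 c2 (proj B c3 x)"
  shows "y \<in> M" "c2 * A2 y = y" "c3 * B y = y"
proof -
  define w where "w = proj B c3 x"
  have w: "w \<in> M" "c3 * B w = w"
    using proj_in[OF B c(3) x] proj_eigen[OF B c(3,4) x rels(6)[OF x]] by (simp_all add: w_def)
  have y: "y = proj A2 c2 w" by (simp add: y_def w_def)
  show yM: "y \<in> M" unfolding y by (rule proj_in[OF A2 c(1) w(1)])
  show "c2 * A2 y = y" unfolding y by (rule proj_eigen[OF A2 c(1,2) w(1) rels(5)[OF w(1)]])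
  have c30: "c3 \<noteq> 0" using c(4) n_pos by (auto simp: zero_power)
  then have Bw: "B w = inverse c3 * w" using w(2) by (simp add: field_simps)
  have "B ((A2 ^^ i) w) = inverse c3 * (A2 ^^ i) w" for i
  proof (induction i)
    case (Suc i)
    have "B (A2 ((A2 ^^ i) w)) = A2 (B ((A2 ^^ i) w))" using rels(3) in_M(5)[OF w(1)] by simp
    then show ?case using Suc relative_endo_scale[OF A2 sk(6)[OF c(3)] in_M(5)[OF w(1)]] by simp
  qed (simp add: Bw)
  then have "B y = inverse c3 * y" unfolding y
    by (intro proj_commute[OF A2 B c(1) sk(6)[OF c(3)] w(1)])
  then show "c3 * B y = y" using c30 by simp
qed

text \<open>On vectors fixed by B, the relation between A1 and A2 becomes commutation and A1^n = B^s
  becomes the identity. Projecting for A1 therefore keeps the eigenvector property for A2.\<close>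

lemma proj_A1:
  assumes x: "x \<in> M" "B x = x" "A2 x = e * x" and e: "e \<in> k" and c: "c \<in> k" "c ^ n = 1"
  defines "t \<equiv> proj A1 c x"
  shows "t \<in> M" "B t = t" "A2 t = e * t" "c * A1 t = t"
proof -
  show "t \<in> M" unfolding t_def by (rule proj_in[OF A1 c(1) x(1)])
  have "(B ^^ i) x = x" for i by (induction i) (simp_all add: x)
  then show "c * A1 t = t" unfolding t_def using rels(4)[OF x(1)] by (intro proj_eigen[OF A1 c x(1)]) simp
  have Bi: "B ((A1 ^^ i) x) = (A1 ^^ i) x" for i
  proof (induction i)
    case (Suc i)
    have "B (A1 ((A1 ^^ i) x)) = A1 (B ((A1 ^^ i) x))"
      by (rule rels(2)[OF in_M(4)[OF x(1)], symmetric])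
    then show ?case using Suc by simp
  qed (simp add: x)
  then show "B t = t" unfolding t_def
    using proj_commute[OF A1 B c(1) sk(2) x(1)] by simp
  have "A2 ((A1 ^^ i) x) = e * (A1 ^^ i) x" for i
  proof (induction i)
    case (Suc i)
    have "A2 (A1 ((A1 ^^ i) x)) = A1 (A2 ((A1 ^^ i) x))"
      using rels(1)[OF in_M(4)[OF x(1), of i]] Bi by simp
    then show ?case using Suc relative_endo_scale[OF A1 e in_M(4)[OF x(1)]] by simp
  qed (simp add: x)
  then show "A2 t = e * t" unfolding t_def by (intro proj_commute[OF A1 A2 c(1) e x(1)])
qed

lemma proj_sum:
  assumes g: "relative_endo k M g" and c: "c1 \<in> k" "\<And>r. r \<in> S \<Longrightarrow> c r \<in> k" 
    and x: "\<And>r. r \<in> S \<Longrightarrow> y r \<in> M"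
  shows "proj g c1 (\<Sum>r\<in>S. c r * y r) = (\<Sum>(i, r)\<in>{..<n} \<times> S. (c1 ^ i * c r) * (g ^^ i) (y r))"
  unfolding proj_def
  using relative_endo_sum[OF relative_endo_funpow[OF g], of S c y] c x
  by (simp add: sum.cartesian_product[symmetric] sum_distrib_left mult.assoc)

text \<open>Independence of the n^3 different multiplicative maps A1^i A2^j B^l. Iterated
  projections expand into such sums, so they do not vanish identically; this is how nonzero
  eigenvectors are found.\<close>

lemma nonvanishing:
  assumes S: "S \<subseteq> {..<n} \<times> {..<n} \<times> {..<n}" and r: "r \<in> S" "c r \<noteq> 0"
  shows "\<exists>x\<in>M. (\<Sum>(i, j, l)\<in>S. c (i, j, l) * (A1 ^^ i) ((A2 ^^ j) ((B ^^ l) x))) \<noteq> 0"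
proof (rule ccontr)
  define \<chi> where "\<chi> = (\<lambda>(i, j, l) x. (A1 ^^ i) ((A2 ^^ j) ((B ^^ l) x)))"
  have re: "relative_endo k M (\<chi> r)" for r
    unfolding \<chi>_def
    using relative_endo_comp[OF relative_endo_funpow[OF A1]
        relative_endo_comp[OF relative_endo_funpow[OF A2] relative_endo_funpow[OF B]]]
    by (cases r) simp
  assume "\<not> ?thesis"
  then have zero: "(\<Sum>r\<in>S. c r * \<chi> r x) = 0" if "x \<in> M" for x
    using that by (auto simp: \<chi>_def case_prod_unfold)
  have "c r = 0"
  proof (rule dedekind_independence[OF _ sM(4) sM(2) _ _ _ zero r(1)])
    show "finite S" using finite_subset[OF S] by auto
    show "\<chi> s (x * y) = \<chi> s x * \<chi> s y" if "x \<in> M" "y \<in> M" for s x y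
      using re[of s] that by (simp add: relative_endo_def)
    show "\<chi> s 1 = 1" for s using re[of s] sk(2) by (simp add: relative_endo_def)
    fix s t assume "s \<in> S" "t \<in> S" "\<forall>x\<in>M. \<chi> s x = \<chi> t x"
    then show "s = t" using S distinct[of "fst s" "fst (snd s)" "snd (snd s)" "fst t" "fst (snd t)" "snd (snd t)"]
      by (cases s; cases t) (force simp: \<chi>_def)
  qed
  then show False using r(2) by simp
qed

lemma proj_nonzero_2:
  assumes c: "c2 \<in> k" "c3 \<in> k"
  shows "\<exists>x\<in>M. proj A2 c2 (proj B c3 x) \<noteq> 0"
proof -
  \<comment> \<open>Padding with i = 0 turns the double sum into an instance of the threefold
    one.\<close>
  have "\<exists>x\<in>M. (\<Sum>(i, j, l)\<in>{0} \<times> {..<n} \<times> {..<n}. (\<lambda>(i, j, l). c2 ^ j * c3 ^ l) (i, j, l) * (A1 ^^ i) ((A2 ^^ j) ((B ^^ l) x))) \<noteq> 0"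
    by (rule nonvanishing[of _ "(0, 0, 0)"]) (use n_pos in auto)
  then obtain x where x: "x \<in> M" "(\<Sum>(i, j, l)\<in>{0} \<times> {..<n} \<times> {..<n}. c2 ^ j * c3 ^ l * (A1 ^^ i) ((A2 ^^ j) ((B ^^ l) x))) \<noteq> 0"
    by auto
  have "proj A2 c2 (proj B c3 x) = (\<Sum>(j, l)\<in>{..<n} \<times> {..<n}. c2 ^ j * c3 ^ l * (A2 ^^ j) ((B ^^ l) x))"
    unfolding proj_def[of B] using c sk(9) in_M(6) x(1) by (intro proj_sum[OF A2]) auto
  also have "\<dots> = (\<Sum>(i, j, l)\<in>{0} \<times> {..<n} \<times> {..<n}. c2 ^ j * c3 ^ l * (A1 ^^ i) ((A2 ^^ j) ((B ^^ l) x)))"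
    by (simp add: sum.cartesian_product[symmetric])
  finally have "proj A2 c2 (proj B c3 x) \<noteq> 0" using x(2) by (simp only:) simp
  then show ?thesis using x(1) by blast
qed

lemma proj_nonzero_3:
  assumes c: "c1 \<in> k" "c2 \<in> k" "c3 \<in> k"
  shows "\<exists>x\<in>M. proj A1 c1 (proj A2 c2 (proj B c3 x)) \<noteq> 0"
proof -
  have "\<exists>x\<in>M. (\<Sum>(i, j, l)\<in>{..<n} \<times> {..<n} \<times> {..<n}. (\<lambda>(i, j, l). c1 ^ i * (c2 ^ j * c3 ^ l)) (i, j, l) * (A1 ^^ i) ((A2 ^^ j) ((B ^^ l) x))) \<noteq> 0"
    by (rule nonvanishing[of _ "(0, 0, 0)"]) (use n_pos in auto)
  then obtain x where x: "x \<in> M" "(\<Sum>(i, j, l)\<in>{..<n} \<times> {..<n} \<times> {..<n}. c1 ^ i * (c2 ^ j * c3 ^ l) * (A1 ^^ i) ((A2 ^^ j) ((B ^^ l) x))) \<noteq> 0"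
    by auto
  have 1: "proj A2 c2 (proj B c3 x) = (\<Sum>r\<in>{..<n} \<times> {..<n}. (c2 ^ fst r * c3 ^ snd r) * (A2 ^^ fst r) ((B ^^ snd r) x))"
    using proj_sum[OF A2 c(2), of "{..<n}" "\<lambda>l. c3 ^ l" "\<lambda>l. (B ^^ l) x"] c sk(9) in_M(6) x(1)
    by (simp add: proj_def[of B] case_prod_unfold)
  have "proj A1 c1 (proj A2 c2 (proj B c3 x)) = (\<Sum>(i, r)\<in>{..<n} \<times> ({..<n} \<times> {..<n}).
      (c1 ^ i * (c2 ^ fst r * c3 ^ snd r)) * (A1 ^^ i) ((A2 ^^ fst r) ((B ^^ snd r) x)))"
    unfolding 1 using c sk(4,9) in_M(5,6) x(1) by (intro proj_sum[OF A1]) auto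
  then have "proj A1 c1 (proj A2 c2 (proj B c3 x)) \<noteq> 0" using x(2) by (simp only: case_prod_unfold) simp
  then show ?thesis using x(1) by blast
qed

lemma Z_power_int: assumes "Z powi m = 1" shows "int n dvd m"
proof (cases "m \<ge> 0")
  case True
  then have "Z ^ nat m = 1" using assms by (simp add: power_int_def)
  then show ?thesis using True by (simp add: Z_eq_1 int_dvd_int_iff[symmetric])
next
  case False
  then have "Z ^ nat (- m) = 1" using assms by (simp add: power_int_def power_inverse)
  then have "int n dvd - m" using False by (simp add: Z_eq_1 int_dvd_int_iff[symmetric])
  then show ?thesis by simp
qed

text \<open>For w = \<theta>^i \<theta>'^j the hypothesis reads w^n = c^p, so w^p is c times a power
  of Z and lies in k. It is then fixed by g, while g w = Z^i w; hence Z^(ip) = 1 and p divides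
  i.\<close>

lemma independent_eigenvectors:
  assumes \<theta>: "\<theta> \<in> M" "\<theta>' \<in> M" "\<theta> \<noteq> 0" "\<theta>' \<noteq> 0" and g: "relative_endo k M g" "g \<theta> = Z * \<theta>" "g \<theta>' = \<theta>'"
    and c: "c \<in> k" "c \<noteq> 0" "(\<theta> ^ n) powi i * (\<theta>' ^ n) powi j = c ^ p"
  shows "int p dvd i"
proof -
  interpret g: subfield_hom M g using M relative_endo_hom_on[OF k g(1)] by unfold_locales
  define w where "w = \<theta> powi i * \<theta>' powi j"
  have powi: "x powi m \<in> M" "g (x powi m) = g x powi m" if "x \<in> M" for x m
    using that sM(6,9) by (auto simp: power_int_def g.power g.inverse)
  have w: "w \<in> M" "w \<noteq> 0" using powi \<theta> sM(4) by (auto simp: w_def)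
  have "(x powi m) ^ n = (x ^ n) powi m" for x :: 'c and m
    by (simp only: power_int_power power_int_power' mult.commute)
  then have "w ^ n = c ^ p" using c(3) by (simp only: w_def power_mult_distrib)
  then have "(w ^ p) ^ p = c ^ p" by (simp add: n power2_eq_square power_mult)
  then obtain t where t: "w ^ p = Z ^ t * c" using pth_root_unique c(2) by blast
  have "w ^ p \<in> k" unfolding t by (intro sk(4,9) Z_k c)
  then have "g (w ^ p) = w ^ p" using g(1) unfolding relative_endo_def by blast
  then have "g w ^ p = w ^ p" by (simp only: g.power[OF w(1)])
  moreover have "g w = Z powi i * w"
    using powi \<theta> by (simp add: w_def g.mult g(2,3) power_int_mult_distrib)
  ultimately have "(Z powi i) ^ p = 1" using w(2) by (simp add: power_mult_distrib)
  then have "Z powi (i * int p) = 1" by (simp add: power_int_mult)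
  then have "int n dvd i * int p" by (rule Z_power_int)
  then show ?thesis using p_pos by (simp add: n power2_eq_square)
qed

lemma kummer_generators:
  obtains \<theta>1 \<theta>2 f where "\<theta>1 ^ n \<in> k" "\<theta>2 ^ n \<in> k" "\<theta>1 \<noteq> 0" "\<theta>2 \<noteq> 0" "f \<in> polys_over k"
    "\<And>c i j. c \<in> k \<Longrightarrow> c \<noteq> 0 \<Longrightarrow> (\<theta>1 ^ n) powi i * (\<theta>2 ^ n) powi j = c ^ p \<Longrightarrow> int p dvd i \<and> int p dvd j"
    "(\<Prod>j<n. poly f (Z ^ j * \<theta>1)) = Z ^ s * \<theta>2 ^ n"
proof -
  \<comment> \<open>As eigenvectors are characterized by c * g t = t, the eigenvalue Z is obtained
    with c = 1/Z.\<close>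
  define Zi where "Zi = inverse Z"
  have Zi: "Zi \<in> k" "Zi ^ n = 1" "Zi * Z = 1" "Z * Zi = 1" "Zi \<noteq> 0"
    using sk(6)[OF Z_k] Z_nz by (simp_all add: Zi_def power_inverse Z_n)
  note one = sk(2) power_one[of n]
  have solve: "y = Z * x" if "Zi * y = x" for x y :: 'c
    using that Zi(4) by (metis mult.assoc mult_1)
  have eig: "\<exists>t\<in>M. t \<noteq> 0 \<and> B t = t \<and> c2 * A2 t = t \<and> c1 * A1 t = t"
    if c: "c1 \<in> k" "c1 ^ n = 1" "c2 \<in> k" "c2 ^ n = 1" for c1 c2
  proof -
    obtain x where x: "x \<in> M" "proj A1 c1 (proj A2 c2 (proj B 1 x)) \<noteq> 0"
      using proj_nonzero_3[OF c(1,3) sk(2)] by blast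
    define y where "y = proj A2 c2 (proj B 1 x)"
    note y = proj_A2_B[OF x(1) c(3,4) one, folded y_def]
    have c20: "c2 \<noteq> 0" using c(4) n_pos by (auto simp: zero_power)
    then have "A2 y = inverse c2 * y" using y(2) by (simp add: field_simps)
    note t = proj_A1[OF y(1) _ this sk(6)[OF c(3)] c(1,2)]
    show ?thesis using t y(3) x(2) c20 by (intro bexI[of _ "proj A1 c1 y"]) (auto simp: y_def)
  qed
  obtain \<theta>1 where \<theta>1': "\<theta>1 \<in> M" "\<theta>1 \<noteq> 0" "B \<theta>1 = \<theta>1" "1 * A2 \<theta>1 = \<theta>1" "Zi * A1 \<theta>1 = \<theta>1"
    using eig[OF Zi(1,2) one] by blast
  note \<theta>1 = \<theta>1'(1-3) \<theta>1'(4)[unfolded mult_1] solve[OF \<theta>1'(5)]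
  obtain \<theta>2 where \<theta>2': "\<theta>2 \<in> M" "\<theta>2 \<noteq> 0" "B \<theta>2 = \<theta>2" "Zi * A2 \<theta>2 = \<theta>2" "1 * A1 \<theta>2 = \<theta>2"
    using eig[OF one Zi(1,2)] by blast
  note \<theta>2 = \<theta>2'(1-3) solve[OF \<theta>2'(4)] \<theta>2'(5)[unfolded mult_1]
  \<comment> \<open>Where B has eigenvalue Z, the maps A1 and A2 do not commute, so \<eta> is made
    an eigenvector of A2 and B only; the ratio u below takes the place of an A1-eigenvalue.\<close>
  obtain x where x: "x \<in> M" "proj A2 1 (proj B Zi x) \<noteq> 0" using proj_nonzero_2[OF sk(2) Zi(1)] by blast
  define \<eta> where "\<eta> = proj A2 1 (proj B Zi x)"
  note \<eta>' = proj_A2_B[OF x(1) one Zi(1,2), folded \<eta>_def]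
  have "\<eta> \<noteq> 0" using x(2) by (simp add: \<eta>_def)
  note \<eta> = \<eta>'(1) this \<eta>'(2)[unfolded mult_1] solve[OF \<eta>'(3)]
  have \<theta>1k: "\<theta>1 ^ n \<in> k"
    by (rule fixed) (simp_all add: sM(9) A1.power A2.power B.power \<theta>1 power_mult_distrib Z_n)
  have \<theta>2k: "\<theta>2 ^ n \<in> k"
    by (rule fixed) (simp_all add: sM(9) A1.power A2.power B.power \<theta>2 power_mult_distrib Z_n)
  define u where "u = A1 \<eta> / \<eta>"
  have A1\<eta>: "A1 \<eta> = u * \<eta>" "A1 \<eta> \<in> M" using \<eta> in_M by (simp_all add: u_def)
  have u: "u \<in> M" unfolding u_def by (intro sM(8) A1\<eta> \<eta>)
  have "B (A1 \<eta>) = Z * A1 \<eta>"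
    using rels(2)[OF \<eta>(1)] relative_endo_scale[OF A1 Z_k \<eta>(1)] \<eta>(4) by simp
  then have Bu: "B u = u" unfolding u_def using B.divide[OF A1\<eta>(2) \<eta>(1)] \<eta> Z_nz by simp
  have "A1 \<eta> = A2 (A1 (Z * \<eta>))" using rels(1)[OF \<eta>(1)] \<eta> by simp
  also have "\<dots> = Z * A2 (A1 \<eta>)"
    using relative_endo_scale[OF A1 Z_k \<eta>(1)] relative_endo_scale[OF A2 Z_k A1\<eta>(2)] by simp
  finally have "A2 (A1 \<eta>) = Zi * A1 \<eta>" using Z_nz by (simp add: Zi_def field_simps)
  then have A2u: "A2 u = Zi * u" unfolding u_def using A2.divide[OF A1\<eta>(2) \<eta>(1)] \<eta> by simp
  \<comment> \<open>A2 divides u by Z and multiplies \<theta>2 by Z, so y is fixed by A2 and B and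
    can be expected to be a polynomial in \<theta>1 over k.\<close>
  define y where "y = u * \<theta>2"
  have y: "y \<in> M" "B y = y" "A2 y = y" using u \<theta>2 Zi sM(4) 
    by (simp_all add: y_def B.mult A2.mult Bu A2u)
  \<comment> \<open>The resolvent of y has A1-eigenvalue Z^(-j), which the factor \<theta>1^j
    cancels: the c j are Fourier coefficients of y and lie in k.\<close>
  define c where "c j = proj A1 (Z ^ j) y * \<theta>1 ^ j / of_nat n" for j
  have c_k: "c j \<in> k" for j
  proof -
    have Zj: "Z ^ j \<in> k" "(Z ^ j) ^ n = 1" using sk(9)[OF Z_k] Z_pow_n by auto
    define t where "t = proj A1 (Z ^ j) y"
    have "A2 y = 1 * y" using y(3) by simp
    note t = proj_A1[OF y(1,2) this sk(2) Zj, folded t_def]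
    have nM: "of_nat n \<in> M" "of_nat n \<in> k" using subfield_set_of_nat M k by blast+
    have \<theta>j: "\<theta>1 ^ j \<in> M" "t * \<theta>1 ^ j \<in> M" using sM(4,9) \<theta>1(1) t(1) by auto
    have hn: "g (of_nat n) = of_nat n" if "relative_endo k M g" for g using that nM by (simp add: relative_endo_def)
    have "A1 (t * \<theta>1 ^ j) = A1 t * (Z * \<theta>1) ^ j" using t \<theta>j \<theta>1 by (simp add: A1.mult A1.power)
    also have "\<dots> = (Z ^ j * A1 t) * \<theta>1 ^ j" by (simp add: power_mult_distrib mult_ac)
    finally have A1t: "A1 (t * \<theta>1 ^ j) = t * \<theta>1 ^ j" using t(4) by simp
    have "A2 (t * \<theta>1 ^ j) = t * \<theta>1 ^ j" "B (t * \<theta>1 ^ j) = t * \<theta>1 ^ j"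
      using t \<theta>j \<theta>1 by (simp_all add: A2.mult A2.power B.mult B.power)
    then show ?thesis unfolding c_def t_def[symmetric] using A1t \<theta>j nM hn A1 A2 B
      by (intro fixed sM(8)) (simp_all add: A1.divide A2.divide B.divide)
  qed
  \<comment> \<open>In the expansion of y the coefficient of \<theta>1^(-j) is c j; writing
    \<theta>1^(-j) as \<theta>1^(n-j) / \<theta>1^n avoids negative exponents.\<close>
  define f where "f = (\<Sum>j<n. monom (c j / \<theta>1 ^ n) (n - j))"
  have f: "f \<in> polys_over k" unfolding f_def
    by (intro polys_over_sum[OF k] polys_over_simps(7)[OF k] sk(8) c_k \<theta>1k)
  have "poly f \<theta>1 = y"
  proof -
    have "c j / \<theta>1 ^ n * \<theta>1 ^ (n - j) = proj A1 (Z ^ j) y / of_nat n" if "j < n" for j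
    proof -
      have "\<theta>1 ^ n = \<theta>1 ^ j * \<theta>1 ^ (n - j)" using that by (simp flip: power_add)
      then show ?thesis using \<theta>1(2) n_nz by (simp add: c_def)
    qed
    then have "poly f \<theta>1 = (\<Sum>j<n. proj A1 (Z ^ j) y / of_nat n)"
      by (simp add: f_def poly_sum poly_monom)
    also have "\<dots> = (\<Sum>j<n. proj A1 (Z ^ j) y) / of_nat n" by (simp add: sum_divide_distrib)
    also have "(\<Sum>j<n. proj A1 (Z ^ j) y) = (\<Sum>i<n. (\<Sum>j<n. (Z ^ i) ^ j) * (A1 ^^ i) y)"
      unfolding proj_def
      by (subst sum.swap) (simp add: sum_distrib_left sum_distrib_right mult.commute flip: power_mult)
    also have "\<dots> = (\<Sum>i<n. if i = 0 then of_nat n * y else 0)"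
      by (intro sum.cong) (auto simp: orthogonality dest: dvd_imp_le)
    finally show ?thesis using n_pos n_nz by simp
  qed
  have A1t: "(A1 ^^ t) y = poly f (Z ^ t * \<theta>1)" for t
  proof -
    interpret h: subfield_hom M "A1 ^^ t"
      using M relative_endo_hom_on[OF k relative_endo_funpow[OF A1]] by unfold_locales
    have *: "(A1 ^^ t) \<theta>1 = Z ^ t * \<theta>1"
    proof (induction t)
      case (Suc t)
      then show ?case using relative_endo_scale[OF A1 sk(9)[OF Z_k] \<theta>1(1), of t] \<theta>1(5) by simp
    qed simp
    have "map_poly (A1 ^^ t) f = f"
      using relative_endo_funpow[OF A1, of t] by (intro map_poly_id_on[OF k _ f]) (simp add: relative_endo_def)
    moreover have "f \<in> polys_over M" using polys_over_mono[of k M] k_M f by blast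
    ultimately show ?thesis using h.poly[OF _ \<theta>1(1), of f] * \<open>poly f \<theta>1 = y\<close> by simp
  qed
  have prod: "(\<Prod>t<m. (A1 ^^ t) u) * \<eta> = (A1 ^^ m) \<eta>" for m
  proof (induction m)
    case (Suc m)
    interpret h: subfield_hom M "A1 ^^ m"
      using M relative_endo_hom_on[OF k relative_endo_funpow[OF A1]] by unfold_locales
    have "(A1 ^^ Suc m) \<eta> = (A1 ^^ m) (u * \<eta>)" by (simp add: funpow_swap1 A1\<eta>(1))
    also have "\<dots> = (A1 ^^ m) u * (A1 ^^ m) \<eta>" by (rule h.mult[OF u \<eta>(1)])
    finally show ?case using Suc by (simp add: mult_ac)
  qed simp
  have B\<eta>: "(B ^^ m) \<eta> = Z ^ m * \<eta>" for m
  proof (induction m)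
    case (Suc m)
    then show ?case using relative_endo_scale[OF B sk(9)[OF Z_k] \<eta>(1), of m] \<eta>(4) by simp
  qed simp
  \<comment> \<open>The conjugates of u telescope: their product is A1^n \<eta> / \<eta>, and A1^n
    \<eta> = B^s \<eta> = Z^s \<eta>.\<close>
  have u_prod: "(\<Prod>t<n. (A1 ^^ t) u) = Z ^ s"
    using prod[of n] rels(4)[OF \<eta>(1)] B\<eta> \<eta>(2) by simp
  have "(A1 ^^ t) \<theta>2 = \<theta>2" for t by (induction t) (simp_all add: \<theta>2)
  then have "(A1 ^^ t) y = (A1 ^^ t) u * \<theta>2" for t
    using relative_endo_funpow[OF A1, of t] u \<theta>2(1) by (simp add: relative_endo_def y_def)
  then have "(\<Prod>t<n. poly f (Z ^ t * \<theta>1)) = Z ^ s * \<theta>2 ^ n"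
    by (simp add: prod.distrib u_prod flip: A1t)
  moreover have "int p dvd i \<and> int p dvd j"
    if "c \<in> k" "c \<noteq> 0" "(\<theta>1 ^ n) powi i * (\<theta>2 ^ n) powi j = c ^ p" for c i j
    using independent_eigenvectors[OF \<theta>1(1) \<theta>2(1) \<theta>1(2) \<theta>2(2) A1 \<theta>1(5) \<theta>2(5) that]
      independent_eigenvectors[OF \<theta>2(1) \<theta>1(1) \<theta>2(2) \<theta>1(2) A2 \<theta>2(4) \<theta>1(4) that(1,2)] that(3)
    by (simp add: mult.commute)
  ultimately show thesis using that[OF \<theta>1k \<theta>2k \<theta>1(2) \<theta>2(2) f] by blast
qed

end

section \<open>Normal forms of words\<close>

fun word_value :: "('b, 'm) monoid_scheme \<Rightarrow> ('g \<Rightarrow> 'b) \<Rightarrow> 'g gword \<Rightarrow> 'b" where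
  "word_value G c [] = \<one>\<^bsub>G\<^esub>"
| "word_value G c ((g, s) # w) = (if s then inv\<^bsub>G\<^esub> (c g) else c g) \<otimes>\<^bsub>G\<^esub> word_value G c w"

context group
begin

lemma pow_Suc_left: "x \<in> carrier G \<Longrightarrow> x [^] Suc i = x \<otimes> x [^] i"
  by (rule nat_pow_Suc2)

context
  fixes c :: "'g \<Rightarrow> 'a"
  assumes c: "\<And>g. c g \<in> carrier G"
begin

lemma word_value_closed: "word_value G c w \<in> carrier G"
  by (induction w) (auto simp: c)

lemma word_value_append: "word_value G c (v @ w) = word_value G c v \<otimes> word_value G c w"
  by (induction v) (auto simp: c word_value_closed m_assoc)

lemma word_value_cancel: "word_value G c [(g, s), (g, \<not> s)] = \<one>"
  by (cases s) (simp_all add: c)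

lemma word_value_winv: "word_value G c (winv w) = inv (word_value G c w)"
proof (induction w)
  case (Cons a w)
  obtain g s where a: "a = (g, s)" by force
  have "word_value G c (winv (a # w)) = word_value G c (winv w) \<otimes> word_value G c [(g, \<not> s)]"
    by (simp add: a winv_def word_value_append)
  then show ?case using Cons by (cases s) (simp_all add: a c word_value_closed inv_mult_group)
qed (simp add: winv_def)

lemma word_value_gen: "word_value G c (gen g) = c g"
  by (simp add: gen_def c)

lemma word_value_wpow: "word_value G c (wpow w i) = word_value G c w [^] i"
proof (induction i)
  case (Suc i)
  then show ?case unfolding pow_Suc_left[OF word_value_closed] by (simp add: wpow_def word_value_append)
qed (simp add: wpow_def)

lemma word_value_word_eq:
  assumes "word_eq R v w" "\<And>l r. (l, r) \<in> R \<Longrightarrow> word_value G c l = word_value G c r"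
  shows "word_value G c v = word_value G c w"
  using assms(1)
proof (induction rule: word_eq.induct)
  case (cancel u g s v)
  have "word_value G c (u @ [(g, s), (g, \<not> s)] @ v) = word_value G c u \<otimes> (word_value G c [(g, s), (g, \<not> s)] \<otimes> word_value G c v)"
    by (simp only: word_value_append)
  then show ?case unfolding word_value_cancel by (simp add: word_value_append word_value_closed)
next
  case (relation l r u v)
  then show ?case using assms(2) by (simp add: word_value_append)
qed auto

end
end

locale phi14_elements = group G for G (structure) +
  fixes n s :: nat and a1 a2 b
  assumes n_pos: "n > 0" and a1: "a1 \<in> carrier G" and a2: "a2 \<in> carrier G" and b: "b \<in> carrier G"
    and a1_a2: "a1 \<otimes> a2 = a2 \<otimes> a1 \<otimes> b" and a1_b: "a1 \<otimes> b = b \<otimes> a1" and a2_b: "a2 \<otimes> b = b \<otimes> a2"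
    and a1_n: "a1 [^] n = b [^] s" and a2_n: "a2 [^] n = \<one>" and b_n: "b [^] n = \<one>"
begin

abbreviation "NF i j l \<equiv> a1 [^] (i::nat) \<otimes> (a2 [^] (j::nat) \<otimes> b [^] (l::nat))"

lemma b_pow_mod: "b [^] l = b [^] (l mod n)"
proof -
  have "b [^] (n * (l div n) + l mod n) = (b [^] n) [^] (l div n) \<otimes> b [^] (l mod n)"
    using b by (simp only: nat_pow_mult nat_pow_pow)
  then show ?thesis using b by (simp add: b_n)
qed

lemma a2_pow_mod: "a2 [^] l = a2 [^] (l mod n)"
proof -
  have "a2 [^] (n * (l div n) + l mod n) = (a2 [^] n) [^] (l div n) \<otimes> a2 [^] (l mod n)"
    using a2 by (simp only: nat_pow_mult nat_pow_pow)
  then show ?thesis using a2 by (simp add: a2_n)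
qed

lemma a1_pow_mod: "a1 [^] i = a1 [^] (i mod n) \<otimes> b [^] (s * (i div n))"
proof -
  have "a1 [^] (i mod n + n * (i div n)) = a1 [^] (i mod n) \<otimes> (a1 [^] n) [^] (i div n)"
    using a1 by (simp only: nat_pow_mult nat_pow_pow)
  then show ?thesis using b by (simp add: a1_n nat_pow_pow)
qed

lemma b_pow_a1: "b [^] (l::nat) \<otimes> a1 [^] (i::nat) = a1 [^] i \<otimes> b [^] l"
  and b_pow_a2: "b [^] (l::nat) \<otimes> a2 [^] (j::nat) = a2 [^] j \<otimes> b [^] l"
proof -
  have *: "b [^] l \<otimes> x = x \<otimes> b [^] l" if "x = a1 \<or> x = a2" for x
    using that a1 a2 b a1_b a2_b by (intro group_commutes_pow) auto
  show "b [^] l \<otimes> a1 [^] i = a1 [^] i \<otimes> b [^] l"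
    using group_commutes_pow[of a1 "b [^] l" i] *[of a1] a1 b by simp
  show "b [^] l \<otimes> a2 [^] j = a2 [^] j \<otimes> b [^] l"
    using group_commutes_pow[of a2 "b [^] l" j] *[of a2] a2 b by simp
qed

text \<open>Here b^(n-1) is the inverse of b, so that all exponents stay natural numbers.\<close>

lemma a2_a1: "a2 \<otimes> a1 = a1 \<otimes> (a2 \<otimes> b [^] (n - 1))"
proof -
  have "b \<otimes> b [^] (n - 1) = b [^] n"
    using n_pos pow_Suc_left[OF b, of "n - 1"] by simp
  then have "a1 \<otimes> a2 \<otimes> b [^] (n - 1) = a2 \<otimes> a1"
    using a1 a2 b by (simp add: a1_a2 m_assoc b_n)
  then show ?thesis using a1 a2 b by (simp add: m_assoc)
qed

lemma a2_a1_pow: "a2 \<otimes> a1 [^] (i::nat) = a1 [^] i \<otimes> (a2 \<otimes> b [^] (i * (n - 1)))"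
proof (induction i)
  case (Suc i)
  let ?c = "b [^] (i * (n - 1))"
  have "a2 \<otimes> a1 [^] Suc i = (a2 \<otimes> a1 [^] i) \<otimes> a1" using a1 a2 by (simp add: m_assoc)
  also have "\<dots> = a1 [^] i \<otimes> (a2 \<otimes> (?c \<otimes> a1))" using a1 a2 b by (simp add: Suc m_assoc)
  also have "?c \<otimes> a1 = a1 \<otimes> ?c" using b_pow_a1[of "i * (n - 1)" 1] a1 by simp
  also have "a1 [^] i \<otimes> (a2 \<otimes> (a1 \<otimes> ?c)) = a1 [^] i \<otimes> ((a2 \<otimes> a1) \<otimes> ?c)"
    using a1 a2 b by (simp add: m_assoc)
  also have "\<dots> = a1 [^] Suc i \<otimes> (a2 \<otimes> (b [^] (n - 1) \<otimes> ?c))"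
    unfolding a2_a1 using a1 a2 b by (simp add: m_assoc)
  also have "b [^] (n - 1) \<otimes> ?c = b [^] (Suc i * (n - 1))" using b by (simp add: nat_pow_mult)
  finally show ?case .
qed (use a1 a2 in simp)

text \<open>The exponents are unbounded, so that left multiplication by a generator merely adds to
  them; reduction below n is left to \<open>word_normal_form\<close>.\<close>

definition "normal_forms = {NF i j l | i j l. True}"

lemma normal_forms_mult:
  assumes "x \<in> normal_forms" shows "a1 \<otimes> x \<in> normal_forms" "a2 \<otimes> x \<in> normal_forms" "b \<otimes> x \<in> normal_forms"
proof -
  obtain i j l where x: "x = NF i j l" using assms by (auto simp: normal_forms_def)
  have "a1 \<otimes> x = NF (Suc i) j l"
    unfolding x pow_Suc_left[OF a1] using a1 a2 b by (simp add: m_assoc)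
  then show "a1 \<otimes> x \<in> normal_forms" unfolding normal_forms_def by blast
  have "a2 \<otimes> x = (a2 \<otimes> a1 [^] i) \<otimes> (a2 [^] j \<otimes> b [^] l)" using a1 a2 b by (simp add: x m_assoc)
  also have "\<dots> = a1 [^] i \<otimes> (a2 \<otimes> ((b [^] (i * (n - 1)) \<otimes> a2 [^] j) \<otimes> b [^] l))"
    unfolding a2_a1_pow using a1 a2 b by (simp add: m_assoc)
  also have "\<dots> = NF i (Suc j) (i * (n - 1) + l)"
    unfolding b_pow_a2 pow_Suc_left[OF a2] using a1 a2 b by (simp add: m_assoc nat_pow_mult)
  finally show "a2 \<otimes> x \<in> normal_forms" unfolding normal_forms_def by blast
  have "b \<otimes> x = (b [^] (1::nat) \<otimes> a1 [^] i) \<otimes> (a2 [^] j \<otimes> b [^] l)" using a1 a2 b by (simp add: x m_assoc)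
  also have "\<dots> = a1 [^] i \<otimes> ((b [^] (1::nat) \<otimes> a2 [^] j) \<otimes> b [^] l)"
    unfolding b_pow_a1 using a1 a2 b by (simp add: m_assoc)
  also have "\<dots> = NF i j (1 + l)"
    unfolding b_pow_a2 using a1 a2 b by (simp only: m_assoc nat_pow_mult nat_pow_closed)
  finally show "b \<otimes> x \<in> normal_forms" unfolding normal_forms_def by blast
qed

lemma normal_forms_power_mult:
  assumes "\<And>x. x \<in> normal_forms \<Longrightarrow> g \<otimes> x \<in> normal_forms" "g \<in> carrier G" "x \<in> normal_forms"
  shows "g [^] (m::nat) \<otimes> x \<in> normal_forms"
proof -
  have nf: "y \<in> carrier G" if "y \<in> normal_forms" for y
    using that a1 a2 b by (auto simp: normal_forms_def)
  show ?thesis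
  proof (induction m)
    case (Suc m)
    then show ?case unfolding pow_Suc_left[OF assms(2)]
      using assms(1)[OF Suc] assms(2) nf[OF assms(3)] by (simp add: m_assoc)
  qed (use assms nf in simp)
qed

lemma inverse_is_power:
  assumes "g \<in> carrier G" "g [^] (m::nat) = \<one>" "m > 0" shows "inv g = g [^] (m - 1)"
proof -
  have "g [^] (m - 1) \<otimes> g = g [^] m" using assms(3) by (cases m) simp_all
  then show ?thesis using assms(1,2) by (intro inv_equality) simp_all
qed

lemma word_normal_form:
  defines "c \<equiv> case_phi14_gen a1 a2 b"
  shows "\<exists>i<n. \<exists>j<n. \<exists>l<n. word_value G c w = NF i j l"
proof -
  \<comment> \<open>Since a1^n = b^s, the relations give a1 the exponent n * n; this turns the
    inverse of a1 into a natural power.\<close>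
  have "a1 [^] (n * n) = \<one>"
    using a1 b a1_n b_n by (metis mult.commute nat_pow_one nat_pow_pow)
  then have inv: "inv a1 = a1 [^] (n * n - 1)" "inv a2 = a2 [^] (n - 1)" "inv b = b [^] (n - 1)"
    using a1 a2 b a2_n b_n n_pos by (intro inverse_is_power; simp)+

  have "word_value G c w \<in> normal_forms"
  proof (induction w)
    case Nil
    have "\<one> = NF 0 0 0" by simp
    then show ?case unfolding normal_forms_def word_value.simps by blast
  next
    case (Cons x w)
    obtain g t where x: "x = (g, t)" by force
    show ?case
    proof (cases g)
      case Alpha1
      then show ?thesis using Cons normal_forms_mult(1) normal_forms_power_mult[OF normal_forms_mult(1) a1 Cons]
        by (simp add: x c_def inv)
    next
      case Alpha2
      then show ?thesis using Cons normal_forms_mult(2) normal_forms_power_mult[OF normal_forms_mult(2) a2 Cons]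
        by (simp add: x c_def inv)
    next
      case Beta
      then show ?thesis using Cons normal_forms_mult(3) normal_forms_power_mult[OF normal_forms_mult(3) b Cons]
        by (simp add: x c_def inv)
    qed
  qed
  then obtain i j l where "word_value G c w = NF i j l" by (auto simp: normal_forms_def)
  \<comment> \<open>Reducing the exponent of a1 releases a power of b, so the exponent of b is
    reduced last.\<close>
  also have "\<dots> = a1 [^] (i mod n) \<otimes> (b [^] (s * (i div n)) \<otimes> a2 [^] j \<otimes> b [^] l)"
    using a1 a2 b by (subst a1_pow_mod) (simp add: m_assoc)
  also have "\<dots> = a1 [^] (i mod n) \<otimes> (a2 [^] j \<otimes> b [^] (s * (i div n) + l))"
    unfolding b_pow_a2 using a1 a2 b by (simp add: m_assoc nat_pow_mult)
  also have "\<dots> = NF (i mod n) (j mod n) ((s * (i div n) + l) mod n)"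
    by (simp only: b_pow_mod[of "s * (i div n) + l", symmetric] a2_pow_mod[of j, symmetric])
  finally show ?thesis using n_pos by (meson mod_less_divisor)
qed

end

text \<open>A commutator equation [x, y] = e is the same as x y = y x e, which contains no inverses
  and is the form used for maps and for normal forms.\<close>

lemma (in group) phi14_relations_iff:
  assumes c: "\<And>g. c g \<in> carrier G" and "p > 0"
  shows "(\<forall>(l, r)\<in>phi14_relations p (wpow (gen Beta) s). word_value G c l = word_value G c r)
    \<longleftrightarrow> phi14_elements G (p ^ 2) s (c Alpha1) (c Alpha2) (c Beta)"
proof -
  have comm: "inv x \<otimes> (inv y \<otimes> (x \<otimes> y)) = e \<longleftrightarrow> x \<otimes> y = y \<otimes> x \<otimes> e"
    if "x \<in> carrier G" "y \<in> carrier G" "e \<in> carrier G" for x y e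
  proof -
    have "inv x \<otimes> (inv y \<otimes> (x \<otimes> y)) = inv (y \<otimes> x) \<otimes> (x \<otimes> y)" using that by (simp add: inv_mult_group m_assoc)
    moreover have "inv (y \<otimes> x) \<otimes> (x \<otimes> y) = e \<longleftrightarrow> x \<otimes> y = y \<otimes> x \<otimes> e"
      using inv_solve_left[of e "y \<otimes> x" "x \<otimes> y"] that by auto
    ultimately show ?thesis by simp
  qed
  have comm1: "inv x \<otimes> (inv y \<otimes> (x \<otimes> y)) = \<one> \<longleftrightarrow> x \<otimes> y = y \<otimes> x"
    if "x \<in> carrier G" "y \<in> carrier G" for x y using comm[OF that one_closed] that by simp
  note wv = word_value_append[OF c] word_value_winv[OF c] word_value_gen[OF c] word_value_wpow[OF c] wcomm_def
    word_value.simps(1)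
  have "(\<forall>(l, r)\<in>phi14_relations p (wpow (gen Beta) s). word_value G c l = word_value G c r)
    \<longleftrightarrow> word_value G c (wcomm (gen Alpha1) (gen Alpha2)) = word_value G c (gen Beta) \<and>
      word_value G c (wpow (gen Alpha1) (p ^ 2)) = word_value G c (wpow (gen Beta) s) \<and>
      word_value G c (wpow (gen Alpha2) (p ^ 2)) = word_value G c [] \<and>
      word_value G c (wpow (gen Beta) (p ^ 2)) = word_value G c [] \<and>
      word_value G c (wcomm (gen Alpha1) (gen Beta)) = word_value G c [] \<and>
      word_value G c (wcomm (gen Alpha2) (gen Beta)) = word_value G c []"
    unfolding phi14_relations_def by (simp only: ball_simps prod.case simp_thms)
  also have "\<dots> \<longleftrightarrow> phi14_elements G (p ^ 2) s (c Alpha1) (c Alpha2) (c Beta)"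
    unfolding phi14_elements_def phi14_elements_axioms_def wv comm[OF c c c] comm1[OF c c]
    using is_group c assms(2) by auto
  finally show ?thesis .
qed

section \<open>Distinctness of the normal forms\<close>

text \<open>The integral Heisenberg group in the coordinates of \<alpha>1^i \<alpha>2^j \<beta>^l.
  The term - j * i' arises from moving \<alpha>1 to the left through \<alpha>2, where \<alpha>2
  \<alpha>1 = \<alpha>1 \<alpha>2 \<beta>^(-1).\<close>

fun heis_mult :: "int \<times> int \<times> int \<Rightarrow> int \<times> int \<times> int \<Rightarrow> int \<times> int \<times> int" where
  "heis_mult (i, j, l) (i', j', l') = (i + i', j + j', l + l' - j * i')"

fun heis_letter :: "phi14_gen \<times> bool \<Rightarrow> int \<times> int \<times> int" where
  "heis_letter (Alpha1, t) = ((if t then - 1 else 1), 0, 0)"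
| "heis_letter (Alpha2, t) = (0, (if t then - 1 else 1), 0)"
| "heis_letter (Beta, t) = (0, 0, (if t then - 1 else 1))"

fun heis_value :: "phi14_gen gword \<Rightarrow> int \<times> int \<times> int" where
  "heis_value [] = (0, 0, 0)"
| "heis_value (x # w) = heis_mult (heis_letter x) (heis_value w)"

text \<open>Congruence modulo the normal subgroup of the integral Heisenberg group generated by
  \<open>(n, 0, -s)\<close>, \<open>(0, n, 0)\<close> and \<open>(0, 0, n)\<close>.\<close>

fun heis_equiv :: "nat \<Rightarrow> nat \<Rightarrow> int \<times> int \<times> int \<Rightarrow> int \<times> int \<times> int \<Rightarrow> bool" where
  "heis_equiv n s (i, j, l) (i', j', l') \<longleftrightarrow>
    (\<exists>x y z. i = i' + int n * x \<and> j = j' + int n * y \<and> l + int s * x = l' + int n * z)"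

lemma heis_equivI:
  assumes "i = i' + int n * x" "j = j' + int n * y" "l + int s * x = l' + int n * z"
  shows "heis_equiv n s (i, j, l) (i', j', l')"
  using assms unfolding heis_equiv.simps by blast

lemma heis_mult_assoc: "heis_mult (heis_mult u v) w = heis_mult u (heis_mult v w)"
  by (cases u; cases v; cases w) (simp add: algebra_simps)

lemma heis_value_append: "heis_value (v @ w) = heis_mult (heis_value v) (heis_value w)"
proof (induction v)
  case Nil
  show ?case by (cases "heis_value w") simp
qed (simp add: heis_mult_assoc)

lemma heis_equiv_refl: "heis_equiv n s u u"
proof (cases u)
  case (fields i j l)
  have "i = i + int n * 0 \<and> j = j + int n * 0 \<and> l + int s * 0 = l + int n * 0" by simp
  then show ?thesis unfolding fields heis_equiv.simps by blast
qed

lemma heis_equiv_sym: assumes "heis_equiv n s u v" shows "heis_equiv n s v u"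
proof -
  obtain i j l i' j' l' where uv: "u = (i, j, l)" "v = (i', j', l')" by (cases u; cases v)
  from assms obtain x y z where "i = i' + int n * x" "j = j' + int n * y" "l + int s * x = l' + int n * z"
    by (auto simp: uv)
  then have "i' = i + int n * (- x) \<and> j' = j + int n * (- y) \<and> l' + int s * (- x) = l + int n * (- z)"
    by simp
  then show ?thesis unfolding uv heis_equiv.simps by blast
qed

lemma heis_equiv_trans: assumes "heis_equiv n s u v" "heis_equiv n s v w" shows "heis_equiv n s u w"
proof -
  obtain i j l i' j' l' i'' j'' l'' where uvw: "u = (i, j, l)" "v = (i', j', l')" "w = (i'', j'', l'')"
    by (cases u; cases v; cases w)
  from assms obtain x y z x' y' z' where "i = i' + int n * x" "j = j' + int n * y" "l + int s * x = l' + int n * z"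
    "i' = i'' + int n * x'" "j' = j'' + int n * y'" "l' + int s * x' = l'' + int n * z'"
    unfolding uvw heis_equiv.simps by blast
  then have "i = i'' + int n * (x + x') \<and> j = j'' + int n * (y + y') \<and> l + int s * (x + x') = l'' + int n * (z + z')"
    by (simp add: algebra_simps)
  then show ?thesis unfolding uvw heis_equiv.simps by blast
qed

lemma heis_equiv_mult:
  assumes "heis_equiv n s u v" shows "heis_equiv n s (heis_mult w (heis_mult u w')) (heis_mult w (heis_mult v w'))"
proof -
  obtain i j l i' j' l' a b c a' b' c' where uv: "u = (i, j, l)" "v = (i', j', l')" "w = (a, b, c)" "w' = (a', b', c')"
    by (cases u; cases v; cases w; cases w')
  from assms obtain x y z where "i = i' + int n * x" "j = j' + int n * y" "l + int s * x = l' + int n * z"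
    by (auto simp: uv)
  \<comment> \<open>Changing i by n x and j by n y changes the mixed terms b i and j a' by multiples
    of n, which the last witness absorbs.\<close>
  then have "a + (i + a') = a + (i' + a') + int n * x \<and> b + (j + b') = b + (j' + b') + int n * y \<and>
    c + (l + c' - j * a') - b * (i + a') + int s * x = c + (l' + c' - j' * a') - b * (i' + a') + int n * (z - y * a' - b * x)"
    by (simp add: algebra_simps)
  then show ?thesis unfolding uv heis_mult.simps heis_equiv.simps by blast
qed

lemma heis_value_wpow:
  "heis_value (wpow (gen Alpha1) m) = (int m, 0, 0)" "heis_value (wpow (gen Alpha2) m) = (0, int m, 0)"
  "heis_value (wpow (gen Beta) m) = (0, 0, int m)"
  by (induction m) (simp_all add: wpow_def gen_def)

lemma heis_equiv_word_eq:
  assumes "word_eq (phi14_relations p (wpow (gen Beta) s)) v w"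
  shows "heis_equiv (p ^ 2) s (heis_value v) (heis_value w)"
  using assms
proof (induction rule: word_eq.induct)
  case (cancel u g t v)
  have "heis_value [(g, t), (g, \<not> t)] = (0, 0, 0)" by (cases g) auto
  moreover have "heis_mult (0, 0, 0) x = x" for x by (cases x) simp
  ultimately have "heis_value ([(g, t), (g, \<not> t)] @ v) = heis_value v"
    by (simp only: heis_value_append)
  then have "heis_value (u @ [(g, t), (g, \<not> t)] @ v) = heis_value (u @ v)"
    by (simp only: heis_value_append)
  then show ?case by (simp only: heis_equiv_refl)
next
  case (relation l r u v)

  have "heis_equiv (p ^ 2) s (heis_value l) (heis_value r)"
    using relation unfolding phi14_relations_def
  proof (elim insertE emptyE)
    assume "(l, r) = (wpow (gen Alpha1) (p ^ 2), wpow (gen Beta) s)"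
    then show ?thesis by (simp only: prod.inject heis_value_wpow) (rule heis_equivI[of _ _ _ 1 _ _ 0 _ _ _ 0]; simp)
  next
    assume "(l, r) = (wpow (gen Alpha2) (p ^ 2), [])"
    then show ?thesis by (simp only: prod.inject heis_value_wpow heis_value.simps)
      (rule heis_equivI[of _ _ _ 0 _ _ 1 _ _ _ 0]; simp)
  next
    assume "(l, r) = (wpow (gen Beta) (p ^ 2), [])"
    then show ?thesis by (simp only: prod.inject heis_value_wpow heis_value.simps)
      (rule heis_equivI[of _ _ _ 0 _ _ 0 _ _ _ 1]; simp)
  next
    assume "(l, r) = (wcomm (gen Alpha1) (gen Alpha2), gen Beta)"
    then have "heis_value l = heis_value r" by (simp add: wcomm_def winv_def gen_def)
    then show ?thesis by (simp only: heis_equiv_refl)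
  next
    assume "(l, r) = (wcomm (gen Alpha1) (gen Beta), [])"
    then have "heis_value l = heis_value r" by (simp add: wcomm_def winv_def gen_def)
    then show ?thesis by (simp only: heis_equiv_refl)
  next
    assume "(l, r) = (wcomm (gen Alpha2) (gen Beta), [])"
    then have "heis_value l = heis_value r" by (simp add: wcomm_def winv_def gen_def)
    then show ?thesis by (simp only: heis_equiv_refl)
  qed
  then show ?case by (simp only: heis_value_append heis_equiv_mult)
qed (auto intro: heis_equiv_refl heis_equiv_sym heis_equiv_trans)

abbreviation "normal_word i j l \<equiv> wpow (gen Alpha1) i @ wpow (gen Alpha2) j @ wpow (gen Beta) l"

lemma normal_words_distinct:
  assumes "word_eq (phi14_relations p (wpow (gen Beta) s)) (normal_word i j l) (normal_word i' j' l')"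
    and "i < p ^ 2" "j < p ^ 2" "l < p ^ 2" "i' < p ^ 2" "j' < p ^ 2" "l' < p ^ 2"
  shows "i = i' \<and> j = j' \<and> l = l'"
proof -
  have small: "a = a' \<and> x = 0" if "int a = int a' + int m * x" "a < m" "a' < m" for a a' m :: nat and x
  proof -
    have "int a mod int m = int a' mod int m" using that(1) by simp
    then have "int (a mod m) = int (a' mod m)" by (simp only: zmod_int)
    then have "a = a'" using that by simp
    then show ?thesis using that by simp
  qed
  have "heis_value (normal_word i j l) = (int i, int j, int l)" for i j l
    by (simp add: heis_value_append heis_value_wpow)
  then have "heis_equiv (p ^ 2) s (int i, int j, int l) (int i', int j', int l')"
    using heis_equiv_word_eq[OF assms(1)] by simp
  then obtain x y z where xyz: "int i = int i' + int (p ^ 2) * x" "int j = int j' + int (p ^ 2) * y"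
    "int l + int s * x = int l' + int (p ^ 2) * z"
    unfolding heis_equiv.simps by blast
  \<comment> \<open>The first coordinate yields x = 0 besides i = i', which removes the term s * x
    from the third.\<close>
  from small[OF xyz(1)] assms have "i = i'" "x = 0" by auto
  moreover from small[OF xyz(2)] assms have "j = j'" by auto
  moreover from small[of l l' "p^2" z] xyz(3) \<open>x = 0\<close> assms have "l = l'" by simp
  ultimately show ?thesis by simp
qed

section \<open>Galois groups as groups of maps\<close>

lemma intermediate_field_iff:
  "intermediate_field (M :: 'a::field alg_closure set) \<longleftrightarrow> subfield_set M \<and> range to_ac \<subseteq> M"
proof -
  define R where "R = (ring_of_type_algebra :: 'a alg_closure ring)"
  interpret R: field R unfolding R_def by (rule field_from_type_algebra)
  have sel: "carrier R = UNIV" "monoid.mult R = (*)" "one R = 1" "ring.zero R = 0" "add R = (+)"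
    by (simp_all add: R_def ring_of_type_algebra_def)
  have inv: "m_inv R x = inverse x" if "x \<noteq> 0" for x
    by (rule R.comm_inv_char) (use that in \<open>simp_all add: sel\<close>)
  have neg: "a_inv R x = - x" for x
    by (rule R.minus_equality) (simp_all add: sel)
  have "subfield M R \<longleftrightarrow> subfield_set M"
  proof
    assume sub: "subfield M R"
    note E = subringE[OF subfieldE(1)[OF sub], unfolded sel neg]
    have "inverse x \<in> M" if "x \<in> M" for x
      using R.subfield_m_inv(1)[OF sub, of x] that inv[of x] E(2) by (cases "x = 0") (auto simp: sel)
    then show "subfield_set M" unfolding subfield_set_def using E(2,3,5,6,7) by (intro conjI ballI) simp_all
  next
    assume sub: "subfield_set M"
    show "subfield M R"
    proof (rule R.subfieldI')
      show "subring M R"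
        by (rule R.subringI) (simp_all add: sel neg subfield_set_simps[OF sub])
      show "m_inv R x \<in> M" if "x \<in> M - {\<zero>\<^bsub>R\<^esub>}" for x
        using that inv[of x] subfield_set_simps(6)[OF sub] by (simp add: sel)
    qed
  qed
  then show ?thesis by (simp add: intermediate_field_def R_def)
qed

lemma Gal_mem:
  "\<sigma> \<in> carrier (Gal M) \<longleftrightarrow> \<sigma> \<in> Bij M \<and>
      (\<forall>x\<in>M. \<forall>y\<in>M. \<sigma> (x + y) = \<sigma> x + \<sigma> y \<and> \<sigma> (x * y) = \<sigma> x * \<sigma> y) \<and>
      (\<forall>c. \<sigma> (to_ac c) = to_ac c)"
  by (simp add: Gal_def)

lemma Gal_mult:
  "\<sigma> \<in> carrier (Gal M) \<Longrightarrow> \<tau> \<in> carrier (Gal M) \<Longrightarrow> \<sigma> \<otimes>\<^bsub>Gal M\<^esub> \<tau> = compose M \<sigma> \<tau>"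
  by (simp add: Gal_def BijGroup_def)

lemma Gal_mult_apply:
  "\<sigma> \<in> carrier (Gal M) \<Longrightarrow> \<tau> \<in> carrier (Gal M) \<Longrightarrow> x \<in> M \<Longrightarrow> (\<sigma> \<otimes>\<^bsub>Gal M\<^esub> \<tau>) x = \<sigma> (\<tau> x)"
  by (simp add: Gal_mult compose_eq)

lemma Gal_one: "\<one>\<^bsub>Gal M\<^esub> = (\<lambda>x\<in>M. x)"
  by (simp add: Gal_def BijGroup_def)

lemma Gal_relative_endo: "\<sigma> \<in> carrier (Gal M) \<Longrightarrow> relative_endo (range to_ac) M \<sigma>"
  unfolding Gal_mem relative_endo_def using Bij_imp_funcset by fastforce

lemma Gal_eqI:
  assumes "\<sigma> \<in> carrier (Gal M)" "\<tau> \<in> carrier (Gal M)" "\<And>x. x \<in> M \<Longrightarrow> \<sigma> x = \<tau> x" shows "\<sigma> = \<tau>"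
  using assms by (intro extensionalityI[of _ M]) (auto simp: Gal_mem Bij_def)

lemma group_Gal:
  assumes M: "subfield_set M" "range to_ac \<subseteq> M" shows "group (Gal M)"
proof -
  define H where "H = {\<sigma> \<in> Bij M. (\<forall>x\<in>M. \<forall>y\<in>M. \<sigma> (x + y) = \<sigma> x + \<sigma> y \<and> \<sigma> (x * y) = \<sigma> x * \<sigma> y) \<and>
      (\<forall>c. \<sigma> (to_ac c) = to_ac c)}"
  have ac: "to_ac c \<in> M" for c using M(2) by auto
  note sM = subfield_set_simps[OF M(1)]
  have "subgroup H (BijGroup M)"
  proof (rule group.subgroupI[OF group_BijGroup])
    show "H \<subseteq> carrier (BijGroup M)" by (auto simp: H_def BijGroup_def)
    have "(\<lambda>x\<in>M. x) \<in> H" using sM ac by (simp add: H_def id_Bij)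
    then show "H \<noteq> {}" by blast
  next
    fix \<sigma> assume "\<sigma> \<in> H"
    then have \<sigma>: "\<sigma> \<in> Bij M" "\<And>x y. x \<in> M \<Longrightarrow> y \<in> M \<Longrightarrow> \<sigma> (x + y) = \<sigma> x + \<sigma> y"
      "\<And>x y. x \<in> M \<Longrightarrow> y \<in> M \<Longrightarrow> \<sigma> (x * y) = \<sigma> x * \<sigma> y" "\<And>c. \<sigma> (to_ac c) = to_ac c"
      by (auto simp: H_def)
    have add: "inv_into M \<sigma> (x + y) = inv_into M \<sigma> x + inv_into M \<sigma> y" if "x \<in> M" "y \<in> M" for x y
      using \<sigma>(2) sM(3) that by (intro Bij_inv_into_lemma[OF _ \<sigma>(1)]) auto
    have mult: "inv_into M \<sigma> (x * y) = inv_into M \<sigma> x * inv_into M \<sigma> y" if "x \<in> M" "y \<in> M" for x y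
      using \<sigma>(3) sM(4) that by (intro Bij_inv_into_lemma[OF _ \<sigma>(1)]) auto
    have "inj_on \<sigma> M" using \<sigma>(1) by (simp add: Bij_def bij_betw_def)
    then have "inv_into M \<sigma> (to_ac c) = to_ac c" for c
      using \<sigma>(4) ac by (intro inv_into_f_eq)
    then show "inv\<^bsub>BijGroup M\<^esub> \<sigma> \<in> H"
      using add mult sM(3,4) ac by (simp add: inv_BijGroup[OF \<sigma>(1)] H_def restrict_inv_into_Bij[OF \<sigma>(1)])
  next
    fix \<sigma> \<tau> assume *: "\<sigma> \<in> H" "\<tau> \<in> H"
    then have "compose M \<sigma> \<tau> \<in> Bij M" by (auto simp: H_def compose_Bij)
    moreover have "\<tau> x \<in> M" if "x \<in> M" for x using * that Bij_imp_funcset by (fastforce simp: H_def)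
    ultimately have "compose M \<sigma> \<tau> \<in> H" using * sM(3,4) ac by (simp add: H_def compose_def)
    then show "\<sigma> \<otimes>\<^bsub>BijGroup M\<^esub> \<tau> \<in> H" using * by (simp add: BijGroup_def H_def)
  qed
  from group.subgroup_imp_group[OF group_BijGroup this] show ?thesis by (simp add: Gal_def H_def)
qed

lemma Gal_pow:
  assumes M: "subfield_set M" "range to_ac \<subseteq> M" and \<sigma>: "\<sigma> \<in> carrier (Gal M)" and x: "x \<in> M"
  shows "(\<sigma> [^]\<^bsub>Gal M\<^esub> (i::nat)) x = (\<sigma> ^^ i) x"
proof (induction i)
  case 0
  then show ?case using x by (simp add: Gal_one)
next
  case (Suc i)
  interpret group "Gal M" by (rule group_Gal[OF M])
  have "(\<sigma> [^]\<^bsub>Gal M\<^esub> Suc i) = \<sigma> \<otimes>\<^bsub>Gal M\<^esub> \<sigma> [^]\<^bsub>Gal M\<^esub> i" by (rule pow_Suc_left[OF \<sigma>])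
  then show ?case using Suc x \<sigma> by (simp add: Gal_mult compose_eq)
qed

lemma Gal_normal_form:
  assumes M: "subfield_set M" "range to_ac \<subseteq> M"
    and c: "a1 \<in> carrier (Gal M)" "a2 \<in> carrier (Gal M)" "b \<in> carrier (Gal M)" and x: "x \<in> M"
  shows "(a1 [^]\<^bsub>Gal M\<^esub> (i::nat) \<otimes>\<^bsub>Gal M\<^esub> (a2 [^]\<^bsub>Gal M\<^esub> (j::nat) \<otimes>\<^bsub>Gal M\<^esub> b [^]\<^bsub>Gal M\<^esub> (l::nat))) x
    = (a1 ^^ i) ((a2 ^^ j) ((b ^^ l) x))"
proof -
  interpret group "Gal M" by (rule group_Gal[OF M])
  have cl: "(b ^^ l) x \<in> M" "(a2 ^^ j) ((b ^^ l) x) \<in> M"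
    using c x relative_endo_closed[OF relative_endo_funpow[OF Gal_relative_endo]] by metis+
  show ?thesis using c x cl by (simp add: Gal_mult_apply Gal_pow[OF M])
qed

section \<open>Words in presented groups\<close>

abbreviation "word_class R w \<equiv> word_rel R `` {w}"

lemma word_class_in: "word_class R w \<in> carrier (presented_group R)"
  by (simp add: presented_group_def quotientI)

lemma word_class_surj: "U \<in> carrier (presented_group R) \<Longrightarrow> \<exists>w. U = word_class R w"
  by (auto simp: presented_group_def elim!: quotientE)

lemma word_class_eq_iff: "word_class R v = word_class R w \<longleftrightarrow> word_eq R v w"
  using eq_equiv_class_iff[OF equiv_word_rel, of v w R] by (simp add: word_rel_def)

lemma word_class_one: "word_class R [] = \<one>\<^bsub>presented_group R\<^esub>"
  by (simp add: presented_group_def)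

lemma word_value_presented_group:
  "word_value (presented_group R) (\<lambda>g. word_class R (gen g)) w = word_class R w"
proof (induction w)
  case (Cons a w)
  interpret P: group "presented_group R" by (rule group_presented_group)
  obtain g s where a: "a = (g, s)" by force
  have "inv\<^bsub>presented_group R\<^esub> (word_class R (gen g)) = word_class R [(g, True)]"
  proof (rule P.inv_equality)
    have "word_class R ([(g, True)] @ gen g) = word_class R []"
      using word_eq.cancel[of R "[]" g True "[]"] by (simp add: word_class_eq_iff gen_def)
    then show "word_class R [(g, True)] \<otimes>\<^bsub>presented_group R\<^esub> word_class R (gen g) = \<one>\<^bsub>presented_group R\<^esub>"
      by (simp add: presented_group_mult word_class_one)
  qed (rule word_class_in)+
  then have "word_value (presented_group R) (\<lambda>g. word_class R (gen g)) (a # w) =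
      word_class R [a] \<otimes>\<^bsub>presented_group R\<^esub> word_class R w"
    using Cons by (simp add: a gen_def)
  then show ?case by (simp add: presented_group_mult)
qed (simp add: word_class_one)

lemma hom_word_value:
  assumes "group_hom G H h" "\<And>g. c g \<in> carrier G"
  shows "h (word_value G c w) = word_value H (\<lambda>g. h (c g)) w"
proof (induction w)
  case Nil
  then show ?case using group_hom.hom_one[OF assms(1)] by simp
next
  case (Cons a w)
  interpret group_hom G H h by (rule assms(1))
  obtain g s where a: "a = (g, s)" by force
  show ?case using Cons assms(2) by (simp add: a G.word_value_closed)
qed

lemma (in group) phi14_word_value_normal_word:
  assumes c: "\<And>g. c g \<in> carrier G"
  shows "word_value G c (normal_word i j l) = c Alpha1 [^] i \<otimes> (c Alpha2 [^] j \<otimes> c Beta [^] l)"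
  by (simp add: word_value_append[OF c] word_value_wpow[OF c] word_value_gen[OF c])

lemma phi14_elements_presented_group:
  fixes p s :: nat
  assumes "p > 0"
  defines "R \<equiv> phi14_relations p (wpow (gen Beta) s)"
  shows "phi14_elements (presented_group R) (p ^ 2) s (word_class R (gen Alpha1)) (word_class R (gen Alpha2)) (word_class R (gen Beta))"
  using group.phi14_relations_iff[where c = "\<lambda>g. word_class R (gen g)" and s = s,
      OF group_presented_group word_class_in assms(1)]
    presented_group_relation[of _ _ "phi14_relations p (wpow (gen Beta) s)"]
  unfolding word_value_presented_group R_def by blast

lemma phi14_gen_cases: "(\<lambda>g. c g) = case_phi14_gen (c Alpha1) (c Alpha2) (c Beta)"
  by (rule ext) (simp split: phi14_gen.split)

section \<open>Realizability in terms of norms\<close>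

text \<open>In k[T]/(T^n - a), with T \<mapsto> zT as the generating automorphism, the class of f
  has norm b. A divisibility over k serves both the Galois side, where T becomes \<theta>1, and the
  algebra side, where T becomes i2.\<close>

definition norm_condition :: "nat \<Rightarrow> 'a::field \<Rightarrow> 'a \<Rightarrow> 'a \<Rightarrow> bool" where
  "norm_condition n z a b \<longleftrightarrow>
    (\<exists>f. monom 1 n - [:a:] dvd (\<Prod>j<n. f \<circ>\<^sub>p [:0, z ^ j:]) - [:b:])"

abbreviation lift :: "'a::field poly \<Rightarrow> 'a alg_closure poly" where "lift \<equiv> map_poly to_ac"

lemma lift_simps:
  "lift (f + g) = lift f + lift g" "lift (f - g) = lift f - lift g" "lift (f * g) = lift f * lift g"
  "lift [:c:] = [:to_ac c:]" "lift (monom c i) = monom (to_ac c) i" "lift 1 = 1"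
  "lift (f \<circ>\<^sub>p [:0, c:]) = lift f \<circ>\<^sub>p [:0, to_ac c:]" "lift f = 0 \<longleftrightarrow> f = 0"
  "degree (lift f) = degree f" "lift f \<in> polys_over (range to_ac)"
proof -
  show "lift (f + g) = lift f + lift g" "lift (f - g) = lift f - lift g"
    by (intro poly_eqI; simp add: coeff_map_poly)+
  show "lift (f * g) = lift f * lift g"
    by (intro poly_eqI) (simp add: coeff_map_poly coeff_mult to_ac_sum)
  show "lift [:c:] = [:to_ac c:]" by (simp add: map_poly_pCons)
  show "lift (monom c i) = monom (to_ac c) i" by (simp add: map_poly_monom)
  show "lift 1 = 1" by (simp add: map_poly_1)
  show "lift (f \<circ>\<^sub>p [:0, c:]) = lift f \<circ>\<^sub>p [:0, to_ac c:]"
    by (intro poly_eqI) (simp add: coeff_map_poly coeff_pcompose_linear)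
  show "lift f = 0 \<longleftrightarrow> f = 0" by (simp add: map_poly_eq_0_iff)
  show "degree (lift f) = degree f" by (intro degree_map_poly) simp
  show "lift f \<in> polys_over (range to_ac)" by (simp add: polys_over_def coeff_map_poly)
qed

lemma lift_prod: "lift (prod f S) = (\<Prod>i\<in>S. lift (f i))"
  by (induction S rule: infinite_finite_induct) (simp_all add: lift_simps)

lemma polys_over_range: "f \<in> polys_over (range to_ac) \<Longrightarrow> \<exists>g. f = lift g"
  by (intro exI[of _ "map_poly of_ac f"] poly_eqI) (simp add: coeff_map_poly polys_over_def to_ac_of_ac)

lemma subfield_set_range_to_ac: "subfield_set (range to_ac)"
  unfolding subfield_set_def
  by (auto simp flip: to_ac_add to_ac_mult to_ac_minus to_ac_inverse)

lemma to_ac_power_int: "to_ac (x powi i) = to_ac x powi i"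
  by (simp add: power_int_def)

section \<open>Passing between k and its algebraic closure\<close>

locale phi14_setting =
  fixes p :: nat and z :: "'a::field"
  assumes prime_p: "prime p" and char: "CHAR('a) \<noteq> p" and z: "primitive_root_of_unity (p ^ 2) z"
begin

lemma z_ac: "primitive_root_of_unity (p ^ 2) (to_ac z)"
  using z by (simp add: primitive_root_of_unity_def flip: to_ac_power to_ac_1)

lemma of_nat_nz: "of_nat (p ^ 2) \<noteq> (0::'a)"
proof
  assume "of_nat (p ^ 2) = (0::'a)"
  then have d: "CHAR('a) dvd p ^ 2" by (simp only: of_nat_eq_0_iff_char_dvd)
  then have "CHAR('a) > 0" using prime_gt_0_nat[OF prime_p] by (intro Nat.gr0I) auto
  then have "prime CHAR('a)" by (rule prime_CHAR_semidom)
  then show False using d prime_p char by (metis prime_dvd_power primes_dvd_imp_eq)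
qed

lemma of_nat_nz_ac: "of_nat (p ^ 2) \<noteq> (0::'a alg_closure)"
  using of_nat_nz by (metis to_ac_eq_0_iff to_ac_of_nat)

lemma kummer_ac: "kummer_field (p ^ 2) (to_ac z) p"
  using z_ac prime_p by unfold_locales auto

abbreviation "k \<equiv> range (to_ac :: 'a \<Rightarrow> 'a alg_closure)"

lemma kummer_base:
  assumes "\<theta> ^ (p ^ 2) = to_ac a" "\<And>c. c ^ p \<noteq> a" shows "kummer (p ^ 2) (to_ac z) p k \<theta>"
proof (intro kummer.intro kummer_axioms.intro kummer_ac subfield_set_range_to_ac)
  show "to_ac z \<in> k" "\<theta> ^ (p ^ 2) \<in> k" using assms(1) by auto
  show "c ^ p \<noteq> \<theta> ^ (p ^ 2)" if "c \<in> k" for c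
    using that assms by (auto simp flip: to_ac_power)
qed

text \<open>When a is no p-th power, T^n - a is the minimal polynomial of \<theta> over k, so
  divisibility by it amounts to vanishing at \<theta>.\<close>

lemma norm_condition_iff:
  assumes \<theta>: "\<theta> ^ (p ^ 2) = to_ac a" and a: "\<And>c. c ^ p \<noteq> a"
  shows "norm_condition (p ^ 2) z a b \<longleftrightarrow>
    (\<exists>f. (\<Prod>j<p ^ 2. poly (lift f) (to_ac z ^ j * \<theta>)) = to_ac b)"
proof -
  interpret K: kummer "p ^ 2" "to_ac z" p k \<theta> by (rule kummer_base[OF assms])
  define q where "q = monom 1 (p ^ 2) - [:a:]"
  define H where "H f = (\<Prod>j<p ^ 2. f \<circ>\<^sub>p [:0, z ^ j:]) - [:b:]" for f
  have q: "lift q = K.q" by (simp add: q_def K.q_def lift_simps \<theta>)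
  have H: "poly (lift (H f)) \<theta> = (\<Prod>j<p ^ 2. poly (lift f) (to_ac z ^ j * \<theta>)) - to_ac b" for f
    by (simp add: H_def lift_simps lift_prod poly_prod poly_pcompose mult.commute)
  have "q dvd h \<longleftrightarrow> poly (lift h) \<theta> = 0" for h
  proof
    assume "q dvd h"
    then obtain g where "h = q * g" by blast
    then show "poly (lift h) \<theta> = 0" by (simp add: lift_simps q K.poly_q)
  next
    assume 0: "poly (lift h) \<theta> = 0"
    have q0: "q \<noteq> 0" using K.q_nz lift_simps(8)[of q] q by simp
    have "lift h = K.q * lift (h div q) + lift (h mod q)"
      by (metis lift_simps(1,3) mult_div_mod_eq q)
    then have "poly (lift (h mod q)) \<theta> = 0" using 0 by (simp add: K.poly_q)
    moreover have "degree (lift (h mod q)) < p ^ 2"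
      using degree_mod_less[OF q0, of h] K.degree_q K.n_pos by (auto simp: lift_simps simp flip: q)
    ultimately have "lift (h mod q) = 0" by (intro K.independent lift_simps)
    then show "q dvd h" by (simp add: lift_simps mod_eq_0_iff_dvd)
  qed
  then show ?thesis unfolding norm_condition_def q_def[symmetric] H_def[symmetric] by (simp add: H)
qed

text \<open>Otherwise one of the exponent vectors (1, 0) and (t, 1), which are nonzero modulo p,
  would give a p-th power.\<close>

lemma independent_not_power:
  assumes "independent_mod_powers p a1 a2" shows "c ^ p \<noteq> a1" "c ^ p \<noteq> a2 * a1 ^ t"
proof -
  have a: "a1 \<noteq> 0" "a2 \<noteq> 0" and
    ind: "\<And>m n c. c \<noteq> 0 \<Longrightarrow> a1 powi m * a2 powi n = c ^ p \<Longrightarrow> int p dvd m \<and> int p dvd n"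
    using assms by (auto simp: independent_mod_powers_def)
  have p1: "\<not> int p dvd 1" using prime_gt_1_nat[OF prime_p] by auto
  have p0: "p > 0" using prime_gt_0_nat[OF prime_p] .
  show "c ^ p \<noteq> a1"
  proof
    assume "c ^ p = a1"
    then have "c \<noteq> 0" "a1 powi 1 * a2 powi 0 = c ^ p" using a p0 by (auto simp: zero_power)
    then show False using ind p1 by blast
  qed
  show "c ^ p \<noteq> a2 * a1 ^ t"
  proof
    assume "c ^ p = a2 * a1 ^ t"
    then have "c \<noteq> 0" "a1 powi int t * a2 powi 1 = c ^ p" using a p0 by (auto simp: zero_power mult.commute)
    then show False using ind p1 by blast
  qed
qed

lemma realizable_if_norm_condition:
  assumes ind: "independent_mod_powers p a1 a2" and norm: "norm_condition (p ^ 2) z a1 (z ^ s * a2)"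
  shows "realizable TYPE('a) (presented_group (phi14_relations p (wpow (gen Beta) s)))"
proof -
  let ?n = "p ^ 2" and ?Z = "to_ac z"
  define R where "R = phi14_relations p (wpow (gen Beta) s)"
  have n_pos: "?n > 0" and p0: "p > 0" using prime_gt_0_nat[OF prime_p] by auto
  obtain \<theta>1 where \<theta>1: "\<theta>1 ^ ?n = to_ac a1" using nth_root_exists[OF n_pos] by blast
  obtain \<theta>2 where \<theta>2: "\<theta>2 ^ ?n = to_ac a2" using nth_root_exists[OF n_pos] by blast
  note np = independent_not_power[OF ind]
  obtain f where f: "(\<Prod>j<?n. poly (lift f) (?Z ^ j * \<theta>1)) = to_ac (z ^ s * a2)"
    using norm norm_condition_iff[OF \<theta>1 np(1)] by blast
  interpret H: heisenberg_kummer ?n ?Z p k \<theta>1 \<theta>2 "lift f" s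
  proof (intro heisenberg_kummer.intro heisenberg_kummer_axioms.intro kummer_ac subfield_set_range_to_ac)
    show "?Z \<in> k" "\<theta>1 ^ ?n \<in> k" "\<theta>2 ^ ?n \<in> k" by (auto simp: \<theta>1 \<theta>2)
    show "lift f \<in> polys_over k" by (rule lift_simps)
    show "(\<Prod>j<?n. poly (lift f) (?Z ^ j * \<theta>1)) = ?Z ^ s * \<theta>2 ^ ?n" by (simp add: f \<theta>2)
    show "c ^ p \<noteq> \<theta>1 ^ ?n" if "c \<in> k" for c using that np(1) by (auto simp: \<theta>1 simp flip: to_ac_power)
    show "c ^ p \<noteq> \<theta>2 ^ ?n * (\<theta>1 ^ ?n) ^ t" if "c \<in> k" for c t
      using that np(2) by (auto simp: \<theta>1 \<theta>2 simp flip: to_ac_power to_ac_mult)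
    show "of_nat ?n \<noteq> (0::'a alg_closure)" by (rule of_nat_nz_ac)
  qed
  define M where "M = H.M.ext"
  obtain A1 A2 B where A: "relative_endo k M A1" "relative_endo k M A2" "relative_endo k M B"
    and rel: "heisenberg_relations ?n s M A1 A2 B"
    and fixed: "\<And>x. x \<in> M \<Longrightarrow> A1 x = x \<Longrightarrow> A2 x = x \<Longrightarrow> B x = x \<Longrightarrow> x \<in> k"
    and faithful: "\<And>i j l. i < ?n \<Longrightarrow> j < ?n \<Longrightarrow> l < ?n \<Longrightarrow>
      \<forall>x\<in>M. (A1 ^^ i) ((A2 ^^ j) ((B ^^ l) x)) = x \<Longrightarrow> i = 0 \<and> j = 0 \<and> l = 0"
    and generate: "\<And>g. relative_endo k M g \<Longrightarrow> \<exists>i j l. \<forall>x\<in>M. g x = (A1 ^^ i) ((A2 ^^ j) ((B ^^ l) x))"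
    apply (rule H.heisenberg_extension[folded M_def])
    subgoal premises h for A1 A2 B by (rule that[OF h(2-8)])
    done
  have M: "subfield_set M" "k \<subseteq> M" unfolding M_def using H.M.subfield_ext H.k_M by auto
  define G where "G = Gal M"
  interpret G: group G unfolding G_def by (rule group_Gal[OF M])
  have rels: "A1 (A2 x) = A2 (A1 (B x))" "A1 (B x) = B (A1 x)" "A2 (B x) = B (A2 x)"
    "(A1 ^^ ?n) x = (B ^^ s) x" "(A2 ^^ ?n) x = x" "(B ^^ ?n) x = x" if "x \<in> M" for x
    using rel that by (auto simp: heisenberg_relations_def)
  have cl: "(g ^^ i) x \<in> M" if "relative_endo k M g" "x \<in> M" for g i x
    using relative_endo_closed[OF relative_endo_funpow[OF that(1)] that(2)] .
  \<comment> \<open>Injectivity holds for every homomorphism of fields, and surjectivity of the n-th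
    iterate gives that of g.\<close>
  have bij: "bij_betw g M M" if g: "relative_endo k M g" and surj: "\<And>x. x \<in> M \<Longrightarrow> \<exists>y\<in>M. (g ^^ ?n) y = x" for g
  proof -
    interpret g: subfield_hom M g
      using M(1) relative_endo_hom_on[OF subfield_set_range_to_ac g] by unfold_locales
    have "x \<in> g ` M" if "x \<in> M" for x
    proof -
      obtain y where y: "y \<in> M" "(g ^^ ?n) y = x" using surj[OF \<open>x \<in> M\<close>] by blast
      have "(g ^^ Suc (?n - 1)) y = x" using y n_pos by simp
      then have "g ((g ^^ (?n - 1)) y) = x" by simp
      then show ?thesis using cl[OF g y(1)] by blast
    qed
    then show ?thesis unfolding bij_betw_def inj_on_def
      using g.inj relative_endo_closed[OF g] by blast
  qed
  have res: "restrict g M \<in> carrier G" if "relative_endo k M g" "bij_betw g M M" for g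
  proof -
    have "restrict g M \<in> Bij M" using that(2) by (simp add: Bij_def bij_betw_cong[of M "restrict g M" g])
    then show ?thesis using that(1) M subfield_set_simps(3,4)[OF M(1)]
      unfolding G_def Gal_mem relative_endo_def by auto
  qed
  have "\<exists>y\<in>M. (A1 ^^ ?n) y = x" if "x \<in> M" for x
  proof (intro bexI)
    \<comment> \<open>Because B^n is the identity, B^(s(n-1)) inverts B^s = A1^n.\<close>
    have "(A1 ^^ ?n) ((B ^^ (s * (?n - 1))) x) = (B ^^ s) ((B ^^ (s * (?n - 1))) x)"
      by (rule rels(4)[OF cl[OF A(3) that]])
    also have "\<dots> = (B ^^ (s + s * (?n - 1))) x" by (simp only: funpow_add comp_apply)
    also have "s + s * (?n - 1) = ?n * s" using n_pos by (metis Suc_pred' mult.commute mult_Suc_right)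
    also have "(B ^^ (?n * s)) x = ((B ^^ ?n) ^^ s) x" by (simp only: funpow_mult)
    also have "\<dots> = x"
    proof -
      have "((B ^^ ?n) ^^ t) x = x" for t by (induction t) (simp_all add: rels(6)[OF that])
      then show ?thesis .
    qed
    finally show "(A1 ^^ ?n) ((B ^^ (s * (?n - 1))) x) = x" .
  qed (rule cl[OF A(3) that])
  then have b1: "bij_betw A1 M M" by (rule bij[OF A(1)])
  have b2: "bij_betw A2 M M" using rels(5) by (intro bij[OF A(2)]) blast
  have b3: "bij_betw B M M" using rels(6) by (intro bij[OF A(3)]) blast
  define c where "c = case_phi14_gen (restrict A1 M) (restrict A2 M) (restrict B M)"
  have c: "c g \<in> carrier G" for g
    using res[OF A(1) b1] res[OF A(2) b2] res[OF A(3) b3] by (cases g) (simp_all add: c_def)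
  have respow: "(restrict g M ^^ i) x = (g ^^ i) x" if "relative_endo k M g" "x \<in> M" for g i x
    using that cl[OF that] by (induction i) simp_all
  have cM: "c Alpha1 x = A1 x" "c Alpha2 x = A2 x" "c Beta x = B x" if "x \<in> M" for x
    using that by (simp_all add: c_def)
  have cpow: "(c Alpha1 ^^ i) x = (A1 ^^ i) x" "(c Alpha2 ^^ i) x = (A2 ^^ i) x" "(c Beta ^^ i) x = (B ^^ i) x"
    if "x \<in> M" for x i using that A by (simp_all add: c_def respow)
  have NF: "(c Alpha1 [^]\<^bsub>G\<^esub> i \<otimes>\<^bsub>G\<^esub> (c Alpha2 [^]\<^bsub>G\<^esub> j \<otimes>\<^bsub>G\<^esub> c Beta [^]\<^bsub>G\<^esub> l)) x
      = (A1 ^^ i) ((A2 ^^ j) ((B ^^ l) x))" if "x \<in> M" for x and i j l :: nat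
    using Gal_normal_form[OF M c[unfolded G_def] c[unfolded G_def] c[unfolded G_def] that, of Alpha1 i Alpha2 j Beta l]
      cl[OF A(3) that] cl[OF A(2) cl[OF A(3) that]] that by (simp add: G_def cpow)
  have endo: "A1 x \<in> M" "A2 x \<in> M" "B x \<in> M" if "x \<in> M" for x
    using relative_endo_closed[OF _ that] A by auto
  have mult: "(\<sigma> \<otimes>\<^bsub>G\<^esub> \<tau>) x = \<sigma> (\<tau> x)" if "\<sigma> \<in> carrier G" "\<tau> \<in> carrier G" "x \<in> M" for \<sigma> \<tau> x
    using that by (simp add: G_def Gal_mult compose_eq)
  have pow: "(c g [^]\<^bsub>G\<^esub> i) x = (c g ^^ i) x" if "x \<in> M" for g x and i :: nat
    using Gal_pow[OF M _ that] c by (simp add: G_def)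
  have eqI: "\<sigma> = \<tau>" if "\<sigma> \<in> carrier G" "\<tau> \<in> carrier G" "\<And>x. x \<in> M \<Longrightarrow> \<sigma> x = \<tau> x" for \<sigma> \<tau>
    using Gal_eqI[of \<sigma> M \<tau>] that by (simp add: G_def)
  have one: "\<one>\<^bsub>G\<^esub> x = x" if "x \<in> M" for x using that by (simp add: G_def Gal_one)
  have E: "phi14_elements G ?n s (c Alpha1) (c Alpha2) (c Beta)"
  proof (unfold_locales)
    show "0 < ?n" by (rule n_pos)
    show "c Alpha1 \<in> carrier G" "c Alpha2 \<in> carrier G" "c Beta \<in> carrier G" by (rule c)+
    show "c Alpha1 \<otimes>\<^bsub>G\<^esub> c Alpha2 = c Alpha2 \<otimes>\<^bsub>G\<^esub> c Alpha1 \<otimes>\<^bsub>G\<^esub> c Beta"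
      by (rule eqI) (simp_all add: c mult cM endo rels(1))
    show "c Alpha1 \<otimes>\<^bsub>G\<^esub> c Beta = c Beta \<otimes>\<^bsub>G\<^esub> c Alpha1"
      by (rule eqI) (simp_all add: c mult cM endo rels(2))
    show "c Alpha2 \<otimes>\<^bsub>G\<^esub> c Beta = c Beta \<otimes>\<^bsub>G\<^esub> c Alpha2"
      by (rule eqI) (simp_all add: c mult cM endo rels(3))
    show "c Alpha1 [^]\<^bsub>G\<^esub> ?n = c Beta [^]\<^bsub>G\<^esub> s" by (rule eqI) (simp_all add: c pow cpow rels(4))
    show "c Alpha2 [^]\<^bsub>G\<^esub> ?n = \<one>\<^bsub>G\<^esub>" by (rule eqI) (simp_all add: c pow cpow rels(5) one)
    show "c Beta [^]\<^bsub>G\<^esub> ?n = \<one>\<^bsub>G\<^esub>" by (rule eqI) (simp_all add: c pow cpow rels(6) one)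
  qed
  then have relations: "word_value G c l = word_value G c r" if "(l, r) \<in> R" for l r
    using G.phi14_relations_iff[where c = c and s = s, OF c p0] that by (auto simp: R_def)
  \<comment> \<open>A class is evaluated through an arbitrary representing word; the relations
    between the generators make the value independent of the word.\<close>
  define \<phi> where "\<phi> U = word_value G c (SOME w. U = word_class R w)" for U
  have \<phi>: "\<phi> (word_class R w) = word_value G c w" for w
  proof -
    have "word_class R w = word_class R (SOME v. word_class R w = word_class R v)" by (rule someI[of _ w]) simp
    then have "word_eq R w (SOME v. word_class R w = word_class R v)" by (simp only: word_class_eq_iff)
    from G.word_value_word_eq[OF c this relations] show ?thesis by (simp add: \<phi>_def)
  qed
  interpret P: group "presented_group R" by (rule group_presented_group)
  have hom: "\<phi> \<in> hom (presented_group R) G"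
  proof (rule homI)
    fix U assume "U \<in> carrier (presented_group R)"
    then obtain u where "U = word_class R u" using word_class_surj by blast
    then show "\<phi> U \<in> carrier G" by (simp add: \<phi> G.word_value_closed[OF c])
  next
    fix U V assume "U \<in> carrier (presented_group R)" "V \<in> carrier (presented_group R)"
    then obtain u v where "U = word_class R u" "V = word_class R v" using word_class_surj by metis
    then show "\<phi> (U \<otimes>\<^bsub>presented_group R\<^esub> V) = \<phi> U \<otimes>\<^bsub>G\<^esub> \<phi> V"
      by (simp add: presented_group_mult \<phi> G.word_value_append[OF c])
  qed
  interpret \<phi>: group_hom "presented_group R" G \<phi> using hom by unfold_locales
  have normal: "\<exists>i<?n. \<exists>j<?n. \<exists>l<?n. word_class R w = word_class R (normal_word i j l)" for w
  proof -
    let ?c = "\<lambda>g. word_class R (gen g)"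
    interpret E: phi14_elements "presented_group R" ?n s "?c Alpha1" "?c Alpha2" "?c Beta"
      unfolding R_def by (rule phi14_elements_presented_group[OF p0])
    obtain i j l where ijl: "i < ?n" "j < ?n" "l < ?n"
      "word_value (presented_group R) ?c w = E.NF i j l"
      using E.word_normal_form[of w] unfolding phi14_gen_cases[of ?c, symmetric] by blast
    have "E.NF i j l = word_value (presented_group R) ?c (normal_word i j l)"
      by (rule P.phi14_word_value_normal_word[OF word_class_in, symmetric])
    then show ?thesis using ijl unfolding word_value_presented_group by metis
  qed
  \<comment> \<open>An element of the kernel has a normal form with exponents below n, and the
    corresponding automorphism is trivial only when all exponents are 0.\<close>
  have "inj_on \<phi> (carrier (presented_group R))"
    unfolding \<phi>.inj_on_one_iff
  proof (intro allI impI)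
    fix U assume U: "U \<in> carrier (presented_group R)" "\<phi> U = \<one>\<^bsub>G\<^esub>"
    then obtain w where w: "U = word_class R w" using word_class_surj by blast
    obtain i j l where ijl: "i < ?n" "j < ?n" "l < ?n" "U = word_class R (normal_word i j l)"
      using normal[of w] w by blast
    have "c Alpha1 [^]\<^bsub>G\<^esub> i \<otimes>\<^bsub>G\<^esub> (c Alpha2 [^]\<^bsub>G\<^esub> j \<otimes>\<^bsub>G\<^esub> c Beta [^]\<^bsub>G\<^esub> l) = \<one>\<^bsub>G\<^esub>"
      using U(2) unfolding ijl(4) \<phi> by (simp only: G.phi14_word_value_normal_word[OF c])
    then have "\<forall>x\<in>M. (A1 ^^ i) ((A2 ^^ j) ((B ^^ l) x)) = x" using NF one by metis
    from faithful[OF ijl(1-3) this] have "normal_word i j l = []" by (simp add: wpow_def)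
    then show "U = \<one>\<^bsub>presented_group R\<^esub>" using ijl(4) word_class_one by metis
  qed
  moreover have "carrier G \<subseteq> \<phi> ` carrier (presented_group R)"
  proof
    fix \<sigma> assume \<sigma>: "\<sigma> \<in> carrier G"
    obtain i j l where ijl: "\<forall>x\<in>M. \<sigma> x = (A1 ^^ i) ((A2 ^^ j) ((B ^^ l) x))"
      using generate[OF Gal_relative_endo] \<sigma> unfolding G_def by blast
    have "\<sigma> = word_value G c (normal_word i j l)"
      using \<sigma> ijl NF by (intro eqI) (simp_all add: c G.word_value_closed[OF c] G.phi14_word_value_normal_word[OF c])
    then have "\<sigma> = \<phi> (word_class R (normal_word i j l))" by (simp only: \<phi>)
    then show "\<sigma> \<in> \<phi> ` carrier (presented_group R)" by (rule image_eqI[OF _ word_class_in])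
  qed
  ultimately have "\<phi> \<in> iso (presented_group R) G"
    using hom unfolding iso_def bij_betw_def by (auto simp: hom_def Pi_def)
  then have "Gal M \<cong> presented_group R"
    using P.iso_sym is_isoI unfolding G_def by blast
  moreover have "galois_extension M" unfolding galois_extension_def intermediate_field_iff
  proof (intro conjI M equalityI subsetI)
    fix x assume "x \<in> {x \<in> M. \<forall>\<sigma>\<in>carrier (Gal M). \<sigma> x = x}"
    then have x: "x \<in> M" "\<And>g. c g x = x" using c by (auto simp: G_def)
    have "A1 x = x" "A2 x = x" "B x = x"
      using x(2)[of Alpha1] x(2)[of Alpha2] x(2)[of Beta] cM[OF x(1)] by metis+
    then show "x \<in> k" by (rule fixed[OF x(1)])
  next
    fix x assume "x \<in> k"
    then show "x \<in> {x \<in> M. \<forall>\<sigma>\<in>carrier (Gal M). \<sigma> x = x}" using M(2) by (auto simp: Gal_mem)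
  qed
  ultimately show ?thesis unfolding realizable_def R_def by blast
qed

lemma norm_condition_if_realizable:
  assumes "realizable TYPE('a) (presented_group (phi14_relations p (wpow (gen Beta) s)))"
  shows "\<exists>a1 a2. independent_mod_powers p a1 a2 \<and> norm_condition (p ^ 2) z a1 (z ^ s * a2)"
proof -
  let ?n = "p ^ 2" and ?Z = "to_ac z"
  define R where "R = phi14_relations p (wpow (gen Beta) s)"
  have n_pos: "?n > 0" and p0: "p > 0" using prime_gt_0_nat[OF prime_p] by auto
  obtain M :: "'a alg_closure set" where gal: "galois_extension M" and iso: "Gal M \<cong> presented_group R"
    using assms by (auto simp: realizable_def R_def)
  have M: "subfield_set M" "k \<subseteq> M" and fixed: "\<And>x. x \<in> M \<Longrightarrow> \<forall>\<sigma>\<in>carrier (Gal M). \<sigma> x = x \<Longrightarrow> x \<in> k"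
    using gal unfolding galois_extension_def intermediate_field_iff by auto
  define G where "G = Gal M"
  interpret G: group G unfolding G_def by (rule group_Gal[OF M])
  interpret P: group "presented_group R" by (rule group_presented_group)
  obtain h where h: "h \<in> iso (presented_group R) G"
    using iso G.iso_sym unfolding G_def is_iso_def by blast
  interpret h: group_hom "presented_group R" G h using h unfolding iso_def by unfold_locales auto
  define c where "c g = h (word_class R (gen g))" for g
  have c: "c g \<in> carrier G" for g unfolding c_def by (rule h.hom_closed[OF word_class_in])
  have hw: "h (word_class R w) = word_value G c w" for w
    using hom_word_value[where c = "\<lambda>g. word_class R (gen g)", OF h.group_hom_axioms word_class_in, of w]
    by (simp add: c_def[abs_def] word_value_presented_group)
  have "word_value G c l = word_value G c r" if "(l, r) \<in> R" for l r
    using presented_group_relation[OF that] by (simp flip: hw)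
  then have "phi14_elements G ?n s (c Alpha1) (c Alpha2) (c Beta)"
    using G.phi14_relations_iff[where c = c and s = s, OF c p0] by (auto simp: R_def)
  then interpret E: phi14_elements G ?n s "c Alpha1" "c Alpha2" "c Beta" .
  have re: "relative_endo k M (c g)" for g by (rule Gal_relative_endo[OF c[unfolded G_def]])
  have mult: "(\<sigma> \<otimes>\<^bsub>G\<^esub> \<tau>) x = \<sigma> (\<tau> x)" if "\<sigma> \<in> carrier G" "\<tau> \<in> carrier G" "x \<in> M" for \<sigma> \<tau> x
    using that by (simp add: G_def Gal_mult compose_eq)
  have pow: "(c g [^]\<^bsub>G\<^esub> i) x = (c g ^^ i) x" if "x \<in> M" for g x and i :: nat
    using Gal_pow[OF M _ that] c by (simp add: G_def)
  have one: "\<one>\<^bsub>G\<^esub> x = x" if "x \<in> M" for x using that by (simp add: G_def Gal_one)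
  have NF: "E.NF i j l x = (c Alpha1 ^^ i) ((c Alpha2 ^^ j) ((c Beta ^^ l) x))" if "x \<in> M" for x i j l
    using Gal_normal_form[OF M c[unfolded G_def] c[unfolded G_def] c[unfolded G_def] that] by (simp add: G_def)
  have rel: "heisenberg_relations ?n s M (c Alpha1) (c Alpha2) (c Beta)"
    unfolding heisenberg_relations_def
  proof (intro ballI conjI)
    fix x assume x: "x \<in> M"
    show "c Alpha1 (c Alpha2 x) = c Alpha2 (c Alpha1 (c Beta x))"
      using arg_cong[OF E.a1_a2, of "\<lambda>f. f x"] x c re[THEN relative_endo_closed] by (simp add: mult)
    show "c Alpha1 (c Beta x) = c Beta (c Alpha1 x)"
      using arg_cong[OF E.a1_b, of "\<lambda>f. f x"] x c by (simp add: mult)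
    show "c Alpha2 (c Beta x) = c Beta (c Alpha2 x)"
      using arg_cong[OF E.a2_b, of "\<lambda>f. f x"] x c by (simp add: mult)
    show "(c Alpha1 ^^ ?n) x = (c Beta ^^ s) x"
      using arg_cong[OF E.a1_n, of "\<lambda>f. f x"] x by (simp add: pow)
    show "(c Alpha2 ^^ ?n) x = x" using arg_cong[OF E.a2_n, of "\<lambda>f. f x"] x by (simp add: pow one)
    show "(c Beta ^^ ?n) x = x" using arg_cong[OF E.b_n, of "\<lambda>f. f x"] x by (simp add: pow one)
  qed
  have h_inj: "inj_on h (carrier (presented_group R))" and h_surj: "h ` carrier (presented_group R) = carrier G"
    using h by (auto simp: iso_def bij_betw_def)
  interpret H: heisenberg_galois ?n ?Z p k M "c Alpha1" "c Alpha2" "c Beta" s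
  proof (intro heisenberg_galois.intro heisenberg_galois_axioms.intro kummer_ac subfield_set_range_to_ac M re rel)
    show "x \<in> M" if "x \<in> k" for x using that M by blast
    show "?Z \<in> k" by simp
    show "of_nat ?n \<noteq> (0::'a alg_closure)" by (rule of_nat_nz_ac)
  next
    fix x assume x: "x \<in> M" "c Alpha1 x = x" "c Alpha2 x = x" "c Beta x = x"
    have pw: "(c g ^^ i) x = x" for g i using x(2-4) by (induction i) (cases g; simp)+
    \<comment> \<open>Every automorphism is the value of a word, so an element fixed by the three
      generators is fixed by the whole group.\<close>
    have "\<sigma> x = x" if "\<sigma> \<in> carrier G" for \<sigma>
    proof -
      obtain U where U: "U \<in> carrier (presented_group R)" "\<sigma> = h U"
        using \<open>\<sigma> \<in> carrier G\<close> h_surj by blast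
      obtain w where "U = word_class R w" using word_class_surj[OF U(1)] by blast
      then have \<sigma>: "\<sigma> = word_value G c w" by (simp only: U(2) hw)
      obtain i j l where "word_value G c w = E.NF i j l"
        using E.word_normal_form[of w] unfolding phi14_gen_cases[of c, symmetric] by blast
      then have "\<sigma> x = E.NF i j l x" by (simp only: \<sigma>)
      then show ?thesis by (simp only: NF[OF x(1)] pw)
    qed
    then show "x \<in> k" by (intro fixed[OF x(1)] ballI) (simp only: G_def)
  next
    fix i j l i' j' l' assume lt: "i < ?n" "j < ?n" "l < ?n" "i' < ?n" "j' < ?n" "l' < ?n"
      and eq: "\<forall>x\<in>M. (c Alpha1 ^^ i) ((c Alpha2 ^^ j) ((c Beta ^^ l) x)) = (c Alpha1 ^^ i') ((c Alpha2 ^^ j') ((c Beta ^^ l') x))"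
    \<comment> \<open>Equal maps come from normal words with the same image under the isomorphism h,
      hence with the same class, and the Heisenberg model separates normal words with exponents
      below n.\<close>
    have "E.NF i j l = E.NF i' j' l'"
    proof (rule Gal_eqI)
      show "E.NF i j l \<in> carrier (Gal M)" "E.NF i' j' l' \<in> carrier (Gal M)" using c by (simp_all flip: G_def)
      show "E.NF i j l x = E.NF i' j' l' x" if "x \<in> M" for x using eq NF[OF that] that by simp
    qed
    then have "h (word_class R (normal_word i j l)) = h (word_class R (normal_word i' j' l'))"
      by (simp only: hw G.phi14_word_value_normal_word[OF c])
    then have "word_eq R (normal_word i j l) (normal_word i' j' l')"
      using inj_onD[OF h_inj _ word_class_in word_class_in] unfolding word_class_eq_iff by blast
    then show "i = i' \<and> j = j' \<and> l = l'" using lt unfolding R_def by (rule normal_words_distinct)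
  qed
  obtain \<theta>1 \<theta>2 f where \<theta>: "\<theta>1 ^ ?n \<in> k" "\<theta>2 ^ ?n \<in> k" "\<theta>1 \<noteq> 0" "\<theta>2 \<noteq> 0" "f \<in> polys_over k"
    and ind: "\<And>c i j. c \<in> k \<Longrightarrow> c \<noteq> 0 \<Longrightarrow> (\<theta>1 ^ ?n) powi i * (\<theta>2 ^ ?n) powi j = c ^ p \<Longrightarrow> int p dvd i \<and> int p dvd j"
    and norm: "(\<Prod>j<?n. poly f (?Z ^ j * \<theta>1)) = ?Z ^ s * \<theta>2 ^ ?n"
    apply (rule H.kummer_generators)
    subgoal premises h for \<theta>1 \<theta>2 f by (rule that[OF h(2-8)])
    done
  obtain a1 a2 g where a: "\<theta>1 ^ ?n = to_ac a1" "\<theta>2 ^ ?n = to_ac a2" "f = lift g"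
    using \<theta> polys_over_range[of f] by blast
  have a0: "a1 \<noteq> 0" "a2 \<noteq> 0" using \<theta>(3,4) a(1,2) by (metis power_not_zero to_ac_0)+
  have indep: "independent_mod_powers p a1 a2"
    unfolding independent_mod_powers_def
  proof (intro conjI a0 allI impI)
    fix m n :: int assume "\<exists>c. c \<noteq> 0 \<and> a1 powi m * a2 powi n = c ^ p"
    then obtain c where c: "c \<noteq> 0" "a1 powi m * a2 powi n = c ^ p" by blast
    have "(\<theta>1 ^ ?n) powi m * (\<theta>2 ^ ?n) powi n = to_ac c ^ p"
      unfolding a using arg_cong[OF c(2), of to_ac] by (simp add: to_ac_power_int)
    then show "int p dvd m" "int p dvd n" using ind[of "to_ac c" m n] c(1) by auto
  qed
  moreover have "norm_condition ?n z a1 (z ^ s * a2)"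
    unfolding norm_condition_iff[OF a(1) independent_not_power(1)[OF indep]]
    using norm a by (intro exI[of _ g]) simp
  ultimately show ?thesis by blast
qed

end

section \<open>Linear systems\<close>

text \<open>Gaussian elimination, one equation of E at a time, with J indexing the unknowns. All
  later dimension counts rest on it.\<close>

lemma linear_system_nontrivial:
  fixes A :: "'j \<Rightarrow> 'x \<Rightarrow> 'a::field"
  assumes "finite E" "finite J" "card E < card J"
  shows "\<exists>c. (\<exists>j\<in>J. c j \<noteq> 0) \<and> (\<forall>x\<in>E. (\<Sum>j\<in>J. c j * A j x) = 0)"
  using assms
proof (induction E arbitrary: J A rule: finite_induct)
  case empty
  then have "J \<noteq> {}" by auto
  then show ?case by (intro exI[of _ "\<lambda>_. 1"]) auto
next
  case (insert x0 E)
  show ?case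
  proof (cases "\<forall>j\<in>J. A j x0 = 0")
    case True
    obtain c where "\<exists>j\<in>J. c j \<noteq> 0" "\<forall>x\<in>E. (\<Sum>j\<in>J. c j * A j x) = 0"
      using insert.IH[of J A] insert.prems insert.hyps by auto
    then show ?thesis using True by (intro exI[of _ c]) auto
  next
    case False
    then obtain j0 where j0: "j0 \<in> J" "A j0 x0 \<noteq> 0" by blast
    define J' where "J' = J - {j0}"
    \<comment> \<open>From the vector of each j, the multiple of the pivot vector j0 that clears
      equation x0 is subtracted; d j0 below is then determined by that equation.\<close>
    define A' where "A' j x = A j x - A j x0 / A j0 x0 * A j0 x" for j x
    have "card J' = card J - 1" "finite J'" using j0 insert.prems by (simp_all add: J'_def)
    then have "card E < card J'" using insert.prems insert.hyps by simp
    then obtain c where c: "\<exists>j\<in>J'. c j \<noteq> 0" "\<forall>x\<in>E. (\<Sum>j\<in>J'. c j * A' j x) = 0"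
      using insert.IH[OF \<open>finite J'\<close>] by blast
    define d where "d j = (if j = j0 then - (\<Sum>j\<in>J'. c j * A j x0) / A j0 x0 else c j)" for j
    have sum: "(\<Sum>j\<in>J. d j * A j x) = (\<Sum>j\<in>J'. c j * A j x) + d j0 * A j0 x" for x
    proof -
      have "(\<Sum>j\<in>J. d j * A j x) = d j0 * A j0 x + (\<Sum>j\<in>J'. d j * A j x)"
        unfolding J'_def by (rule sum.remove[OF insert.prems(1) j0(1)])
      also have "(\<Sum>j\<in>J'. d j * A j x) = (\<Sum>j\<in>J'. c j * A j x)"
        by (intro sum.cong) (auto simp: d_def J'_def)
      finally show ?thesis by simp
    qed
    have "(\<Sum>j\<in>J'. c j * A j x) + d j0 * A j0 x = (\<Sum>j\<in>J'. c j * A' j x)" for x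
    proof -
      have "(\<Sum>j\<in>J'. c j * A' j x) = (\<Sum>j\<in>J'. c j * A j x) - (\<Sum>j\<in>J'. c j * A j x0) / A j0 x0 * A j0 x"
        by (simp add: A'_def algebra_simps sum_subtractf sum_distrib_left sum_distrib_right sum_divide_distrib)
      then show ?thesis by (simp add: d_def)
    qed
    then have "\<forall>x\<in>E. (\<Sum>j\<in>J. d j * A j x) = 0" using c(2) by (simp add: sum)
    moreover have "(\<Sum>j\<in>J. d j * A j x0) = 0" using j0(2) by (simp only: sum) (simp add: d_def)
    moreover have "\<exists>j\<in>J. d j \<noteq> 0" using c(1) by (auto simp: d_def J'_def)
    ultimately show ?thesis by (intro exI[of _ d]) auto
  qed
qed

section \<open>Matrix algebras\<close>

lemma base_algebra_sel:
  "carrier base_algebra = UNIV" "monoid.mult base_algebra = (*)" "one base_algebra = 1"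
  "ring.zero base_algebra = 0" "add base_algebra = (+)" "module.smult base_algebra = (*)"
  by (simp_all add: base_algebra_def)

lemma ring_base_algebra: "ring (base_algebra :: ('a::field, 'a) module)"
proof -
  have "\<exists>y. x + y = 0" "\<exists>y. y + x = 0" for x :: 'a by (rule exI[of _ "- x"], simp)+
  then show ?thesis
    unfolding base_algebra_def by unfold_locales (auto simp: algebra_simps Units_def)
qed

lemma finsum_base_algebra: "finite S \<Longrightarrow> finsum base_algebra f S = (\<Sum>x\<in>S. f x)"
proof (induction S rule: finite_induct)
  case empty
  interpret ring "base_algebra :: ('b::field, 'b) module" by (rule ring_base_algebra)
  show ?case by (simp add: base_algebra_sel)
next
  case (insert x S)
  interpret ring "base_algebra :: ('b::field, 'b) module" by (rule ring_base_algebra)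
  show ?case using insert by (subst finsum_insert) (auto simp: base_algebra_sel)
qed

abbreviation "idx m \<equiv> {..<m} \<times> {..<(m::nat)}"

lemma matrix_algebra_sel:
  "carrier (matrix_algebra m A) = idx m \<rightarrow>\<^sub>E carrier A"
  "monoid.mult (matrix_algebra m A) U V = (\<lambda>(i, j)\<in>idx m. \<Oplus>\<^bsub>A\<^esub>l\<in>{..<m}. U (i, l) \<otimes>\<^bsub>A\<^esub> V (l, j))"
  "one (matrix_algebra m A) = (\<lambda>(i, j)\<in>idx m. if i = j then \<one>\<^bsub>A\<^esub> else \<zero>\<^bsub>A\<^esub>)"
  "add (matrix_algebra m A) U V = (\<lambda>ij\<in>idx m. U ij \<oplus>\<^bsub>A\<^esub> V ij)"
  "module.smult (matrix_algebra m A) c U = (\<lambda>ij\<in>idx m. c \<odot>\<^bsub>A\<^esub> U ij)"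
  by (simp_all add: matrix_algebra_def)

lemma matrix_base_algebra_sel:
  "carrier (matrix_algebra m (base_algebra :: ('a::field, 'a) module)) = idx m \<rightarrow>\<^sub>E UNIV"
  "monoid.mult (matrix_algebra m (base_algebra :: ('a::field, 'a) module)) U V
    = (\<lambda>(i, j)\<in>idx m. \<Sum>l<m. U (i, l) * V (l, j))"
  "one (matrix_algebra m (base_algebra :: ('a::field, 'a) module)) = (\<lambda>(i, j)\<in>idx m. if i = j then 1 else 0)"
  "add (matrix_algebra m (base_algebra :: ('a::field, 'a) module)) U V = (\<lambda>ij\<in>idx m. U ij + V ij)"
  "module.smult (matrix_algebra m (base_algebra :: ('a::field, 'a) module)) c U = (\<lambda>ij\<in>idx m. c * U ij)"
  unfolding matrix_algebra_sel base_algebra_sel by (simp_all add: finsum_base_algebra)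

section \<open>Presented algebras\<close>

lemma free_ring_sel:
  "carrier (ring_of_type_algebra :: ('g, 'a::field) free_algebra ring) = UNIV"
  "monoid.mult (ring_of_type_algebra :: ('g, 'a) free_algebra ring) = (*)"
  "one (ring_of_type_algebra :: ('g, 'a) free_algebra ring) = 1"
  "ring.zero (ring_of_type_algebra :: ('g, 'a) free_algebra ring) = 0"
  "add (ring_of_type_algebra :: ('g, 'a) free_algebra ring) = (+)"
  by (simp_all add: ring_of_type_algebra_def)

definition rel_ideal :: "('g, 'a::field) free_algebra set \<Rightarrow> ('g, 'a) free_algebra set" where
  "rel_ideal R = Idl\<^bsub>ring_of_type_algebra\<^esub> R"

definition alg_class :: "('g, 'a::field) free_algebra set \<Rightarrow> ('g, 'a) free_algebra \<Rightarrow> ('g, 'a) free_algebra set" where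
  "alg_class R x = rel_ideal R +>\<^bsub>ring_of_type_algebra\<^esub> x"

lemma ideal_rel_ideal: "ideal (rel_ideal R) (ring_of_type_algebra :: ('g, 'a::field) free_algebra ring)"
  unfolding rel_ideal_def by (rule ring.genideal_ideal[OF ring_free_algebra]) (simp add: free_ring_sel)

lemma rel_ideal_closed:
  fixes x y r :: "('g, 'a::field) free_algebra"
  shows "0 \<in> rel_ideal R" "x \<in> rel_ideal R \<Longrightarrow> y \<in> rel_ideal R \<Longrightarrow> x + y \<in> rel_ideal R"
    "x \<in> rel_ideal R \<Longrightarrow> r * x \<in> rel_ideal R" "x \<in> rel_ideal R \<Longrightarrow> x * r \<in> rel_ideal R"
    "x \<in> rel_ideal R \<Longrightarrow> - x \<in> rel_ideal R" "x \<in> R \<Longrightarrow> x \<in> rel_ideal R"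
    "x \<in> rel_ideal R \<Longrightarrow> y \<in> rel_ideal R \<Longrightarrow> x - y \<in> rel_ideal R"
proof -
  interpret ideal "rel_ideal R" "ring_of_type_algebra :: ('g, 'a) free_algebra ring"
    by (rule ideal_rel_ideal)
  show 0: "0 \<in> rel_ideal R" using additive_subgroup.zero_closed[OF is_additive_subgroup] by (simp add: free_ring_sel)
  show add: "x \<in> rel_ideal R \<Longrightarrow> y \<in> rel_ideal R \<Longrightarrow> x + y \<in> rel_ideal R" for x y
    using additive_subgroup.a_closed[OF is_additive_subgroup, of x y] by (simp add: free_ring_sel)
  show l: "x \<in> rel_ideal R \<Longrightarrow> r * x \<in> rel_ideal R" for x r
    using I_l_closed[of x r] by (simp add: free_ring_sel)
  show "x \<in> rel_ideal R \<Longrightarrow> x * r \<in> rel_ideal R"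
    using I_r_closed[of x r] by (simp add: free_ring_sel)
  show neg: "x \<in> rel_ideal R \<Longrightarrow> - x \<in> rel_ideal R" for x using l[of x "- 1"] by simp
  show "x \<in> R \<Longrightarrow> x \<in> rel_ideal R"
    unfolding rel_ideal_def using ring.genideal_self[OF ring_free_algebra, of R] by (auto simp: free_ring_sel)
  show "x \<in> rel_ideal R \<Longrightarrow> y \<in> rel_ideal R \<Longrightarrow> x - y \<in> rel_ideal R"
    using add[OF _ neg, of x y] by simp
qed

lemma rel_ideal_minimal:
  fixes J :: "('g, 'a::field) free_algebra set"
  assumes "R \<subseteq> J" "0 \<in> J" "\<And>x y. x \<in> J \<Longrightarrow> y \<in> J \<Longrightarrow> x + y \<in> J"
    "\<And>x r. x \<in> J \<Longrightarrow> r * x \<in> J" "\<And>x r. x \<in> J \<Longrightarrow> x * r \<in> J"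
  shows "rel_ideal R \<subseteq> J"
proof -
  interpret F: ring "ring_of_type_algebra :: ('g, 'a) free_algebra ring" by (rule ring_free_algebra)
  have neg: "a_inv (ring_of_type_algebra :: ('g, 'a) free_algebra ring) x = - x" for x
    by (rule F.minus_equality) (simp_all add: free_ring_sel)
  have neg_J: "- x \<in> J" if "x \<in> J" for x using assms(4)[OF that, of "- 1"] by simp
  have "ideal J (ring_of_type_algebra :: ('g, 'a) free_algebra ring)"
  proof (rule idealI[OF ring_free_algebra])
    show "subgroup J (add_monoid (ring_of_type_algebra :: ('g, 'a) free_algebra ring))"
      using assms(2,3) neg_J neg unfolding a_inv_def
      by (intro group.subgroupI[OF F.a_group]) (auto simp: free_ring_sel)
  qed (use assms(4,5) in \<open>simp_all add: free_ring_sel\<close>)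
  then show ?thesis unfolding rel_ideal_def using assms(1) by (intro F.genideal_minimal)
qed

lemma presented_algebra_sel:
  fixes R :: "('g, 'a::field) free_algebra set"
  shows "carrier (presented_algebra R) = range (alg_class R)"
    "monoid.mult (presented_algebra R) (alg_class R x) (alg_class R y) = alg_class R (x * y)"
    "one (presented_algebra R) = alg_class R 1"
    "ring.zero (presented_algebra R) = alg_class R 0"
    "add (presented_algebra R) (alg_class R x) (alg_class R y) = alg_class R (x + y)"
    "module.smult (presented_algebra R) c (alg_class R x) = alg_class R (fa_const c * x)"
    "alg_class R x = alg_class R y \<longleftrightarrow> x - y \<in> rel_ideal R"
proof -
  let ?F = "ring_of_type_algebra :: ('g, 'a) free_algebra ring"
  interpret F: ring ?F by (rule ring_free_algebra)
  interpret I: ideal "rel_ideal R" ?F by (rule ideal_rel_ideal)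
  have neg: "a_inv ?F x = - x" for x
    by (rule F.minus_equality) (simp_all add: free_ring_sel)
  have sel: "carrier (presented_algebra R) = carrier (?F Quot rel_ideal R)"
    "monoid.mult (presented_algebra R) = monoid.mult (?F Quot rel_ideal R)"
    "one (presented_algebra R) = one (?F Quot rel_ideal R)"
    "ring.zero (presented_algebra R) = ring.zero (?F Quot rel_ideal R)"
    "add (presented_algebra R) = add (?F Quot rel_ideal R)"
    by (simp_all add: presented_algebra_def Let_def rel_ideal_def)
  show "carrier (presented_algebra R) = range (alg_class R)"
    unfolding sel by (auto simp: FactRing_def A_RCOSETS_def' alg_class_def free_ring_sel)
  have mult: "monoid.mult (?F Quot rel_ideal R) (alg_class R x) (alg_class R y) = alg_class R (x * y)" for x y
    using I.rcoset_mult_add[of x y] by (simp add: FactRing_def alg_class_def free_ring_sel)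
  then show "monoid.mult (presented_algebra R) (alg_class R x) (alg_class R y) = alg_class R (x * y)"
    by (simp add: sel)
  show "one (presented_algebra R) = alg_class R 1" by (simp add: sel FactRing_def alg_class_def free_ring_sel)
  show eq: "alg_class R x = alg_class R y \<longleftrightarrow> x - y \<in> rel_ideal R" for x y
    using F.quotient_eq_iff_same_a_r_cos[OF ideal_rel_ideal, of x y R]
    by (simp add: alg_class_def free_ring_sel a_minus_def neg)
  have "rel_ideal R = alg_class R 0"
    using F.a_coset_add_zero[of "rel_ideal R"] by (simp add: alg_class_def free_ring_sel)
  then show "ring.zero (presented_algebra R) = alg_class R 0" by (simp add: sel FactRing_def)
  show "add (presented_algebra R) (alg_class R x) (alg_class R y) = alg_class R (x + y)"
    using I.a_rcos_sum[of x y] by (simp add: sel FactRing_def alg_class_def free_ring_sel)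
  show "module.smult (presented_algebra R) c (alg_class R x) = alg_class R (fa_const c * x)"
    using mult by (simp add: presented_algebra_def Let_def rel_ideal_def[symmetric] alg_class_def)
qed

lemma ring_presented_algebra: "ring (presented_algebra (R :: ('g, 'a::field) free_algebra set))"
proof (rule ringI)
  note sel = presented_algebra_sel[of R]
  show "abelian_group (presented_algebra R)"
  proof (rule abelian_groupI)
    fix U assume "U \<in> carrier (presented_algebra R)"
    then obtain x where U: "U = alg_class R x" by (auto simp: sel(1))
    have "alg_class R (- x) \<oplus>\<^bsub>presented_algebra R\<^esub> U = \<zero>\<^bsub>presented_algebra R\<^esub>" by (simp add: U sel(4,5))
    then show "\<exists>V\<in>carrier (presented_algebra R). V \<oplus>\<^bsub>presented_algebra R\<^esub> U = \<zero>\<^bsub>presented_algebra R\<^esub>"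
      unfolding sel(1) by blast
  qed (auto simp: sel(1,4,5) add.assoc add.commute add.left_commute)
  show "Group.monoid (presented_algebra R)"
    by (rule monoidI) (auto simp: sel(1,2,3) mult.assoc)
qed (auto simp: presented_algebra_sel(1,2,5) algebra_simps)

section \<open>The free algebra\<close>

lemma fa_const_simps:
  "fa_const 0 = 0" "fa_const 1 = 1" "fa_const (c + d) = fa_const c + fa_const d"
  "fa_const (c * d) = fa_const c * fa_const d" "fa_const (- c) = - fa_const c"
  by (simp_all add: fa_const_def single_add mult_single single_uminus)

lemma free_algebra_expand:
  "(x :: ('g, 'a::field) free_algebra) = (\<Sum>m\<in>Poly_Mapping.keys x. Poly_Mapping.single m (Poly_Mapping.lookup x m))"
  by (intro poly_mapping_eqI) (auto simp: lookup_sum lookup_single when_def in_keys_iff sum.delta')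

lemma fa_const_single: "fa_const c * Poly_Mapping.single m d = Poly_Mapping.single m (c * d)"
  "Poly_Mapping.single m d * fa_const c = Poly_Mapping.single m (d * c)"
  by (simp_all add: fa_const_def mult_single)

lemma fa_const_central: "fa_const c * x = x * fa_const c"
  by (subst (1 2) free_algebra_expand[of x])
    (simp add: sum_distrib_left sum_distrib_right fa_const_single mult.commute)

lemma single_Word_Cons: "Poly_Mapping.single (Word (g # w)) 1 = fa_gen g * Poly_Mapping.single (Word w) 1"
  by (simp add: fa_gen_def mult_single)

text \<open>Every word arises from the empty one by putting letters in front, so multiplication by
  generators from the left is enough.\<close>

lemma free_algebra_induct [case_names one add scale gen]:
  fixes x :: "('g, 'a::field) free_algebra"
  assumes one: "P 1" and add: "\<And>x y. P x \<Longrightarrow> P y \<Longrightarrow> P (x + y)"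
    and scale: "\<And>c x. P x \<Longrightarrow> P (fa_const c * x)" and gen: "\<And>g x. P x \<Longrightarrow> P (fa_gen g * x)"
  shows "P x"
proof -
  have word: "P (Poly_Mapping.single (Word w) 1)" for w
  proof (induction w)
    case Nil
    have "Poly_Mapping.single (Word []) 1 = (1 :: ('g, 'a) free_algebra)"
      by (metis single_one zero_free_monoid_def)
    then show ?case using one by simp
  qed (simp add: single_Word_Cons gen)
  have "P (Poly_Mapping.single m c)" for m c
  proof (cases m)
    case (Word w)
    then show ?thesis using scale[OF word[of w], of c] by (simp add: fa_const_single)
  qed
  moreover have "P 0" using scale[OF one, of 0] by (simp add: fa_const_simps)
  ultimately have "P (\<Sum>m\<in>S. Poly_Mapping.single m (Poly_Mapping.lookup x m))" for S
    by (induction S rule: infinite_finite_induct) (auto intro: add)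
  then show ?thesis by (subst free_algebra_expand)
qed

section \<open>The cyclic algebra\<close>

abbreviation "i1 \<equiv> fa_gen I1 :: (cyclic_gen, 'a::field) free_algebra"
abbreviation "i2 \<equiv> fa_gen I2 :: (cyclic_gen, 'a::field) free_algebra"

text \<open>Evaluation of a commutative polynomial at i2, in Horner form. Constants commute with i2,
  so this is a ring homomorphism into the noncommutative algebra, and it makes division by T^n - a
  available there.\<close>

definition poly_i2 :: "'a::field poly \<Rightarrow> (cyclic_gen, 'a) free_algebra" where
  "poly_i2 g = fold_coeffs (\<lambda>c y. fa_const c + i2 * y) g 0"

lemma poly_i2_0: "poly_i2 0 = 0"
  by (simp add: poly_i2_def)

lemma poly_i2_pCons: "poly_i2 (pCons c g) = fa_const c + i2 * poly_i2 g"
proof (cases "c = 0 \<and> g = 0")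
  case False
  then have "coeffs (pCons c g) = c # coeffs g" by (auto simp: cCons_def)
  then show ?thesis by (simp add: poly_i2_def fold_coeffs_def)
qed (simp add: poly_i2_0 fa_const_simps)

lemma poly_i2_const: "poly_i2 [:c:] = fa_const c"
  by (simp add: poly_i2_pCons poly_i2_0)

lemma poly_i2_1: "poly_i2 1 = 1"
  using poly_i2_const[of 1] by (simp add: fa_const_simps one_pCons)

lemma poly_i2_add: "poly_i2 (g + h) = poly_i2 g + poly_i2 h"
  by (induction g h rule: poly_induct2) (simp_all add: poly_i2_0 poly_i2_pCons fa_const_simps algebra_simps)

lemma poly_i2_smult: "poly_i2 (smult c g) = fa_const c * poly_i2 g"
proof (induction g)
  case (pCons d g)
  have "fa_const c * (i2 * poly_i2 g) = i2 * (fa_const c * poly_i2 g)"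
    by (metis fa_const_central mult.assoc)
  then show ?case using pCons by (simp add: poly_i2_pCons fa_const_simps distrib_left)
qed (simp add: poly_i2_0)

lemma poly_i2_mult: "poly_i2 (g * h) = poly_i2 g * poly_i2 h"
proof (induction g)
  case (pCons c g)
  then show ?case
    by (simp add: mult_pCons_left poly_i2_add poly_i2_smult poly_i2_pCons fa_const_simps distrib_right mult.assoc)
qed (simp add: poly_i2_0)

lemma poly_i2_diff: "poly_i2 (g - h) = poly_i2 g - poly_i2 h"
  using poly_i2_add[of "g - h" h] by (simp add: algebra_simps)

lemma poly_i2_sum: "poly_i2 (sum g S) = (\<Sum>s\<in>S. poly_i2 (g s))"
  by (induction S rule: infinite_finite_induct) (simp_all add: poly_i2_0 poly_i2_add)

lemma poly_i2_monom: "poly_i2 (monom c i) = fa_const c * i2 ^ i"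
proof (induction i)
  case (Suc i)
  have "i2 * (fa_const c * i2 ^ i) = fa_const c * i2 ^ Suc i"
    unfolding power_Suc mult.assoc[symmetric] fa_const_central[of c i2] ..
  then show ?case using Suc by (simp add: monom_Suc poly_i2_pCons fa_const_simps)
qed (simp add: monom_0 poly_i2_const)

lemma pcompose_linear_linear: "(f :: 'a::comm_ring_1 poly) \<circ>\<^sub>p [:0, c:] \<circ>\<^sub>p [:0, d:] = f \<circ>\<^sub>p [:0, c * d:]"
  by (simp add: pcompose_pCons mult.commute flip: pcompose_assoc)

lemma monom_pcompose_linear: "monom 1 l \<circ>\<^sub>p [:0, c:] = smult (c ^ l) (monom (1::'a::comm_ring_1) l)"
  by (intro poly_eqI) (simp add: coeff_pcompose_linear)

locale cyclic_presentation = prim_root n z for n and z :: "'a::field" +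
  fixes a b :: 'a
  assumes a_nz: "a \<noteq> 0" and b_nz: "b \<noteq> 0" and n_nz: "of_nat n \<noteq> (0::'a)"
begin

definition rels :: "(cyclic_gen, 'a) free_algebra set" where
  "rels = {i1 ^ n - fa_const b, i2 ^ n - fa_const a, i1 * i2 - fa_const z * i2 * i1}"

definition q where "q = monom 1 n - [:a:]"

lemma degree_q: "degree q = n" and q_nz: "q \<noteq> 0"
proof -
  have c: "coeff q n = 1" using n_pos by (simp add: q_def coeff_pCons split: nat.splits)
  have "degree q \<le> n" unfolding q_def by (intro degree_diff_le) (auto simp: degree_monom_le)
  moreover have "degree q \<ge> n" using c by (intro le_degree) simp
  ultimately show "degree q = n" by simp
  show "q \<noteq> 0" using c by auto
qed

lemma degree_mod_q: "degree (g mod q) < n"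
  using degree_mod_less[OF q_nz, of g] degree_q n_pos by auto

lemma small_multiple: "q dvd g \<Longrightarrow> degree g < n \<Longrightarrow> g = 0"
  using dvd_imp_degree_le[of q g] degree_q by (cases "g = 0") auto

abbreviation "cls \<equiv> alg_class rels"
lemmas sel = presented_algebra_sel[of rels]

lemma cls_mult: "cls x = cls x' \<Longrightarrow> cls y = cls y' \<Longrightarrow> cls (x * y) = cls (x' * y')"
proof -
  assume "cls x = cls x'" "cls y = cls y'"
  then have "cls x \<otimes>\<^bsub>presented_algebra rels\<^esub> cls y = cls x' \<otimes>\<^bsub>presented_algebra rels\<^esub> cls y'" by (simp only:)
  then show ?thesis by (simp only: sel(2))
qed

lemma cls_add: "cls x = cls x' \<Longrightarrow> cls y = cls y' \<Longrightarrow> cls (x + y) = cls (x' + y')"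
proof -
  assume "cls x = cls x'" "cls y = cls y'"
  then have "cls x \<oplus>\<^bsub>presented_algebra rels\<^esub> cls y = cls x' \<oplus>\<^bsub>presented_algebra rels\<^esub> cls y'" by (simp only:)
  then show ?thesis by (simp only: sel(5))
qed

lemma cls_sum: "(\<And>s. s \<in> S \<Longrightarrow> cls (f s) = cls (g s)) \<Longrightarrow> cls (sum f S) = cls (sum g S)"
proof (induction S rule: infinite_finite_induct)
  case (insert s S)
  then have "cls (f s + sum f S) = cls (g s + sum g S)" by (intro cls_add) simp_all
  then show ?case using insert.hyps by simp
qed simp_all

lemma cls_relations:
  "cls (i1 ^ n) = cls (fa_const b)" "cls (i2 ^ n) = cls (fa_const a)" "cls (i1 * i2) = cls (fa_const z * i2 * i1)"
  unfolding sel(7) by (rule rel_ideal_closed(6); simp add: rels_def)+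

lemma cls_q: "cls (poly_i2 q) = cls 0"
proof -
  have "cls (i2 ^ n + - fa_const a) = cls (fa_const a + - fa_const a)" by (rule cls_add[OF cls_relations(2) HOL.refl])
  moreover have "poly_i2 q = i2 ^ n + - fa_const a"
    unfolding q_def poly_i2_diff poly_i2_monom poly_i2_const fa_const_simps(2) by simp
  ultimately show ?thesis by (simp only: right_minus)
qed

lemma cls_mod_q: "cls (poly_i2 (g mod q)) = cls (poly_i2 g)"
proof -
  have "cls (poly_i2 (g div q) * poly_i2 q + poly_i2 (g mod q)) = cls (poly_i2 (g div q) * 0 + poly_i2 (g mod q))"
    by (rule cls_add[OF cls_mult[OF HOL.refl cls_q] HOL.refl])
  then have "cls (poly_i2 (g div q * q + g mod q)) = cls (poly_i2 (g mod q))"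
    by (simp only: poly_i2_mult poly_i2_add mult_zero_right add_0_left)
  then show ?thesis by (simp only: div_mult_mod_eq)
qed

text \<open>The rule for moving i1 past i2 propagates through the Horner form: i1 crosses k[i2] at
  the cost of the substitution T \<mapsto> zT.\<close>

lemma cls_i1_poly: "cls (i1 * poly_i2 g) = cls (poly_i2 (g \<circ>\<^sub>p [:0, z:]) * i1)"
proof (induction g)
  case 0
  then show ?case by (simp add: poly_i2_0)
next
  case (pCons c g)
  have "i1 * poly_i2 (pCons c g) = fa_const c * i1 + (i1 * i2) * poly_i2 g"
    by (simp add: poly_i2_pCons distrib_left mult.assoc fa_const_central)
  also have "cls \<dots> = cls (fa_const c * i1 + (fa_const z * i2 * i1) * poly_i2 g)"
    by (rule cls_add[OF HOL.refl cls_mult[OF cls_relations(3) HOL.refl]])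
  also have "\<dots> = cls (fa_const c * i1 + (fa_const z * i2) * (i1 * poly_i2 g))" by (simp only: mult.assoc)
  also have "\<dots> = cls (fa_const c * i1 + (fa_const z * i2) * (poly_i2 (g \<circ>\<^sub>p [:0, z:]) * i1))"
    by (rule cls_add[OF HOL.refl cls_mult[OF HOL.refl pCons(2)]])
  also have "fa_const c * i1 + (fa_const z * i2) * (poly_i2 (g \<circ>\<^sub>p [:0, z:]) * i1) =
      poly_i2 ([:c:] + [:0, z:] * (g \<circ>\<^sub>p [:0, z:])) * i1"
  proof -
    have "poly_i2 [:0, z:] = fa_const z * i2"
      by (simp add: poly_i2_pCons poly_i2_0 fa_const_simps fa_const_central[of z i2])
    then show ?thesis by (simp only: poly_i2_add poly_i2_mult poly_i2_const distrib_right mult.assoc)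
  qed
  finally show ?case by (simp add: pcompose_pCons)
qed

text \<open>Combinations of powers of i1 with coefficients from k[i2] on the left. Once the C j are
  reduced modulo q, they show that the n^2 monomials i2^i i1^j span the algebra.\<close>

definition N where "N C = (\<Sum>j<n. poly_i2 (C j) * i1 ^ j)"

lemma normal_form_aux: "\<exists>C. cls x = cls (N C)"
proof (induction x rule: free_algebra_induct)
  case one
  define C0 :: "nat \<Rightarrow> 'a poly" where "C0 j = (if j = 0 then 1 else 0)" for j
  have "N C0 = (\<Sum>j<n. if j = 0 then 1 else 0)"
    unfolding N_def C0_def by (intro sum.cong) (auto simp: poly_i2_1 poly_i2_0)
  also have "\<dots> = 1" using n_pos by simp
  finally show ?case by (intro exI[of _ C0]) simp
next
  case (add x y)
  then obtain C D where "cls x = cls (N C)" "cls y = cls (N D)" by blast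
  then have "cls (x + y) = cls (N C + N D)" by (rule cls_add)
  also have "N C + N D = N (\<lambda>j. C j + D j)" by (simp add: N_def poly_i2_add distrib_right sum.distrib)
  finally show ?case by blast
next
  case (scale c x)
  then obtain C where "cls x = cls (N C)" by blast
  then have "cls (fa_const c * x) = cls (fa_const c * N C)" by (rule cls_mult[OF HOL.refl])
  also have "fa_const c * N C = N (\<lambda>j. smult c (C j))" by (simp add: N_def poly_i2_smult sum_distrib_left mult.assoc)
  finally show ?case by blast
next
  case (gen g x)
  then obtain C where C: "cls x = cls (N C)" by blast
  show ?case
  proof (cases g)
    case I2
    have "cls (i2 * x) = cls (i2 * N C)" using C by (rule cls_mult[OF HOL.refl])
    also have "i2 * N C = N (\<lambda>j. pCons 0 (C j))"
      by (simp add: N_def poly_i2_pCons fa_const_simps sum_distrib_left mult.assoc)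
    finally show ?thesis using I2 by blast
  next
    case I1
    obtain m where m: "n = Suc m" using n_pos by (cases n) auto
    define D where "D j = C j \<circ>\<^sub>p [:0, z:]" for j
    \<comment> \<open>Multiplication by i1 shifts the coefficients up by one; the top one returns to
      position 0 with the factor i1^n = b.\<close>
    define C' where "C' j = (case j of 0 \<Rightarrow> smult b (D m) | Suc i \<Rightarrow> D i)" for j
    have "cls (i1 * x) = cls (i1 * N C)" using C by (rule cls_mult[OF HOL.refl])
    also have "i1 * N C = (\<Sum>j<n. (i1 * poly_i2 (C j)) * i1 ^ j)" by (simp add: N_def sum_distrib_left mult.assoc)
    also have "cls \<dots> = cls (\<Sum>j<n. (poly_i2 (D j) * i1) * i1 ^ j)"
      unfolding D_def by (rule cls_sum) (rule cls_mult[OF cls_i1_poly HOL.refl])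
    also have "(\<Sum>j<n. (poly_i2 (D j) * i1) * i1 ^ j) = (\<Sum>j<m. poly_i2 (D j) * i1 ^ Suc j) + poly_i2 (D m) * i1 ^ n"
      by (simp add: m mult.assoc)
    also have "cls \<dots> = cls ((\<Sum>j<m. poly_i2 (D j) * i1 ^ Suc j) + poly_i2 (D m) * fa_const b)"
      by (rule cls_add[OF HOL.refl cls_mult[OF HOL.refl cls_relations(1)]])
    also have "(\<Sum>j<m. poly_i2 (D j) * i1 ^ Suc j) + poly_i2 (D m) * fa_const b = N C'"
      unfolding N_def unfolding m by (subst sum.lessThan_Suc_shift) (simp add: C'_def poly_i2_smult fa_const_central)
    finally show ?thesis using I1 by blast
  qed
qed

lemma normal_form: "\<exists>C. (\<forall>j. degree (C j) < n) \<and> cls x = cls (N C)"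
proof -
  obtain C where "cls x = cls (N C)" using normal_form_aux by blast
  also have "cls (N C) = cls (N (\<lambda>j. C j mod q))"
    unfolding N_def by (rule cls_sum) (rule cls_mult[OF cls_mod_q[symmetric] HOL.refl])
  finally show ?thesis using degree_mod_q by (intro exI[of _ "\<lambda>j. C j mod q"]) simp
qed

lemma N_expand:
  assumes "\<And>j. degree (C j) < n"
  shows "N C = (\<Sum>(i, j)\<in>idx n. fa_const (coeff (C j) i) * (i2 ^ i * i1 ^ j))"
proof -
  have "C j = (\<Sum>i<n. monom (coeff (C j) i) i)" for j
  proof -
    have "C j = (\<Sum>i\<le>degree (C j). monom (coeff (C j) i) i)" by (simp add: poly_as_sum_of_monoms)
    also have "\<dots> = (\<Sum>i<n. monom (coeff (C j) i) i)"
      using assms[of j] by (intro sum.mono_neutral_left) (auto simp: coeff_eq_0)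
    finally show ?thesis .
  qed
  then have "poly_i2 (C j) = (\<Sum>i<n. fa_const (coeff (C j) i) * i2 ^ i)" for j
    by (metis (no_types, lifting) poly_i2_monom poly_i2_sum sum.cong)
  then have "N C = (\<Sum>j<n. \<Sum>i<n. fa_const (coeff (C j) i) * (i2 ^ i * i1 ^ j))"
    by (simp add: N_def sum_distrib_right mult.assoc)
  also have "\<dots> = (\<Sum>i<n. \<Sum>j<n. fa_const (coeff (C j) i) * (i2 ^ i * i1 ^ j))" by (rule sum.swap)
  finally show ?thesis by (simp add: sum.cartesian_product)
qed

lemma cyclic_algebra_eq: "cyclic_algebra n a b z = presented_algebra rels"
  by (simp add: cyclic_algebra_def rels_def)

end

section \<open>Splitting from a norm\<close>

text \<open>The quotient of the free algebra is mapped to the endomorphisms of \<open>k[T]/(T\<^sup>n - a)\<close>: \<open>i\<^sub>2\<close> acts as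
  multiplication by \<open>T\<close> and \<open>i\<^sub>1\<close> as \<open>g(T) \<mapsto> f(T) g(zT)\<close>.\<close>

locale norm_splitting = cyclic_presentation n z a b for n and z :: "'a::field" and a b +
  fixes f :: "'a poly"
  assumes norm: "q dvd (\<Prod>j<n. f \<circ>\<^sub>p [:0, z ^ j:]) - [:b:]"
begin

fun act_letter :: "cyclic_gen \<Rightarrow> 'a poly \<Rightarrow> 'a poly" where
  "act_letter I1 g = f * (g \<circ>\<^sub>p [:0, z:])"
| "act_letter I2 g = [:0, 1:] * g"

fun act_word :: "cyclic_gen free_monoid \<Rightarrow> 'a poly \<Rightarrow> 'a poly" where
  "act_word (Word w) g = foldr act_letter w g"

definition act :: "(cyclic_gen, 'a) free_algebra \<Rightarrow> 'a poly \<Rightarrow> 'a poly" where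
  "act x g = (\<Sum>m\<in>Poly_Mapping.keys x. smult (Poly_Mapping.lookup x m) (act_word m g))"

lemma act_letter_linear: "act_letter l (g + h) = act_letter l g + act_letter l h"
  "act_letter l (smult c g) = smult c (act_letter l g)" "act_letter l 0 = 0"
  by (cases l; simp add: pcompose_add pcompose_smult distrib_left)+

lemma act_letter_sum: "act_letter l (sum g S) = (\<Sum>s\<in>S. act_letter l (g s))"
  by (induction S rule: infinite_finite_induct) (simp_all add: act_letter_linear)

lemma act_single: "act (Poly_Mapping.single m c) g = smult c (act_word m g)"
  by (simp add: act_def)

lemma act_add: "act (x + y) g = act x g + act y g"
  unfolding act_def by (rule setsum_keys_plus_distrib) (simp_all add: smult_add_left)

lemma act_0: "act 0 g = 0" by (simp add: act_def)

lemma act_sum: "act (sum x S) g = (\<Sum>s\<in>S. act (x s) g)"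
  by (induction S rule: infinite_finite_induct) (simp_all add: act_0 act_add)

lemma act_gen: "act (fa_gen l * x) g = act_letter l (act x g)"
proof -
  have s: "fa_gen l * Poly_Mapping.single (Word w) c = Poly_Mapping.single (Word (l # w)) c" for w and c :: 'a
    by (simp add: fa_gen_def mult_single)
  have 1: "act (fa_gen l * Poly_Mapping.single m c) g = act_letter l (act (Poly_Mapping.single m c) g)" for m c
    by (cases m) (simp add: s act_single act_letter_linear)
  show ?thesis
    by (subst (1 2) free_algebra_expand[of x]) (simp add: sum_distrib_left act_sum 1 act_letter_sum)
qed

lemma act_scale: "act (fa_const c * x) g = smult c (act x g)"
proof -
  have 1: "act (fa_const c * Poly_Mapping.single m d) g = smult c (act (Poly_Mapping.single m d) g)" for m d
    by (simp add: fa_const_single act_single)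
  have 2: "smult c (sum h S) = (\<Sum>s\<in>S. smult c (h s))" for h :: "'s \<Rightarrow> 'a poly" and S
    by (induction S rule: infinite_finite_induct) (simp_all add: smult_add_right)
  show ?thesis
    by (subst (1 2) free_algebra_expand[of x]) (simp add: sum_distrib_left act_sum 1 2)
qed

lemma act_1: "act 1 g = g"
proof -
  have eq: "(1 :: (cyclic_gen, 'a) free_algebra) = Poly_Mapping.single (Word []) 1"
    by (metis single_one zero_free_monoid_def)
  show ?thesis by (subst eq) (simp add: act_single)
qed

lemma act_mult: "act (x * y) g = act x (act y g)"
  by (induction x rule: free_algebra_induct)
    (simp_all add: act_1 act_add act_scale act_gen distrib_right mult.assoc)

lemma act_linear: "act x (g + h) = act x g + act x h" "act x (smult c g) = smult c (act x g)"
proof -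
  show "act x (g + h) = act x g + act x h"
    by (induction x rule: free_algebra_induct)
      (simp_all add: act_1 act_add act_scale act_gen act_letter_linear smult_add_right)
  show "act x (smult c g) = smult c (act x g)"
    by (induction x rule: free_algebra_induct)
      (simp_all add: act_1 act_add act_scale act_gen act_letter_linear smult_add_right mult.commute)
qed

lemma act_sum_right: "act x (sum g S) = (\<Sum>s\<in>S. act x (g s))"
proof -
  have "act x 0 = 0" using act_linear(2)[of x 0 0] by simp
  then show ?thesis by (induction S rule: infinite_finite_induct) (simp_all add: act_linear)
qed

text \<open>Since z^n = 1, q is invariant under T \<mapsto> zT, so the action preserves the ideal of
  q and descends to k[T]/(q).\<close>

lemma act_dvd: "q dvd g \<Longrightarrow> q dvd act x g"
proof (induction x rule: free_algebra_induct)
  case (gen l x)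
  then obtain h where h: "act x g = q * h" by blast
  have "q \<circ>\<^sub>p [:0, z:] = q"
    by (simp add: q_def pcompose_diff monom_pcompose_linear Z_n)
  then have "act_letter I1 (q * h) = q * (f * (h \<circ>\<^sub>p [:0, z:]))"
    by (simp add: pcompose_mult mult.left_commute)
  moreover have "act_letter I2 (q * h) = q * ([:0, 1:] * h)"
    by (simp only: act_letter.simps mult.left_commute)
  ultimately show ?case unfolding act_gen h by (cases l) (simp_all only: dvd_triv_left)
qed (simp_all add: act_1 act_add act_scale dvd_smult)

lemma act_poly: "act (poly_i2 C) g = C * g"
proof (induction C)
  case (pCons c C)
  have "act (fa_const c) g = smult c g" using act_scale[of c 1 g] by (simp add: act_1)
  then show ?case using pCons by (simp add: poly_i2_pCons act_add act_gen)
qed (simp add: poly_i2_0 act_0)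

text \<open>Partial norms of f: i1^j acts as g(T) \<mapsto> Fp j * g(z^j T), and Fp n is b modulo
  q.\<close>

definition Fp where "Fp j = (\<Prod>t<j. f \<circ>\<^sub>p [:0, z ^ t:])"

lemma Fp_Suc: "Fp (Suc j) = f * (Fp j \<circ>\<^sub>p [:0, z:])"
  unfolding Fp_def by (subst prod.lessThan_Suc_shift) (simp add: pcompose_prod pcompose_linear_linear mult.commute pcompose_idR)

lemma act_i1_pow: "act (i1 ^ j) g = Fp j * (g \<circ>\<^sub>p [:0, z ^ j:])"
proof (induction j)
  case 0
  then show ?case by (simp add: Fp_def act_1 pcompose_idR)
next
  case (Suc j)
  then show ?case
    by (simp add: act_gen Fp_Suc pcompose_mult pcompose_linear_linear mult.assoc mult.commute[of z])
qed

lemma act_rel_ideal: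
  assumes "x \<in> rel_ideal rels" shows "q dvd act x g"
proof -
  define K where "K = {x. \<forall>g. q dvd act x g}"
  have diff: "act (x - y) g = act x g - act y g" for x y g
    using act_add[of "x - y" y g] by (simp add: algebra_simps)
  have const: "act (fa_const c) g = smult c g" for c g using act_scale[of c 1 g] by (simp add: act_1)
  have "rel_ideal rels \<subseteq> K"
  proof (rule rel_ideal_minimal)
    have 1: "q dvd act (i1 ^ n - fa_const b) g" for g
    proof -
      have "act (i1 ^ n - fa_const b) g = (Fp n - [:b:]) * g"
        by (simp add: diff const act_i1_pow Z_n pcompose_idR left_diff_distrib)
      then show ?thesis using norm by (simp add: Fp_def)
    qed
    have 2: "q dvd act (i2 ^ n - fa_const a) g" for g
    proof -
      have "act (i2 ^ n - fa_const a) g = q * g"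
        using act_poly[of "monom 1 n" g] by (simp add: diff const poly_i2_monom fa_const_simps q_def left_diff_distrib)
      then show ?thesis by simp
    qed
    have 3: "q dvd act (i1 * i2 - fa_const z * i2 * i1) g" for g
    proof -
      have i: "act i1 h = act_letter I1 h" "act i2 h = act_letter I2 h" for h
        using act_gen[of _ 1 h] by (simp_all add: act_1)
      have "act (i1 * i2 - fa_const z * i2 * i1) g = 0"
        by (simp add: diff act_mult const i pcompose_pCons pcompose_mult algebra_simps)
      then show ?thesis by simp
    qed
    show "rels \<subseteq> K" unfolding rels_def K_def using 1 2 3 by blast
    show "0 \<in> K" by (simp add: K_def act_0)
    show "x + y \<in> K" if "x \<in> K" "y \<in> K" for x y using that by (simp add: K_def act_add)
    show "r * x \<in> K" if "x \<in> K" for x r using that by (simp add: K_def act_mult act_dvd)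
    show "x * r \<in> K" if "x \<in> K" for x r using that by (simp add: K_def act_mult)
  qed
  then show ?thesis using assms by (auto simp: K_def)
qed

lemma act_N_zero:
  assumes C: "\<And>j. degree (C j) < n" and zero: "\<And>g. q dvd act (N C) g" and t: "t < n"
  shows "C t = 0"
proof -
  define S where "S l = (\<Sum>j<n. smult ((z ^ j) ^ l) (C j * Fp j))" for l
  have S: "q dvd S l" if "l < n" for l
  proof -
    have "act (N C) (monom 1 l) = monom 1 l * S l"
      by (simp add: N_def S_def act_sum act_mult act_poly act_i1_pow monom_pcompose_linear sum_distrib_left mult_ac)
    then have "q dvd monom 1 l * S l" using zero[of "monom 1 l"] by simp
    then have "q dvd monom 1 (n - l) * (monom 1 l * S l)" by (rule dvd_mult)
    also have "monom 1 (n - l) * (monom 1 l * S l) = monom 1 n * S l"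
      using that by (simp add: mult.assoc[symmetric] mult_monom)
    also have "\<dots> = q * S l + smult a (S l)" by (simp add: q_def left_diff_distrib)
    finally have "q dvd smult a (S l)" by (simp add: dvd_add_right_iff)
    then show ?thesis using a_nz by (rule dvd_smult_cancel)
  qed
  \<comment> \<open>The exponent n - t acts as -t, so that the sum over l picks out the index j =
    t.\<close>
  have "q dvd (\<Sum>l<n. smult ((z ^ (n - t)) ^ l) (S l))" using S by (intro dvd_sum dvd_smult) auto
  also have "(\<Sum>l<n. smult ((z ^ (n - t)) ^ l) (S l)) = (\<Sum>l<n. \<Sum>j<n. smult ((z ^ (j + (n - t))) ^ l) (C j * Fp j))"
  proof -
    have "smult c (sum h T) = (\<Sum>s\<in>T. smult c (h s))" for h :: "nat \<Rightarrow> 'a poly" and T c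
      by (induction T rule: infinite_finite_induct) (simp_all add: smult_add_right)
    then show ?thesis by (simp add: S_def power_add power_mult_distrib mult.commute)
  qed
  also have "\<dots> = (\<Sum>j<n. smult (\<Sum>l<n. (z ^ (j + (n - t))) ^ l) (C j * Fp j))"
    by (subst sum.swap) (simp add: smult_sum)
  also have "\<dots> = (\<Sum>j<n. if j = t then smult (of_nat n) (C t * Fp t) else 0)"
  proof (intro sum.cong HOL.refl)
    fix j assume "j \<in> {..<n}"
    have "n dvd j + (n - t) \<longleftrightarrow> j = t"
    proof
      assume "n dvd j + (n - t)"
      then obtain d where d: "j + (n - t) = n * d" by blast
      have "0 < j + (n - t)" "j + (n - t) < n * 2" using t \<open>j \<in> {..<n}\<close> by auto
      then have "0 < d" "d < 2" using d by (auto intro: Nat.gr0I)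
      then have "d = 1" by simp
      then show "j = t" using d t by simp
    qed (use t in simp)
    then show "smult (\<Sum>l<n. (z ^ (j + (n - t))) ^ l) (C j * Fp j) = (if j = t then smult (of_nat n) (C t * Fp t) else 0)"
      by (simp add: orthogonality)
  qed
  also have "\<dots> = smult (of_nat n) (C t * Fp t)" using t by simp
  finally have "q dvd C t * Fp t" using n_nz by (rule dvd_smult_cancel)
  moreover have "Fp t dvd Fp n" unfolding Fp_def using t by (intro prod_dvd_prod_subset) auto
  ultimately have "q dvd C t * Fp n" by (meson dvd_trans mult_dvd_mono dvd_refl)
  moreover have "q dvd C t * (Fp n - [:b:])" using norm by (simp add: Fp_def)
  ultimately have "q dvd C t * Fp n - C t * (Fp n - [:b:])" by (rule dvd_diff)
  then have "q dvd smult b (C t)" by (simp add: algebra_simps)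
  then have "q dvd C t" using b_nz by (rule dvd_smult_cancel)
  then show ?thesis using C by (rule small_multiple)
qed

lemma rel_ideal_iff: "x \<in> rel_ideal rels \<longleftrightarrow> (\<forall>g. q dvd act x g)"
proof
  assume x: "\<forall>g. q dvd act x g"
  obtain C where C: "\<And>j. degree (C j) < n" "cls x = cls (N C)" using normal_form by blast
  have "x - N C \<in> rel_ideal rels" using C(2) sel(7) by blast
  then have d: "q dvd act (x - N C) g" for g by (rule act_rel_ideal)
  have dN: "q dvd act (N C) g" for g
  proof -
    have "act x g = act (x - N C) g + act (N C) g" using act_add[of "x - N C" "N C" g] by simp
    then show ?thesis using x d[of g] by (metis dvd_add_right_iff)
  qed
  have "C j = 0" if "j < n" for j by (rule act_N_zero[where C = C, OF C(1) dN that])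
  then have "N C = 0" by (simp add: N_def poly_i2_0)
  then have "cls x = cls 0" using C(2) by simp
  then show "x \<in> rel_ideal rels" by (simp add: sel(7))
qed (use act_rel_ideal in blast)

text \<open>The matrix of x on k[T]/(q) in the basis 1, T, ..., T^(n-1).\<close>

definition mat where "mat x = (\<lambda>(i, j)\<in>idx n. coeff (act x (monom 1 j) mod q) i)"

lemma matI: "(\<And>i j. (i, j) \<in> idx n \<Longrightarrow> mat x (i, j) = v (i, j)) \<Longrightarrow> mat x = restrict v (idx n)"
  by (auto simp: mat_def restrict_def fun_eq_iff)

lemma mat_add: "(i, j) \<in> idx n \<Longrightarrow> mat (x + y) (i, j) = mat x (i, j) + mat y (i, j)"
  by (simp add: mat_def act_add poly_mod_add_left)

lemma mat_scale: "(i, j) \<in> idx n \<Longrightarrow> mat (fa_const c * x) (i, j) = c * mat x (i, j)"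
  by (simp add: mat_def act_scale mod_smult_left)

lemma mat_sum: "(i, j) \<in> idx n \<Longrightarrow> mat (sum x S) (i, j) = (\<Sum>s\<in>S. mat (x s) (i, j))"
  by (induction S rule: infinite_finite_induct) (simp_all add: mat_add, simp_all add: mat_def act_0)

lemma expand_small: "degree (g :: 'a poly) < n \<Longrightarrow> g = (\<Sum>i<n. smult (coeff g i) (monom 1 i))"
proof -
  assume "degree g < n"
  have "g = (\<Sum>i\<le>degree g. monom (coeff g i) i)" by (simp add: poly_as_sum_of_monoms)
  also have "\<dots> = (\<Sum>i<n. monom (coeff g i) i)"
    using \<open>degree g < n\<close> by (intro sum.mono_neutral_left) (auto simp: coeff_eq_0)
  moreover have "smult (coeff g i) (monom 1 i) = monom (coeff g i) i" for i by (simp add: smult_monom)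
  ultimately show ?thesis by (simp only:)
qed

lemma act_mod_cong: "g mod q = h mod q \<Longrightarrow> act x g mod q = act x h mod q"
proof -
  assume "g mod q = h mod q"
  then have "q dvd g - h" by (simp add: mod_eq_dvd_iff)
  then have "q dvd act x (g - h)" by (rule act_dvd)
  moreover have "act x g = act x (g - h) + act x h" using act_linear(1)[of x "g - h" h] by simp
  ultimately show ?thesis by (auto simp: poly_mod_add_left)
qed

lemma mat_mult: "(i, j) \<in> idx n \<Longrightarrow> mat (x * y) (i, j) = (\<Sum>l<n. mat x (i, l) * mat y (l, j))"
proof -
  assume ij: "(i, j) \<in> idx n"
  define g where "g = act y (monom 1 j) mod q"
  have g: "g = (\<Sum>l<n. smult (coeff g l) (monom 1 l))" unfolding g_def by (intro expand_small degree_mod_q)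
  have "act (x * y) (monom 1 j) mod q = act x g mod q"
    unfolding act_mult by (rule act_mod_cong) (simp add: g_def)
  also have "act x g = (\<Sum>l<n. smult (coeff g l) (act x (monom 1 l)))"
    by (subst g) (simp add: act_sum_right act_linear)
  also have "\<dots> mod q = (\<Sum>l<n. smult (coeff g l) (act x (monom 1 l) mod q))"
  proof -
    have "sum h T mod q = (\<Sum>s\<in>T. h s mod q)" for h :: "nat \<Rightarrow> 'a poly" and T
      by (induction T rule: infinite_finite_induct) (simp_all add: poly_mod_add_left)
    then show ?thesis by (simp add: mod_smult_left)
  qed
  finally have "coeff (act (x * y) (monom 1 j) mod q) i = (\<Sum>l<n. coeff g l * coeff (act x (monom 1 l) mod q) i)"
    by (simp add: coeff_sum)
  then show ?thesis using ij by (simp add: mat_def g_def mult.commute)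
qed

lemma mat_1: "mat 1 = (\<lambda>(i, j)\<in>idx n. if i = j then 1 else 0)"
proof -
  have "monom (1::'a) j mod q = monom 1 j" if "j < n" for j
    using that degree_q by (intro mod_poly_less) (simp add: degree_monom_eq)
  then show ?thesis by (intro ext) (auto simp: mat_def act_1)
qed

lemma mat_zero_iff: "(\<forall>ij\<in>idx n. mat x ij = 0) \<longleftrightarrow> x \<in> rel_ideal rels"
proof
  assume zero: "\<forall>ij\<in>idx n. mat x ij = 0"
  have T: "act x (monom 1 j) mod q = 0" if "j < n" for j
  proof -
    have "coeff (act x (monom 1 j) mod q) i = 0" for i
      using zero that degree_mod_q[of "act x (monom 1 j)"] by (cases "i < n") (auto simp: mat_def coeff_eq_0)
    then show ?thesis by (intro poly_eqI) simp
  qed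
  have "q dvd act x g" for g
  proof -
    have "act x g mod q = act x (g mod q) mod q" by (rule act_mod_cong) simp
    also have "g mod q = (\<Sum>l<n. smult (coeff (g mod q) l) (monom 1 l))" by (intro expand_small degree_mod_q)
    finally have "act x g mod q = (\<Sum>l<n. smult (coeff (g mod q) l) (act x (monom 1 l))) mod q"
      by (simp add: act_sum_right act_linear)
    moreover have "q dvd (\<Sum>l<n. smult (coeff (g mod q) l) (act x (monom 1 l)))"
      using T by (intro dvd_sum dvd_smult) (auto simp: mod_eq_0_iff_dvd)
    ultimately show ?thesis by (simp add: mod_eq_0_iff_dvd)
  qed
  then show "x \<in> rel_ideal rels" by (simp add: rel_ideal_iff)
next
  assume "x \<in> rel_ideal rels"
  then have "act x g mod q = 0" for g by (simp add: rel_ideal_iff mod_eq_0_iff_dvd)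
  then show "\<forall>ij\<in>idx n. mat x ij = 0" by (auto simp: mat_def)
qed

lemma mat_eq_iff: "mat x = mat y \<longleftrightarrow> x - y \<in> rel_ideal rels"
proof -
  have d: "mat x ij = mat (x - y) ij + mat y ij" if "ij \<in> idx n" for ij
    using mat_add[of "fst ij" "snd ij" "x - y" y] that by simp
  have "mat x = mat y \<longleftrightarrow> (\<forall>ij\<in>idx n. mat x ij = mat y ij)"
    by (auto simp: mat_def restrict_def fun_eq_iff)
  also have "\<dots> \<longleftrightarrow> (\<forall>ij\<in>idx n. mat (x - y) ij = 0)" using d by (intro ball_cong) auto
  finally show ?thesis by (simp only: mat_zero_iff)
qed

text \<open>A dimension count: U and the n^2 matrices of the i2^i i1^j are n^2 + 1 vectors in a
  space of dimension n^2, hence dependent. U must occur in the relation because the others are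
  independent by \<open>act_N_zero\<close>.\<close>

lemma mat_surj: assumes U: "U \<in> idx n \<rightarrow>\<^sub>E UNIV" shows "\<exists>x. mat x = U"
proof -
  define W :: "nat \<times> nat \<Rightarrow> (cyclic_gen, 'a) free_algebra" where "W ij = i2 ^ fst ij * i1 ^ snd ij" for ij
  \<comment> \<open>\<open>None\<close> stands for the target U and \<open>Some (i, j)\<close> for
    the monomial i2^i i1^j.\<close>
  define A where "A s = (case s of None \<Rightarrow> U | Some ij \<Rightarrow> mat (W ij))" for s
  let ?J = "insert None (Some ` idx n)"
  have "card ?J = Suc (card (idx n))" by (subst card_insert_disjoint) (auto simp: card_image)
  then obtain c where c: "\<exists>s\<in>?J. c s \<noteq> 0" "\<And>ij. ij \<in> idx n \<Longrightarrow> (\<Sum>s\<in>?J. c s * A s ij) = 0"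
    using linear_system_nontrivial[of "idx n" ?J A] by auto
  have split: "(\<Sum>s\<in>?J. c s * A s ij) = c None * U ij + (\<Sum>s\<in>idx n. c (Some s) * mat (W s) ij)" for ij
    by (subst sum.insert) (auto simp: A_def sum.reindex)
  have comb: "mat (\<Sum>s\<in>idx n. fa_const (d s) * W s) ij = (\<Sum>s\<in>idx n. d s * mat (W s) ij)"
    if "ij \<in> idx n" for d ij
    using that by (cases ij) (simp add: mat_sum mat_scale del: mem_Sigma_iff)
  have "c None \<noteq> 0"
  proof
    assume c0: "c None = 0"
    define C where "C j = (if j < n then \<Sum>i<n. monom (c (Some (i, j))) i else 0)" for j
    have dC: "degree (C j) < n" for j unfolding C_def
      using n_pos degree_monom_le by (auto intro!: degree_sum_less intro: le_less_trans)
    have coeff_C: "coeff (C j) i = c (Some (i, j))" if "i < n" "j < n" for i j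
      using that by (simp add: C_def coeff_sum if_distrib[of "\<lambda>x. x = _"] cong: if_cong)
    have "N C = (\<Sum>s\<in>idx n. fa_const (c (Some s)) * W s)"
      unfolding N_expand[OF dC] by (intro sum.cong) (auto simp: coeff_C W_def)
    then have "mat (N C) ij = 0" if "ij \<in> idx n" for ij
      using c(2)[OF that] comb[OF that] c0 by (simp add: split)
    then have "N C \<in> rel_ideal rels" using mat_zero_iff by blast
    then have dN: "q dvd act (N C) g" for g by (rule act_rel_ideal)
    have "C j = 0" if "j < n" for j by (rule act_N_zero[where C = C, OF dC dN that])
    then have "c (Some (i, j)) = 0" if "i < n" "j < n" for i j using coeff_C[OF that] that by simp
    then show False using c(1) c0 by auto
  qed
  define x where "x = (\<Sum>s\<in>idx n. fa_const (- c (Some s) / c None) * W s)"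
  have "mat x ij = U ij" if "ij \<in> idx n" for ij
  proof -
    have "mat x ij = (\<Sum>s\<in>idx n. (- c (Some s) / c None) * mat (W s) ij)" unfolding x_def by (rule comb[OF that])
    also have "\<dots> = - (\<Sum>s\<in>idx n. c (Some s) * mat (W s) ij) / c None"
      by (simp add: sum_divide_distrib sum_negf)
    also have "(\<Sum>s\<in>idx n. c (Some s) * mat (W s) ij) = - (c None * U ij)"
      using c(2)[OF that] unfolding split by (simp add: eq_neg_iff_add_eq_0 add.commute)
    also have "- (- (c None * U ij)) / c None = U ij" using \<open>c None \<noteq> 0\<close> by simp
    finally show ?thesis .
  qed
  moreover have "mat x \<in> idx n \<rightarrow>\<^sub>E UNIV" by (simp add: mat_def)
  ultimately have "mat x = U" using U by (intro PiE_ext[of _ "idx n" "\<lambda>_. UNIV"]) auto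
  then show ?thesis by blast
qed

text \<open>The equivalence is witnessed by 1 x 1 matrices over the algebra, read through their
  entry at (0, 0), against n x n matrices over k.\<close>

lemma splits: "trivial_in_Br (cyclic_algebra n a b z)"
proof -
  let ?A = "presented_algebra rels" and ?B = "base_algebra :: ('a, 'a) module"
  interpret A: ring ?A by (rule ring_presented_algebra)
  note mA = matrix_algebra_sel[of 1 ?A] and mB = matrix_base_algebra_sel
  define rep where "rep V = (SOME x. V = cls x)" for V
  define h where "h U = mat (rep (U (0, 0)))" for U :: "nat \<times> nat \<Rightarrow> _"
  have rep: "mat (rep (cls x)) = mat x" for x
  proof -
    have "cls x = cls (rep (cls x))" unfolding rep_def by (rule someI[of _ x]) simp
    then show ?thesis using sel(7) mat_eq_iff by metis
  qed
  have idx1: "idx 1 = {(0, 0)}" by auto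
  have ex: "\<exists>x. U (0, 0) = cls x" if "U \<in> carrier (matrix_algebra 1 ?A)" for U
    using that unfolding mA idx1 sel(1) by (auto simp: PiE_def Pi_def)
  have mult: "(U \<otimes>\<^bsub>matrix_algebra 1 ?A\<^esub> V) (0, 0) = U (0, 0) \<otimes>\<^bsub>?A\<^esub> V (0, 0)"
    if "U \<in> carrier (matrix_algebra 1 ?A)" "V \<in> carrier (matrix_algebra 1 ?A)" for U V
  proof -
    have "U (0, 0) \<otimes>\<^bsub>?A\<^esub> V (0, 0) \<in> carrier ?A"
      using ex[OF that(1)] ex[OF that(2)] by (auto simp: sel(1,2))
    then show ?thesis unfolding mA by (simp add: lessThan_Suc)
  qed
  have "h \<in> ring_iso (matrix_algebra 1 ?A) (matrix_algebra n ?B)"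
  proof (rule ring_iso_memI)
    fix U V assume UV: "U \<in> carrier (matrix_algebra 1 ?A)" "V \<in> carrier (matrix_algebra 1 ?A)"
    obtain x y where xy: "U (0, 0) = cls x" "V (0, 0) = cls y" using ex UV by metis
    show "h (U \<otimes>\<^bsub>matrix_algebra 1 ?A\<^esub> V) = h U \<otimes>\<^bsub>matrix_algebra n ?B\<^esub> h V"
      unfolding h_def mult[OF UV] xy sel(2) rep mB by (rule matI) (auto simp: mat_mult)
    have "(U \<oplus>\<^bsub>matrix_algebra 1 ?A\<^esub> V) (0, 0) = cls (x + y)" unfolding mA by (simp add: xy sel(5))
    then show "h (U \<oplus>\<^bsub>matrix_algebra 1 ?A\<^esub> V) = h U \<oplus>\<^bsub>matrix_algebra n ?B\<^esub> h V"
      unfolding h_def xy mB by (simp only: rep) (rule matI, auto simp: mat_add)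
  next
    fix U assume "U \<in> carrier (matrix_algebra 1 ?A)"
    show "h U \<in> carrier (matrix_algebra n ?B)" unfolding h_def mB by (simp add: mat_def)
  next
    have "\<one>\<^bsub>matrix_algebra 1 ?A\<^esub> (0, 0) = cls 1" unfolding mA by (simp add: sel(3))
    then show "h \<one>\<^bsub>matrix_algebra 1 ?A\<^esub> = \<one>\<^bsub>matrix_algebra n ?B\<^esub>"
      unfolding h_def mB by (simp only: rep mat_1)
  next
    show "bij_betw h (carrier (matrix_algebra 1 ?A)) (carrier (matrix_algebra n ?B))"
    proof (rule bij_betwI')
      fix U V assume UV: "U \<in> carrier (matrix_algebra 1 ?A)" "V \<in> carrier (matrix_algebra 1 ?A)"
      obtain x y where xy: "U (0, 0) = cls x" "V (0, 0) = cls y" using ex UV by metis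
      have "U = V \<longleftrightarrow> U (0, 0) = V (0, 0)"
        using UV unfolding mA idx1 by (auto intro: PiE_ext)
      then show "h U = h V \<longleftrightarrow> U = V"
        unfolding h_def xy rep mat_eq_iff by (simp add: xy sel(7))
    next
      fix U assume "U \<in> carrier (matrix_algebra 1 ?A)"
      show "h U \<in> carrier (matrix_algebra n ?B)" unfolding h_def mB by (simp add: mat_def)
    next
      fix V assume "V \<in> carrier (matrix_algebra n ?B)"
      then obtain x where x: "mat x = V" using mat_surj unfolding mB by blast
      define U where "U = (\<lambda>ij\<in>idx 1. cls x)"
      have "U \<in> carrier (matrix_algebra 1 ?A)" unfolding mA U_def sel(1) by auto
      moreover have "h U = V" unfolding h_def U_def using rep[of x] x by simp
      ultimately show "\<exists>U\<in>carrier (matrix_algebra 1 ?A). V = h U" by blast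
    qed
  qed
  moreover have "h (c \<odot>\<^bsub>matrix_algebra 1 ?A\<^esub> U) = c \<odot>\<^bsub>matrix_algebra n ?B\<^esub> h U"
    if "U \<in> carrier (matrix_algebra 1 ?A)" for c U
  proof -
    obtain x where x: "U (0, 0) = cls x" using ex[OF \<open>U \<in> _\<close>] by blast
    have "(c \<odot>\<^bsub>matrix_algebra 1 ?A\<^esub> U) (0, 0) = cls (fa_const c * x)" unfolding mA by (simp add: x sel(6))
    then show ?thesis
      unfolding h_def x mB by (simp only: rep) (rule matI, auto simp: mat_scale)
  qed
  ultimately have "algebra_iso (matrix_algebra 1 ?A) (matrix_algebra n ?B)"
    unfolding algebra_iso_def by blast
  then show ?thesis
    unfolding trivial_in_Br_def brauer_equivalent_def cyclic_algebra_eq using n_pos zero_less_one by blast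
qed

end

section \<open>A norm from a splitting\<close>

locale split_cyclic_algebra = cyclic_presentation n z a b for n and z :: "'a::field" and a b +
  fixes m r :: nat and h :: "(nat \<times> nat \<Rightarrow> (cyclic_gen, 'a) free_algebra set) \<Rightarrow> nat \<times> nat \<Rightarrow> 'a"
  assumes m_pos: "m > 0" and r_pos: "r > 0"
    and iso: "h \<in> ring_iso (matrix_algebra m (presented_algebra rels)) (matrix_algebra r base_algebra)"
    and scale: "U \<in> carrier (matrix_algebra m (presented_algebra rels)) \<Longrightarrow>
      h (c \<odot>\<^bsub>matrix_algebra m (presented_algebra rels)\<^esub> U) = c \<odot>\<^bsub>matrix_algebra r base_algebra\<^esub> h U"
    and irreducible: "g dvd q \<Longrightarrow> degree g < n \<Longrightarrow> degree g = 0"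
begin

abbreviation "MA \<equiv> matrix_algebra m (presented_algebra rels)"
abbreviation "MB \<equiv> matrix_algebra r (base_algebra :: ('a, 'a) module)"

lemmas mA = matrix_algebra_sel[of m "presented_algebra rels"]
lemmas mB = matrix_base_algebra_sel[where 'a = 'a, of r]

lemma finsum_cls: "finite S \<Longrightarrow> finsum (presented_algebra rels) (\<lambda>s. cls (f s)) S = cls (sum f S)"
proof (induction S rule: finite_induct)
  case empty
  interpret ring "presented_algebra rels" by (rule ring_presented_algebra)
  show ?case by (simp add: sel(4))
next
  case (insert s S)
  interpret ring "presented_algebra rels" by (rule ring_presented_algebra)
  have "finsum (presented_algebra rels) (\<lambda>s. cls (f s)) (insert s S)
      = cls (f s) \<oplus>\<^bsub>presented_algebra rels\<^esub> finsum (presented_algebra rels) (\<lambda>s. cls (f s)) S"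
    using insert.hyps by (intro finsum_insert) (auto simp: sel(1))
  then show ?case using insert by (simp add: sel(5))
qed

text \<open>Matrices over the algebra are handled through representatives in the free algebra.\<close>

definition mcls :: "(nat \<times> nat \<Rightarrow> (cyclic_gen, 'a) free_algebra) \<Rightarrow> nat \<times> nat \<Rightarrow> (cyclic_gen, 'a) free_algebra set" where
  "mcls x = (\<lambda>ij\<in>idx m. cls (x ij))"

lemma mcls_in: "mcls x \<in> carrier MA"
  unfolding mA sel(1) mcls_def by auto

lemma mcls_surj: assumes "U \<in> carrier MA" shows "\<exists>x. U = mcls x"
proof -
  have "\<exists>x. U ij = cls x" if "ij \<in> idx m" for ij
    using PiE_mem[OF assms[unfolded mA sel(1)] that] by blast
  then have "\<forall>ij\<in>idx m. \<exists>x. U ij = cls x" by blast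
  then obtain x where "\<forall>ij\<in>idx m. U ij = cls (x ij)" by metis
  then have "U = mcls x" using assms unfolding mA mcls_def by (intro PiE_ext[of U "idx m"]) (auto simp: sel(1))
  then show ?thesis by blast
qed

lemma mcls_add: "mcls x \<oplus>\<^bsub>MA\<^esub> mcls y = mcls (\<lambda>ij. x ij + y ij)"
  unfolding mA mcls_def by (intro ext) (simp add: sel(5))

lemma mcls_scale: "c \<odot>\<^bsub>MA\<^esub> mcls x = mcls (\<lambda>ij. fa_const c * x ij)"
  unfolding mA mcls_def by (intro ext) (simp add: sel(6))

lemma mcls_mult: "mcls x \<otimes>\<^bsub>MA\<^esub> mcls y = mcls (\<lambda>(i, j). \<Sum>l<m. x (i, l) * y (l, j))"
proof
  fix ij :: "nat \<times> nat"
  obtain i j where ij: "ij = (i, j)" by force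
  show "(mcls x \<otimes>\<^bsub>MA\<^esub> mcls y) ij = mcls (\<lambda>(i, j). \<Sum>l<m. x (i, l) * y (l, j)) ij"
  proof (cases "(i, j) \<in> idx m")
    case True
    interpret ring "presented_algebra rels" by (rule ring_presented_algebra)
    have "(mcls x \<otimes>\<^bsub>MA\<^esub> mcls y) ij
        = finsum (presented_algebra rels) (\<lambda>l. mcls x (i, l) \<otimes>\<^bsub>presented_algebra rels\<^esub> mcls y (l, j)) {..<m}"
      using True unfolding mA ij by simp
    also have "\<dots> = finsum (presented_algebra rels) (\<lambda>l. cls (x (i, l) * y (l, j))) {..<m}"
      using True by (intro finsum_cong') (auto simp: mcls_def sel(1,2))
    finally show ?thesis using True by (simp add: finsum_cls mcls_def ij)
  qed (auto simp: mA mcls_def ij)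
qed

lemma mcls_one: "\<one>\<^bsub>MA\<^esub> = mcls (\<lambda>(i, j). if i = j then 1 else 0)"
  unfolding mA mcls_def by (intro ext) (auto simp: sel(3,4))

lemma mcls_cong: "(\<And>ij. ij \<in> idx m \<Longrightarrow> cls (x ij) = cls (y ij)) \<Longrightarrow> mcls x = mcls y"
  unfolding mcls_def by (intro restrict_ext)

definition unit_mat :: "nat \<Rightarrow> nat \<Rightarrow> (cyclic_gen, 'a) free_algebra \<Rightarrow> nat \<times> nat \<Rightarrow> (cyclic_gen, 'a) free_algebra" where
  "unit_mat u v x ij = (if ij = (u, v) then x else 0)"

text \<open>The image in M_r(k) of x times the matrix unit at (u, v); \<open>h_expand\<close>
  recovers h from these pieces.\<close>

definition G where "G u v x = h (mcls (unit_mat u v x))"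

lemma h_add: "ij \<in> idx r \<Longrightarrow> h (mcls (\<lambda>ij. x ij + y ij)) ij = h (mcls x) ij + h (mcls y) ij"
  using ring_iso_memE(3)[OF iso mcls_in mcls_in, of x y] by (simp add: mcls_add mB(4))

lemma h_zero: assumes "ij \<in> idx r" shows "h (mcls (\<lambda>_. 0)) ij = 0"
  using h_add[OF assms, of "\<lambda>_. 0" "\<lambda>_. 0"] by (simp only: add_0_left add_cancel_right_right)

lemma h_mult: "(i, j) \<in> idx r \<Longrightarrow>
    h (mcls (\<lambda>(i, j). \<Sum>l<m. x (i, l) * y (l, j))) (i, j) = (\<Sum>l<r. h (mcls x) (i, l) * h (mcls y) (l, j))"
  using ring_iso_memE(2)[OF iso mcls_in mcls_in, of x y] by (simp add: mcls_mult mB(2))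

lemma G_add: "ij \<in> idx r \<Longrightarrow> G u v (x + y) ij = G u v x ij + G u v y ij"
proof -
  assume ij: "ij \<in> idx r"
  have "unit_mat u v (x + y) = (\<lambda>ij. unit_mat u v x ij + unit_mat u v y ij)" by (auto simp: unit_mat_def)
  then show ?thesis using h_add[OF ij] by (simp add: G_def)
qed

lemma G_zero: "ij \<in> idx r \<Longrightarrow> G u v 0 ij = 0"
  using G_add[of ij u v 0 0] by (simp only: add_0_left add_cancel_right_right)

lemma G_sum: "ij \<in> idx r \<Longrightarrow> G u v (sum x S) ij = (\<Sum>s\<in>S. G u v (x s) ij)"
  by (induction S rule: infinite_finite_induct) (simp_all add: G_zero G_add del: mem_Sigma_iff)

lemma G_scale: "ij \<in> idx r \<Longrightarrow> G u v (fa_const c * x) ij = c * G u v x ij"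
proof -
  assume ij: "ij \<in> idx r"
  have "unit_mat u v (fa_const c * x) = (\<lambda>ij. fa_const c * unit_mat u v x ij)" by (auto simp: unit_mat_def)
  then have "G u v (fa_const c * x) = c \<odot>\<^bsub>MB\<^esub> h (mcls (unit_mat u v x))"
    using scale[OF mcls_in] by (simp add: G_def mcls_scale)
  then show ?thesis using ij by (simp add: mB(5) G_def)
qed

lemma G_cong: "cls x = cls y \<Longrightarrow> G u v x = G u v y"
  unfolding G_def by (intro arg_cong[of _ _ h] mcls_cong) (simp add: unit_mat_def)

lemma G_mult:
  assumes "(i, j) \<in> idx r" "u < m" "v < m" "w < m" "t < m"
  shows "(\<Sum>l<r. G u v x (i, l) * G w t y (l, j)) = (if v = w then G u t (x * y) (i, j) else 0)"
proof -
  have "(\<Sum>l<m. unit_mat u v x (i, l) * unit_mat w t y (l, j)) = unit_mat u t (if v = w then x * y else 0) (i, j)" for i j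
  proof -
    have "(\<Sum>l<m. unit_mat u v x (i, l) * unit_mat w t y (l, j))
        = (\<Sum>l<m. if l = v then unit_mat u t (if v = w then x * y else 0) (i, j) else 0)"
      by (intro sum.cong) (auto simp: unit_mat_def)
    then show ?thesis using assms(3) by simp
  qed
  then have "(\<lambda>(i, j). \<Sum>l<m. unit_mat u v x (i, l) * unit_mat w t y (l, j)) = unit_mat u t (if v = w then x * y else 0)"
    by (intro ext) auto
  then have "h (mcls (unit_mat u t (if v = w then x * y else 0))) (i, j) = (\<Sum>l<r. G u v x (i, l) * G w t y (l, j))"
    using h_mult[OF assms(1), of "unit_mat u v x" "unit_mat w t y"] by (simp add: G_def)
  then show ?thesis using G_zero[OF assms(1)] by (cases "v = w") (simp_all add: G_def)
qed

lemma h_expand: assumes ij: "ij \<in> idx r" shows "h (mcls x) ij = (\<Sum>(u, v)\<in>idx m. G u v (x (u, v)) ij)"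
proof -
  have "h (mcls (\<lambda>uv. if uv \<in> S then x uv else 0)) ij = (\<Sum>(u, v)\<in>S. G u v (x (u, v)) ij)" if "finite S" for S
    using that
  proof (induction S rule: finite_induct)
    case empty
    then show ?case using h_zero[OF ij] by simp
  next
    case (insert s S)
    obtain u v where s: "s = (u, v)" by force
    have "(\<lambda>uv. if uv \<in> insert s S then x uv else 0) = (\<lambda>uv. unit_mat u v (x (u, v)) uv + (if uv \<in> S then x uv else 0))"
      using insert.hyps by (auto simp: s unit_mat_def)
    then show ?case using insert h_add[OF ij, of "unit_mat u v (x (u, v))"] by (simp add: s G_def)
  qed
  from this[of "idx m"] have "h (mcls (\<lambda>uv. if uv \<in> idx m then x uv else 0)) ij = (\<Sum>(u, v)\<in>idx m. G u v (x (u, v)) ij)" by simp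
  moreover have "mcls (\<lambda>uv. if uv \<in> idx m then x uv else 0) = mcls x" by (intro mcls_cong) simp
  ultimately show ?thesis by simp
qed

lemma G_normal_form:
  "\<exists>c. \<forall>u v. \<forall>ij\<in>idx r. G u v x ij = (\<Sum>s\<in>idx n. c s * G u v (i2 ^ fst s * i1 ^ snd s) ij)"
proof -
  obtain C where C: "\<And>j. degree (C j) < n" "cls x = cls (N C)" using normal_form by blast
  have "G u v x ij = (\<Sum>s\<in>idx n. coeff (C (snd s)) (fst s) * G u v (i2 ^ fst s * i1 ^ snd s) ij)"
    if "ij \<in> idx r" for u v ij
    unfolding G_cong[OF C(2)] N_expand[OF C(1)] case_prod_unfold G_sum[OF that] G_scale[OF that] ..
  then show ?thesis by (intro exI[of _ "\<lambda>s. coeff (C (snd s)) (fst s)"] allI ballI) assumption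
qed

text \<open>The \<open>r\<^sup>2\<close> unit matrices are spanned by the images of the \<open>m\<^sup>2n\<^sup>2\<close> elements
  \<open>i\<^sub>2\<^sup>i i\<^sub>1\<^sup>j\<close> placed at single matrix positions.\<close>

lemma r_le: "r \<le> m * n"
proof (rule ccontr)
  assume "\<not> r \<le> m * n"
  then have "m * n < r" by simp
  then have "(m * n) * (m * n) < r * r" by (intro mult_strict_mono) auto
  then have card: "card (idx m \<times> idx n) < card (idx r)" by (simp add: mult.assoc mult.left_commute)
  define e :: "nat \<times> nat \<Rightarrow> nat \<times> nat \<Rightarrow> 'a" where "e p = (\<lambda>ij\<in>idx r. if ij = p then 1 else 0)" for p
  have "\<forall>p. \<exists>t. \<forall>ij\<in>idx r. e p ij = (\<Sum>s\<in>idx m \<times> idx n. t s * G (fst (fst s)) (snd (fst s)) (i2 ^ fst (snd s) * i1 ^ snd (snd s)) ij)"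
  proof
    fix p
    have "e p \<in> carrier MB" by (auto simp: mB e_def)
    moreover have "h ` carrier MA = carrier MB" using ring_iso_memE(5)[OF iso] unfolding bij_betw_def by (rule conjunct2)
    ultimately have "e p \<in> h ` carrier MA" by (simp only:)
    then obtain U where U: "e p = h U" "U \<in> carrier MA" by (rule imageE)
    obtain x where x: "U = mcls x" using mcls_surj[OF U(2)] by (rule exE)
    have "\<forall>uv. \<exists>c. \<forall>u v. \<forall>ij\<in>idx r. G u v (x uv) ij = (\<Sum>s\<in>idx n. c s * G u v (i2 ^ fst s * i1 ^ snd s) ij)"
      by (rule allI, rule G_normal_form)
    from choice[OF this] obtain c where H: "\<forall>uv u v. \<forall>ij\<in>idx r. G u v (x uv) ij = (\<Sum>s\<in>idx n. c uv s * G u v (i2 ^ fst s * i1 ^ snd s) ij)" ..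
    have c: "G u v (x uv) ij = (\<Sum>s\<in>idx n. c uv s * G u v (i2 ^ fst s * i1 ^ snd s) ij)" if "ij \<in> idx r" for uv u v ij
      by (rule H[rule_format, OF that])
    have "e p ij = (\<Sum>s\<in>idx m \<times> idx n. c (fst s) (snd s) * G (fst (fst s)) (snd (fst s)) (i2 ^ fst (snd s) * i1 ^ snd (snd s)) ij)"
      if ij: "ij \<in> idx r" for ij
    proof -
      have "e p ij = (\<Sum>uv\<in>idx m. G (fst uv) (snd uv) (x uv) ij)"
        unfolding U(1) x h_expand[OF ij] case_prod_unfold prod.collapse ..
      also have "\<dots> = (\<Sum>uv\<in>idx m. \<Sum>s\<in>idx n. c uv s * G (fst uv) (snd uv) (i2 ^ fst s * i1 ^ snd s) ij)"
        by (simp only: c[OF ij])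
      finally show ?thesis by (simp only: sum.cartesian_product case_prod_unfold)
    qed
    then show "\<exists>t. \<forall>ij\<in>idx r. e p ij = (\<Sum>s\<in>idx m \<times> idx n. t s * G (fst (fst s)) (snd (fst s)) (i2 ^ fst (snd s) * i1 ^ snd (snd s)) ij)"
      by (intro exI[of _ "\<lambda>s. c (fst s) (snd s)"] ballI) assumption
  qed
  from choice[OF this] obtain t where H: "\<forall>p. \<forall>ij\<in>idx r.
      e p ij = (\<Sum>s\<in>idx m \<times> idx n. t p s * G (fst (fst s)) (snd (fst s)) (i2 ^ fst (snd s) * i1 ^ snd (snd s)) ij)" ..
  have t: "e p ij = (\<Sum>s\<in>idx m \<times> idx n. t p s * G (fst (fst s)) (snd (fst s)) (i2 ^ fst (snd s) * i1 ^ snd (snd s)) ij)"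
    if "ij \<in> idx r" for p ij by (rule H[rule_format, OF that])
  \<comment> \<open>There are more unit matrices than spanning elements, so a nontrivial combination
    c of their coordinate vectors vanishes. The same combination of unit matrices is then zero,
    which forces c = 0.\<close>
  obtain c where c: "\<exists>p\<in>idx r. c p \<noteq> 0" "\<forall>s\<in>idx m \<times> idx n. (\<Sum>p\<in>idx r. c p * t p s) = 0"
    using linear_system_nontrivial[of "idx m \<times> idx n" "idx r" t] card by auto
  have "c ij = 0" if ij: "ij \<in> idx r" for ij
  proof -
    let ?H = "\<lambda>s. G (fst (fst s)) (snd (fst s)) (i2 ^ fst (snd s) * i1 ^ snd (snd s)) ij"
    have "c ij = (\<Sum>p\<in>idx r. if p = ij then c p else 0)" using ij by (simp add: sum.delta)
    also have "\<dots> = (\<Sum>p\<in>idx r. c p * e p ij)" using ij by (intro sum.cong) (auto simp: e_def)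
    also have "\<dots> = (\<Sum>p\<in>idx r. \<Sum>s\<in>idx m \<times> idx n. (c p * t p s) * ?H s)"
      by (simp only: t[OF ij] sum_distrib_left mult.assoc)
    also have "\<dots> = (\<Sum>s\<in>idx m \<times> idx n. \<Sum>p\<in>idx r. (c p * t p s) * ?H s)" by (rule sum.swap)
    also have "\<dots> = (\<Sum>s\<in>idx m \<times> idx n. (\<Sum>p\<in>idx r. c p * t p s) * ?H s)" by (simp only: sum_distrib_right)
    also have "\<dots> = 0" using c(2) by (intro sum.neutral) auto
    finally show ?thesis .
  qed
  then show False using c(1) by blast
qed

text \<open>The action through h of x times a matrix unit on column vectors of length r. Vectors are
  functions on all natural numbers, and the value 0 beyond r lets products of actions be compared as
  functions.\<close>

definition T where "T u v x \<xi> i = (if i < r then \<Sum>j<r. G u v x (i, j) * \<xi> j else 0)"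

lemma T_add: "T u v (x + y) \<xi> i = T u v x \<xi> i + T u v y \<xi> i"
  by (simp add: T_def G_add distrib_right sum.distrib)

lemma T_scale: "T u v (fa_const c * x) \<xi> i = c * T u v x \<xi> i"
  by (simp add: T_def G_scale sum_distrib_left mult.assoc)

lemma T_zero: "T u v 0 \<xi> i = 0"
  by (simp add: T_def G_zero)

lemma T_sum: "T u v (sum x S) \<xi> i = (\<Sum>s\<in>S. T u v (x s) \<xi> i)"
  by (induction S rule: infinite_finite_induct) (simp_all add: T_zero T_add)

lemma T_cong: "cls x = cls y \<Longrightarrow> T u v x = T u v y"
proof -
  assume "cls x = cls y"
  then have eq: "G u v x = G u v y" by (rule G_cong)
  show ?thesis by (intro ext) (simp only: T_def eq)
qed

lemma T_linear: "T u v x (\<lambda>j. \<Sum>s\<in>S. c s * \<xi> s j) i = (\<Sum>s\<in>S. c s * T u v x (\<xi> s) i)"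
proof (cases "i < r")
  case True
  have "(\<Sum>j<r. G u v x (i, j) * (\<Sum>s\<in>S. c s * \<xi> s j)) = (\<Sum>j<r. \<Sum>s\<in>S. c s * (G u v x (i, j) * \<xi> s j))"
    by (simp add: sum_distrib_left mult.left_commute)
  also have "\<dots> = (\<Sum>s\<in>S. \<Sum>j<r. c s * (G u v x (i, j) * \<xi> s j))" by (rule sum.swap)
  finally show ?thesis using True by (simp add: T_def sum_distrib_left)
qed (simp add: T_def)

lemma T_mult:
  assumes "u < m" "v < m" "w < m" "t < m"
  shows "T u v x (T w t y \<xi>) i = (if v = w then T u t (x * y) \<xi> i else 0)"
proof (cases "i < r")
  case True
  have "(\<Sum>j<r. G u v x (i, j) * T w t y \<xi> j) = (\<Sum>j<r. \<Sum>l<r. G u v x (i, j) * G w t y (j, l) * \<xi> l)"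
    by (simp add: T_def sum_distrib_left mult.assoc)
  also have "\<dots> = (\<Sum>l<r. (\<Sum>j<r. G u v x (i, j) * G w t y (j, l)) * \<xi> l)"
    by (subst sum.swap) (simp add: sum_distrib_right)
  also have "\<dots> = (\<Sum>l<r. (if v = w then G u t (x * y) (i, l) else 0) * \<xi> l)"
    using True G_mult[OF _ assms] by (intro sum.cong) auto
  finally show ?thesis using True by (simp add: T_def)
qed (simp add: T_def)

lemma T_mult_same: "u < m \<Longrightarrow> v < m \<Longrightarrow> t < m \<Longrightarrow> T u v x (T v t y \<xi>) = T u t (x * y) \<xi>"
  by (intro ext) (simp add: T_mult)

lemma T_identity: assumes "i < r" shows "(\<Sum>u<m. T u u 1 \<xi> i) = \<xi> i"
proof -
  have G1: "(\<Sum>u<m. G u u 1 (i, j)) = (if i = j then 1 else 0)" if "j < r" for j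
  proof -
    have ij: "(i, j) \<in> idx r" using assms that by simp
    have "(\<Sum>(u, v)\<in>idx m. G u v (if u = v then 1 else 0) (i, j)) = h \<one>\<^bsub>MA\<^esub> (i, j)"
      unfolding mcls_one h_expand[OF ij] by (simp add: case_prod_unfold)
    also have "\<dots> = (if i = j then 1 else 0)" using ij by (simp add: ring_iso_memE(4)[OF iso] mB(3))
    finally have *: "(\<Sum>u<m. \<Sum>v<m. G u v (if u = v then 1 else 0) (i, j)) = (if i = j then 1 else 0)"
      by (simp only: sum.cartesian_product)
    have "(\<Sum>v<m. G u v (if u = v then 1 else 0) (i, j)) = G u u 1 (i, j)" if "u < m" for u
    proof -
      have "(\<Sum>v<m. G u v (if u = v then 1 else 0) (i, j)) = (\<Sum>v<m. if v = u then G u u 1 (i, j) else 0)"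
        using G_zero[OF ij] by (intro sum.cong) auto
      then show ?thesis using that by simp
    qed
    then show ?thesis using * by simp
  qed
  have "(\<Sum>u<m. T u u 1 \<xi> i) = (\<Sum>j<r. (\<Sum>u<m. G u u 1 (i, j)) * \<xi> j)"
    using assms by (simp add: T_def sum_distrib_right) (rule sum.swap)
  also have "\<dots> = (\<Sum>j<r. if j = i then \<xi> i else 0)" using G1 by (intro sum.cong) auto
  finally show ?thesis using assms by simp
qed

lemma norm_condition_holds: "norm_condition n z a b"
proof -
  obtain \<xi> i0 where \<xi>: "T 0 0 1 \<xi> = \<xi>" and i0: "\<xi> i0 \<noteq> 0"
  proof -
    define e where "e = (\<lambda>j::nat. if j = 0 then 1 else (0::'a))"
    have "(\<Sum>u<m. T u u 1 e 0) \<noteq> 0" using T_identity[OF r_pos, of e] by (simp add: e_def)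
    then obtain u where u: "u < m" "T u u 1 e 0 \<noteq> 0" by (meson lessThan_iff sum.neutral)
    \<comment> \<open>Some diagonal matrix unit E_uu does not kill the first basis vector. Moving
      that vector to position 0 by E_0u gives a nonzero result, because E_u0 takes it back to its
      E_uu-part. The vectors fixed by E_00 form a module over the cyclic algebra.\<close>
    define \<xi> where "\<xi> = T 0 u 1 e"
    have "T 0 0 1 \<xi> = \<xi>" using T_mult_same[of 0 0 u 1 1 e] m_pos u by (simp add: \<xi>_def)
    moreover have "\<exists>i. \<xi> i \<noteq> 0"
    proof (rule ccontr)
      assume "\<nexists>i. \<xi> i \<noteq> 0"
      then have "T u 0 1 \<xi> 0 = 0" by (simp add: T_def)
      then show False using T_mult_same[of u 0 u 1 1 e] m_pos u by (simp add: \<xi>_def)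
    qed
    ultimately show thesis using that by blast
  qed
  define op where "op x \<eta> = T 0 0 x \<eta>" for x and \<eta> :: "nat \<Rightarrow> 'a"
  have op_mult: "op x (op y \<eta>) = op (x * y) \<eta>" for x y \<eta>
    unfolding op_def using m_pos by (intro T_mult_same)
  have op_add: "op (x + y) \<eta> i = op x \<eta> i + op y \<eta> i" for x y \<eta> i unfolding op_def by (rule T_add)
  have op_scale: "op (fa_const c * x) \<eta> i = c * op x \<eta> i" for c x \<eta> i unfolding op_def by (rule T_scale)
  have op_0: "op 0 \<eta> i = 0" for \<eta> i unfolding op_def by (rule T_zero)
  have op_cong: "op x = op y" if "cls x = cls y" for x y unfolding op_def using T_cong[OF that] by simp
  have op_zero_right: "op x (\<lambda>_. 0) = (\<lambda>_. 0)" for x by (simp add: op_def T_def fun_eq_iff)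
  have op_1: "op 1 \<xi> = \<xi>" using \<xi> by (simp add: op_def)
  have op_const: "op (fa_const c) \<xi> i = c * \<xi> i" for c i using op_scale[of c 1 \<xi> i] op_1 by simp
  define ann where "ann g \<longleftrightarrow> op (poly_i2 g) \<xi> = (\<lambda>_. 0)" for g
  have ann_mult: "ann (s * g)" if "ann g" for s g
    using that op_mult[of "poly_i2 s" "poly_i2 g" \<xi>] by (simp add: ann_def poly_i2_mult op_zero_right)
  have ann_q: "ann q" unfolding ann_def op_cong[OF cls_q] by (simp add: op_0 fun_eq_iff)
  have ann_add: "ann (g + h)" if "ann g" "ann h" for g h
    using that by (simp add: ann_def poly_i2_add op_add fun_eq_iff)
  have ann_mod: "ann (s mod g)" if "ann s" "ann g" for s g
  proof -
    have "s mod g = s + (- (s div g)) * g" by (simp add: minus_div_mult_eq_mod[symmetric])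
    then show ?thesis by (simp only: ann_add[OF that(1) ann_mult[OF that(2)]])
  qed
  \<comment> \<open>The polynomials annihilating \<xi> form an ideal that contains q but no nonzero
    constant. By irreducibility of q, its nonzero elements have degree at least n.\<close>
  have small: "g = 0" if g: "ann g" "degree g < n" for g
  proof (rule ccontr)
    assume "g \<noteq> 0"
    define P where "P g \<longleftrightarrow> ann g \<and> g \<noteq> 0" for g
    define k where "k = arg_min degree P"
    have "P g" using g \<open>g \<noteq> 0\<close> by (simp add: P_def)
    then have k: "P k" and kmin: "\<And>h. P h \<Longrightarrow> degree k \<le> degree h"
      unfolding k_def using arg_min_natI arg_min_nat_le by (metis, metis)
    have "q mod k = 0"
    proof (rule ccontr)
      assume nz: "q mod k \<noteq> 0"
      have "P (q mod k)" using ann_mod[OF ann_q, of k] k nz by (simp add: P_def)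
      then have "degree k \<le> degree (q mod k)" by (rule kmin)
      moreover have "degree (q mod k) < degree k" using degree_mod_less[of k q] k nz by (auto simp: P_def)
      ultimately show False by simp
    qed
    then have "k dvd q" by (simp add: mod_eq_0_iff_dvd)
    moreover have "degree k < n" using kmin[OF \<open>P g\<close>] g(2) by simp
    ultimately have "degree k = 0" by (rule irreducible)
    then obtain c where c: "k = [:c:]" by (rule degree_eq_zeroE)
    then have "c \<noteq> 0" using k by (auto simp: P_def)
    have "op (fa_const c) \<xi> i0 = 0" using k c by (simp add: P_def ann_def poly_i2_const)
    then show False using op_const[of c i0] i0 \<open>c \<noteq> 0\<close> by simp
  qed
  have ann_dvd: "q dvd g" if "ann g" for g
    using small[OF ann_mod[OF that ann_q] degree_mod_q] by (simp add: mod_eq_0_iff_dvd)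
  \<comment> \<open>The vectors w i \<xi> are \<xi>, i2 \<xi>, ..., i2^(n-1) \<xi> and, at index n,
    i1 \<xi>: one more than the dimension of the module allows.\<close>
  define w :: "nat \<Rightarrow> (cyclic_gen, 'a) free_algebra" where "w i = (if i < n then i2 ^ i else i1)" for i
  obtain d where d: "\<exists>i\<le>n. d i \<noteq> 0" "\<And>l. (\<Sum>i\<le>n. d i * op (w i) \<xi> l) = 0"
  proof -
    \<comment> \<open>Instead of computing the dimension of the module, all m copies of it are used:
      the m(n+1) vectors E_v0 (w i) \<xi> in k^r outnumber r, and E_0u applied to a relation between
      them extracts the part with v = u.\<close>
    let ?J = "{..<m} \<times> {..n}"
    have "card {..<r} < card ?J" using r_le m_pos by simp
    then obtain c where c: "\<exists>s\<in>?J. c s \<noteq> 0" "\<forall>l\<in>{..<r}. (\<Sum>s\<in>?J. c s * T (fst s) 0 (w (snd s)) \<xi> l) = 0"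
      using linear_system_nontrivial[of "{..<r}" ?J "\<lambda>s l. T (fst s) 0 (w (snd s)) \<xi> l"] by auto
    then obtain u i where ui: "u < m" "i \<le> n" "c (u, i) \<noteq> 0" by auto
    have zero: "(\<lambda>l. \<Sum>s\<in>?J. c s * T (fst s) 0 (w (snd s)) \<xi> l) = (\<lambda>_. 0)"
    proof
      fix l show "(\<Sum>s\<in>?J. c s * T (fst s) 0 (w (snd s)) \<xi> l) = 0"
        using c(2) by (cases "l < r") (auto simp: T_def)
    qed
    have "(\<Sum>i\<le>n. c (u, i) * op (w i) \<xi> l) = 0" for l
    proof -
      have "0 = T 0 u 1 (\<lambda>l. \<Sum>s\<in>?J. c s * T (fst s) 0 (w (snd s)) \<xi> l) l"
        unfolding zero by (simp add: T_def)
      also have "\<dots> = (\<Sum>s\<in>?J. c s * T 0 u 1 (T (fst s) 0 (w (snd s)) \<xi>) l)" by (rule T_linear)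
      also have "\<dots> = (\<Sum>s\<in>?J. c s * (if u = fst s then T 0 0 (w (snd s)) \<xi> l else 0))"
        using T_mult[OF m_pos ui(1) _ m_pos, of _ 1] by (intro sum.cong) auto
      also have "\<dots> = (\<Sum>v<m. \<Sum>i\<le>n. c (v, i) * (if u = v then T 0 0 (w i) \<xi> l else 0))"
        by (simp add: sum.cartesian_product case_prod_unfold)
      also have "\<dots> = (\<Sum>v<m. if v = u then (\<Sum>i\<le>n. c (u, i) * T 0 0 (w i) \<xi> l) else 0)"
        by (intro sum.cong) auto
      finally show ?thesis using ui(1) by (simp add: op_def)
    qed
    then show thesis using that[of "\<lambda>i. c (u, i)"] ui by blast
  qed
  define k where "k = (\<Sum>i<n. monom (d i) i)"
  have dk: "degree k < n" unfolding k_def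
    using n_pos degree_monom_le by (intro degree_sum_less) (auto intro: le_less_trans)
  have op_sum: "op (sum x S) \<eta> l = (\<Sum>s\<in>S. op (x s) \<eta> l)" for x :: "nat \<Rightarrow> _" and S \<eta> l
    unfolding op_def by (rule T_sum)
  have op_k: "op (poly_i2 k) \<xi> l = (\<Sum>i<n. d i * op (i2 ^ i) \<xi> l)" for l
    by (simp add: k_def poly_i2_sum poly_i2_monom op_sum op_scale)
  have rel: "op (poly_i2 k) \<xi> l + d n * op i1 \<xi> l = 0" for l
    using d(2)[of l] by (simp add: op_k w_def flip: lessThan_Suc_atMost)
  \<comment> \<open>Otherwise the polynomial \<open>k\<close>, of degree below n, would annihilate
    \<xi> and all d i would vanish.\<close>
  have dn: "d n \<noteq> 0"
  proof
    assume 0: "d n = 0"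
    then have "ann k" using rel by (simp add: ann_def fun_eq_iff)
    then have "k = 0" using dk by (rule small)
    moreover have "coeff k i = d i" if "i < n" for i
      using that by (simp add: k_def coeff_sum if_distrib[of "\<lambda>x. x = _"] cong: if_cong)
    ultimately have "d i = 0" if "i < n" for i using that by (metis coeff_0)
    then show False using d(1) 0 by (metis le_neq_implies_less)
  qed
  \<comment> \<open>Solving the relation for i1 \<xi>: this polynomial represents the element
    y.\<close>
  define f where "f = smult (- inverse (d n)) k"
  have op_i1: "op i1 \<xi> = op (poly_i2 f) \<xi>"
  proof
    fix l
    have "d n * op i1 \<xi> l = - op (poly_i2 k) \<xi> l" using rel[of l] by (simp add: eq_neg_iff_add_eq_0 add.commute)
    then have "op i1 \<xi> l = - inverse (d n) * op (poly_i2 k) \<xi> l" using dn by (simp add: field_simps)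
    then show "op i1 \<xi> l = op (poly_i2 f) \<xi> l" by (simp only: f_def poly_i2_smult op_scale)
  qed
  \<comment> \<open>Moving i1 past polynomials in i2 substitutes zT for T, so i1^j \<xi> is the j-th
    partial norm of f applied to \<xi>. At j = n the relation i1^n = b shows that the norm minus b
    annihilates \<xi>.\<close>
  define Fq where "Fq j = (\<Prod>t<j. f \<circ>\<^sub>p [:0, z ^ t:])" for j
  have Fq_Suc: "Fq (Suc j) = (Fq j \<circ>\<^sub>p [:0, z:]) * f" for j
    unfolding Fq_def
    by (subst prod.lessThan_Suc_shift) (simp add: pcompose_prod pcompose_linear_linear mult.commute pcompose_idR)
  have pow: "op (i1 ^ j) \<xi> = op (poly_i2 (Fq j)) \<xi>" for j
  proof (induction j)
    case 0
    then show ?case by (simp add: Fq_def poly_i2_1)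
  next
    case (Suc j)
    have "op (i1 ^ Suc j) \<xi> = op i1 (op (poly_i2 (Fq j)) \<xi>)" unfolding Suc[symmetric] op_mult by simp
    also have "\<dots> = op (poly_i2 (Fq j \<circ>\<^sub>p [:0, z:]) * i1) \<xi>" unfolding op_mult op_cong[OF cls_i1_poly] ..
    also have "\<dots> = op (poly_i2 (Fq j \<circ>\<^sub>p [:0, z:])) (op (poly_i2 f) \<xi>)" by (simp only: op_mult[symmetric] op_i1)
    finally show ?case by (simp only: op_mult Fq_Suc poly_i2_mult)
  qed
  have "op (poly_i2 (Fq n)) \<xi> = op (fa_const b) \<xi>" using pow[of n] op_cong[OF cls_relations(1)] by simp
  moreover have "poly_i2 (Fq n) = poly_i2 (Fq n - [:b:]) + fa_const b"
    by (simp add: poly_i2_diff poly_i2_const)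
  ultimately have "op (poly_i2 (Fq n - [:b:])) \<xi> i + op (fa_const b) \<xi> i = op (fa_const b) \<xi> i" for i
    by (metis op_add)
  then have "ann (Fq n - [:b:])" by (simp add: ann_def fun_eq_iff)
  then have "q dvd Fq n - [:b:]" by (rule ann_dvd)
  then show ?thesis unfolding norm_condition_def q_def Fq_def by blast
qed

end

context cyclic_presentation
begin

lemma trivial_if_norm_condition:
  assumes "norm_condition n z a b" shows "trivial_in_Br (cyclic_algebra n a b z)"
proof -
  obtain f where "q dvd (\<Prod>j<n. f \<circ>\<^sub>p [:0, z ^ j:]) - [:b:]" using assms by (auto simp: norm_condition_def q_def)
  then interpret norm_splitting n z a b f by unfold_locales
  show ?thesis by (rule splits)
qed

lemma norm_condition_if_trivial:
  assumes "\<And>g. g dvd q \<Longrightarrow> degree g < n \<Longrightarrow> degree g = 0" "trivial_in_Br (cyclic_algebra n a b z)"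
  shows "norm_condition n z a b"
proof -
  obtain m r where mr: "m > 0" "r > 0"
    "algebra_iso (matrix_algebra m (presented_algebra rels)) (matrix_algebra r (base_algebra :: ('a, 'a) module))"
    using assms(2) unfolding trivial_in_Br_def brauer_equivalent_def cyclic_algebra_eq by blast
  then obtain h where "h \<in> ring_iso (matrix_algebra m (presented_algebra rels)) (matrix_algebra r (base_algebra :: ('a, 'a) module))"
    "\<forall>c. \<forall>x\<in>carrier (matrix_algebra m (presented_algebra rels)).
      h (c \<odot>\<^bsub>matrix_algebra m (presented_algebra rels)\<^esub> x) = c \<odot>\<^bsub>matrix_algebra r base_algebra\<^esub> h x"
    unfolding algebra_iso_def by blast
  then interpret split_cyclic_algebra n z a b m r h
    using mr assms(1) by unfold_locales auto
  show ?thesis by (rule norm_condition_holds)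
qed

end

section \<open>The equivalence for a general exponent s\<close>

context phi14_setting
begin

lemma cyclic_presentation: "a \<noteq> 0 \<Longrightarrow> b \<noteq> 0 \<Longrightarrow> cyclic_presentation (p ^ 2) z a b"
  using z of_nat_nz by unfold_locales

lemma trivial_iff_norm_condition:
  assumes "\<And>c. c ^ p \<noteq> a" "a \<noteq> 0" "b \<noteq> 0"
  shows "trivial_in_Br (cyclic_algebra (p ^ 2) a b z) \<longleftrightarrow> norm_condition (p ^ 2) z a b"
proof -
  interpret cyclic_presentation "p ^ 2" z a b by (rule cyclic_presentation[OF assms(2,3)])
  \<comment> \<open>A nonconstant g has a root \<theta> in the closure, which is also a root of q.
    But q is the minimal polynomial of \<theta>, so g cannot have smaller degree.\<close>
  have "degree g = 0" if g: "g dvd q" "degree g < p ^ 2" for g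
  proof (rule ccontr)
    assume "degree g \<noteq> 0"
    then have "\<exists>\<theta>. poly (lift g) \<theta> = 0"
      by (intro alg_closed_imp_poly_has_root) (simp add: lift_simps)
    then obtain \<theta> where \<theta>: "poly (lift g) \<theta> = 0" ..
    obtain g' where "q = g * g'" using g(1) by blast
    then have "poly (lift q) \<theta> = 0" using \<theta> by (simp add: lift_simps)
    then have "\<theta> ^ (p ^ 2) = to_ac a" by (simp add: q_def lift_simps poly_monom)
    then interpret K: kummer "p ^ 2" "to_ac z" p k \<theta> by (rule kummer_base[OF _ assms(1)])
    have "lift g = 0" using \<theta> g(2) by (intro K.independent lift_simps) (simp_all add: lift_simps)
    then show False using \<open>degree g \<noteq> 0\<close> by (simp add: lift_simps)
  qed
  then show ?thesis using trivial_if_norm_condition norm_condition_if_trivial by blast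
qed

theorem realizable_iff:
  "realizable TYPE('a) (presented_group (phi14_relations p (wpow (gen Beta) s))) \<longleftrightarrow>
    (\<exists>a1 a2. independent_mod_powers p a1 a2 \<and> trivial_in_Br (cyclic_algebra (p ^ 2) a1 (z ^ s * a2) z))"
proof -
  have "z \<noteq> 0" using z prime_gt_0_nat[OF prime_p] by (auto simp: primitive_root_of_unity_def zero_power)
  then have "trivial_in_Br (cyclic_algebra (p ^ 2) a1 (z ^ s * a2) z) \<longleftrightarrow> norm_condition (p ^ 2) z a1 (z ^ s * a2)"
    if ind: "independent_mod_powers p a1 a2" for a1 a2
    using ind independent_not_power(1)[OF ind]
    by (intro trivial_iff_norm_condition) (auto simp: independent_mod_powers_def)
  then show ?thesis using realizable_if_norm_condition norm_condition_if_realizable by blast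
qed

end

theorem mainTheorem10:
  fixes p :: nat and z :: "'a::field"
  assumes "prime p" and "odd p" and "CHAR('a) \<noteq> p"
    and "primitive_root_of_unity (p ^ 2) z"
  shows "(realizable TYPE('a) (phi14_42 p) \<longleftrightarrow>
            (\<exists>a1 a2. independent_mod_powers p a1 a2 \<and>
              trivial_in_Br (cyclic_algebra (p ^ 2) a1 (z * a2) z)))
       \<and> (realizable TYPE('a) (phi14_321 p) \<longleftrightarrow>
            (\<exists>a1 a2. independent_mod_powers p a1 a2 \<and>
              trivial_in_Br (cyclic_algebra (p ^ 2) a1 (z ^ p * a2) z)))
       \<and> (realizable TYPE('a) (phi14_222 p) \<longleftrightarrow>
            (\<exists>a1 a2. independent_mod_powers p a1 a2 \<and>
              trivial_in_Br (cyclic_algebra (p ^ 2) a1 a2 z)))"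
proof -
  interpret phi14_setting p z using assms by unfold_locales
  have "wpow (gen Beta) 1 = gen Beta" "wpow (gen Beta) 0 = []" by (simp_all add: wpow_def)
  then show ?thesis
    using realizable_iff[of 1] realizable_iff[of p] realizable_iff[of 0]
    unfolding phi14_42_def phi14_321_def phi14_222_def by simp
qed

end
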